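(* A finite group $G$ is a $CD1$-group with $a_k=r^s$ for some prime $r$ and some positive integer $s$ if and only if one of the following cases holds: (1) $G$ is a $2$-group of central type with $|Z(G)|=2$ and $|G|=2^{2s+1}$ for some positive integer $s$; (2) $G$ is a doubly transitive Frobenius group of order $(2^n-1)2^n$, where $2^n-1=r$ is a Mersenne prime; (3) $G$ is a doubly transitive Frobenius group of order $(3^2-1)3^2=72$; (4) $G$ is a doubly transitive Frobenius group of order $(p-1)p$, where $p=2^n+1$ is a Fermat prime.
   Context: All groups are finite. Let $\mathrm{Irr}(G)=\{\chi_1,\dots,\chi_k\}$ be the set of complex irreducible characters of $G$, with $\chi_1=1_G$ and $\chi_1(1)=1\le\chi_2(1)\le\dots\le\chi_k(1)$; put $a_k=\chi_k(1)$. A group $G$ is a $CD1$-group if $|G|>2$ and two columns of its character table differ by exactly one entry, i.e. there are non-conjugate $a,b\in G$ and an index $j$ with $\chi_j(a)\ne\chi_j(b)$ and $\chi_i(a)=\chi_i(b)$ for all $i\ne j$. A group $G$ is of central type if there is $\chi\in\mathrm{Irr}(G)$ with $[G:Z(G)]=\chi(1)^2$. A Frobenius group $G$ with Frobenius kernel $F$ and Frobenius complement $H$ is called doubly transitive if $|H|=|F|-1$. A Mersenne prime is a prime of the form $2^n-1$; a Fermat prime is a prime of the form $2^n+1$ with $n\ge 1$. *)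

theory Defs
  imports
    "HOL-Algebra.Coset"
    "HOL-Computational_Algebra.Primes"
    "Jordan_Normal_Form.VS_Connect"
begin

definition conjugate_elems :: "('a, 'b) monoid_scheme \<Rightarrow> 'a \<Rightarrow> 'a \<Rightarrow> bool" where
  "conjugate_elems G a b \<longleftrightarrow>
     (\<exists>g\<in>carrier G. b = g \<otimes>\<^bsub>G\<^esub> a \<otimes>\<^bsub>G\<^esub> inv\<^bsub>G\<^esub> g)"

definition group_center :: "('a, 'b) monoid_scheme \<Rightarrow> 'a set" where
  "group_center G = {z \<in> carrier G. \<forall>g\<in>carrier G. z \<otimes>\<^bsub>G\<^esub> g = g \<otimes>\<^bsub>G\<^esub> z}"

definition p_group :: "nat \<Rightarrow> ('a, 'b) monoid_scheme \<Rightarrow> bool" where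
  "p_group p G \<longleftrightarrow> (\<exists>m. Coset.order G = p ^ m)"

definition frobenius_complement :: "('a, 'b) monoid_scheme \<Rightarrow> 'a set \<Rightarrow> bool" where
  "frobenius_complement G H \<longleftrightarrow>
     subgroup H G \<and> H \<noteq> {\<one>\<^bsub>G\<^esub>} \<and> H \<noteq> carrier G \<and>
     (\<forall>g\<in>carrier G - H. H \<inter> (g <#\<^bsub>G\<^esub> H #>\<^bsub>G\<^esub> inv\<^bsub>G\<^esub> g) = {\<one>\<^bsub>G\<^esub>})"

definition frobenius_kernel :: "('a, 'b) monoid_scheme \<Rightarrow> 'a set \<Rightarrow> 'a set" where
  "frobenius_kernel G H =
     (carrier G - (\<Union>g\<in>carrier G. g <#\<^bsub>G\<^esub> H #>\<^bsub>G\<^esub> inv\<^bsub>G\<^esub> g)) \<union> {\<one>\<^bsub>G\<^esub>}"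

definition doubly_transitive_frobenius :: "('a, 'b) monoid_scheme \<Rightarrow> bool" where
  "doubly_transitive_frobenius G \<longleftrightarrow>
     (\<exists>H. frobenius_complement G H \<and> card H = card (frobenius_kernel G H) - 1)"

definition mat_trace :: "'a::comm_monoid_add mat \<Rightarrow> 'a" where
  "mat_trace A = (\<Sum>i<dim_row A. A $$ (i, i))"

definition complex_rep ::
    "('a, 'b) monoid_scheme \<Rightarrow> nat \<Rightarrow> ('a \<Rightarrow> complex mat) \<Rightarrow> bool" where
  "complex_rep G n \<rho> \<longleftrightarrow> \<rho> \<in> hom G (units_of (ring_mat TYPE(complex) n ()))"

definition irreducible_rep ::
    "('a, 'b) monoid_scheme \<Rightarrow> nat \<Rightarrow> ('a \<Rightarrow> complex mat) \<Rightarrow> bool" where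
  "irreducible_rep G n \<rho> \<longleftrightarrow>
     complex_rep G n \<rho> \<and> 0 < n \<and>
     (\<forall>W. VectorSpace.subspace class_ring W (module_vec TYPE(complex) n) \<longrightarrow>
          (\<forall>g\<in>carrier G. \<forall>w\<in>W. \<rho> g *\<^sub>v w \<in> W) \<longrightarrow>
          W = {0\<^sub>v n} \<or> W = carrier_vec n)"

text \<open>Characters are made extensional, so that each irreducible character of \<open>G\<close> is a
  single element of \<open>Irr G\<close>.\<close>

definition rep_character ::
    "('a, 'b) monoid_scheme \<Rightarrow> ('a \<Rightarrow> complex mat) \<Rightarrow> 'a \<Rightarrow> complex" where
  "rep_character G \<rho> = (\<lambda>g\<in>carrier G. mat_trace (\<rho> g))"

definition Irr :: "('a, 'b) monoid_scheme \<Rightarrow> ('a \<Rightarrow> complex) set" where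
  "Irr G = {rep_character G \<rho> |n \<rho>. irreducible_rep G n \<rho>}"

definition max_irr_degree :: "('a, 'b) monoid_scheme \<Rightarrow> nat" where
  "max_irr_degree G = Max {n. \<exists>\<chi>\<in>Irr G. \<chi> \<one>\<^bsub>G\<^esub> = of_nat n}"

definition CD1_group :: "('a, 'b) monoid_scheme \<Rightarrow> bool" where
  "CD1_group G \<longleftrightarrow>
     2 < Coset.order G \<and>
     (\<exists>a\<in>carrier G. \<exists>b\<in>carrier G. \<not> conjugate_elems G a b \<and>
        (\<exists>\<chi>\<in>Irr G. \<chi> a \<noteq> \<chi> b \<and> (\<forall>\<psi>\<in>Irr G - {\<chi>}. \<psi> a = \<psi> b)))"

definition central_type :: "('a, 'b) monoid_scheme \<Rightarrow> bool" where
  "central_type G \<longleftrightarrow>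
     (\<exists>\<chi>\<in>Irr G. of_nat (card (rcosets\<^bsub>G\<^esub> (group_center G))) = (\<chi> \<one>\<^bsub>G\<^esub>)\<^sup>2)"

end

theory Submission
  imports Defs "Jordan_Normal_Form.Spectral_Radius" "HOL-Algebra.Sylow"
begin

text \<open>
  Suppose the columns of \<open>a\<close> and \<open>b\<close> differ only at the character \<open>\<chi>\<close>. Orthogonality with
  the column of the identity forces \<open>b = 1\<close>, say, and then the orthogonality of the difference
  of the two columns with all columns determines \<open>\<chi>\<close>: it vanishes off \<open>N = {1} \<union> conj_class a\<close>, and
  \<open>\<chi> a = - \<chi> 1 / m\<close> for \<open>m = \<bar>conj_class a\<bar>\<close>. The class sum of \<open>N\<close> acts as \<open>m + 1\<close> in every other
  irreducible representation and as \<open>0\<close> in that of \<open>\<chi>\<close>, so it is a multiple of an idempotent;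
  hence \<open>N\<close> is a normal subgroup (\<open>N_mult_closed\<close>). Comparing orders gives \<open>\<chi> 1 = e m\<close> and
  \<open>\<bar>G\<bar> = e\<^sup>2 m (m + 1)\<close> for some \<open>e\<close> (\<open>cd1_arith\<close>), and \<open>\<chi> 1\<close> is the largest degree.

  If \<open>e m\<close> is a power of the prime \<open>r\<close>, then either \<open>m = 1\<close> and \<open>r = 2\<close>, where \<open>N\<close> is the
  centre and \<open>G\<close> is a \<open>2\<close>-group of central type, or \<open>r\<close> does not divide \<open>m + 1\<close>. In the second situation a Sylow
  \<open>r\<close>-subgroup \<open>R\<close> has order \<open>e\<^sup>2 m\<close> and meets \<open>N\<close> trivially, so \<open>\<chi>\<close> restricted to \<open>R\<close> is
  supported on the identity and contains the trivial character \<open>1/e\<close> times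
  (\<open>card_complement_dvd\<close>). Thus \<open>e = 1\<close>, and \<open>R\<close> is a Frobenius complement acting regularly on
  \<open>N - {1}\<close>. All elements of \<open>N - {1}\<close> are conjugate, so \<open>m + 1\<close> is a prime power as well, and
  \<open>prime_power_eq_Suc_prime_power\<close> leaves the three families of orders.

  Conversely, in a \<open>2\<close>-group of central type with centre of order two, the central involution acts
  as \<open>1\<close> or \<open>- 1\<close> in each irreducible representation, and both kinds contribute half of \<open>\<bar>G\<bar>\<close> to the
  sum of the squared degrees; the character provided by central type accounts for the whole half
  of the second kind. In a doubly transitive Frobenius group with complement of order \<open>h\<close>, counting
  the conjugates of the complement shows that the Frobenius kernel \<open>K\<close> is the centralizer of each
  of its elements \<open>x \<noteq> 1\<close> and that \<open>K - {1}\<close> is one class. An irreducible character that is not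
  constant on \<open>K\<close> must vanish off \<open>K\<close> and have degree \<open>h\<close>, and the orthogonality relations leave
  room for exactly one such character.

  The character theory behind this rests on \<open>column_orthogonality_one\<close>. The central idempotents
  attached to the irreducible characters add up to an element of the group algebra that acts as
  the identity on irreducible representations; being idempotent, it acts as the identity on all
  representations, and the regular representation shows that it is the identity element.
\<close>

section \<open>Linear algebra over the complex numbers\<close>

definition linear_subspace :: "nat \<Rightarrow> complex vec set \<Rightarrow> bool" where
  "linear_subspace n W \<longleftrightarrow> W \<subseteq> carrier_vec n \<and> 0\<^sub>v n \<in> W \<and>
     (\<forall>v\<in>W. \<forall>w\<in>W. v + w \<in> W) \<and> (\<forall>c. \<forall>v\<in>W. c \<cdot>\<^sub>v v \<in> W)"

lemma subspace_iff_linear_subspace: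
  "VectorSpace.subspace class_ring W (module_vec TYPE(complex) n) \<longleftrightarrow> linear_subspace n W"
  unfolding VectorSpace.subspace_def submodule_def linear_subspace_def
  using vec_vs[where 'a = complex] vec_module[where 'a = complex]
  by (simp add: module_vec_simps) (auto simp: class_ring_simps)

definition inj_mat :: "complex mat \<Rightarrow> bool" where
  "inj_mat B \<longleftrightarrow> (\<forall>v\<in>carrier_vec (dim_col B). B *\<^sub>v v = 0\<^sub>v (dim_row B) \<longrightarrow> v = 0\<^sub>v (dim_col B))"

lemma mat_mult_unit_vec:
  fixes A :: "'a::comm_semiring_1 mat"
  assumes "A \<in> carrier_mat n m" "j < m"
  shows "A *\<^sub>v unit_vec m j = col A j"
  using assms by (intro eq_vecI) auto

lemma mat_eqI_mult_vec:
  fixes A :: "'a::comm_semiring_1 mat"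
  assumes A: "A \<in> carrier_mat n m" and B: "B \<in> carrier_mat n m"
    and eq: "\<And>v. v \<in> carrier_vec m \<Longrightarrow> A *\<^sub>v v = B *\<^sub>v v"
  shows "A = B"
proof (rule mat_col_eqI)
  fix j assume "j < dim_col B"
  then have "j < m" using B by simp
  then show "col A j = col B j"
    using eq[of "unit_vec m j"] mat_mult_unit_vec[OF A] mat_mult_unit_vec[OF B] by simp
qed (use A B in auto)

text \<open>If \<open>k > n\<close>, then zero rows complete \<open>B\<close> to a singular square matrix, and a kernel vector of that matrix is one of \<open>B\<close>.\<close>

lemma inj_mat_dim_le:
  assumes B: "B \<in> carrier_mat n k" and inj: "inj_mat B"
  shows "k \<le> n"
proof (rule ccontr)
  assume "\<not> k \<le> n"
  then have nk: "n < k" by simp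
  define A where "A = mat k k (\<lambda>(i,j). if i < n then B $$ (i,j) else 0)"
  have A: "A \<in> carrier_mat k k" by (simp add: A_def)
  have rowA: "row A i = (if i < n then row B i else 0\<^sub>v k)" if "i < k" for i
    using that B by (intro eq_vecI) (auto simp: A_def)
  have "det A = 0"
  proof -
    have "A = mat\<^sub>r k k (\<lambda>i. if i = n then 0\<^sub>v k else row A i)"
    proof (rule eq_matI)
      fix i j assume "i < dim_row (mat\<^sub>r k k (\<lambda>i. if i = n then 0\<^sub>v k else row A i))"
        "j < dim_col (mat\<^sub>r k k (\<lambda>i. if i = n then 0\<^sub>v k else row A i))"
      then have ij: "i < k" "j < k" by auto
      have "A $$ (i,j) = (if i = n then 0\<^sub>v k else row A i) $ j"
        using ij nk A rowA[of n] by (cases "i = n") (simp_all add: A_def)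
      then show "A $$ (i,j) = mat\<^sub>r k k (\<lambda>i. if i = n then 0\<^sub>v k else row A i) $$ (i,j)"
        by (simp only: index_mat(2)[OF ij])
    qed (use A in auto)
    then have "det A = det (mat\<^sub>r k k (\<lambda>i. if i = n then 0\<^sub>v k else row A i))" by (rule arg_cong)
    also have "\<dots> = 0" by (rule det_row_0[OF nk]) (use A in auto)
    finally show ?thesis .
  qed
  then obtain v where v: "v \<in> carrier_vec k" "v \<noteq> 0\<^sub>v k" "A *\<^sub>v v = 0\<^sub>v k"
    using det_0_iff_vec_prod_zero_field[OF A] by blast
  have "B *\<^sub>v v = 0\<^sub>v n"
  proof (rule eq_vecI)
    fix i assume i: "i < dim_vec (0\<^sub>v n :: complex vec)"
    then have "(B *\<^sub>v v) $ i = (A *\<^sub>v v) $ i"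
      using rowA[of i] nk B A by simp
    then show "(B *\<^sub>v v) $ i = 0\<^sub>v n $ i" using v(3) i nk by simp
  qed (use B in simp)
  then show False using inj v B unfolding inj_mat_def by auto
qed

text \<open>A vector in the kernel of the enlarged matrix with nonzero last entry would express \<open>w\<close> by the columns of \<open>B\<close>.\<close>

lemma inj_mat_append_col:
  assumes B: "B \<in> carrier_mat n k" and inj: "inj_mat B"
    and w: "w \<in> carrier_vec n" and new: "\<And>v. v \<in> carrier_vec k \<Longrightarrow> B *\<^sub>v v \<noteq> w"
  obtains B' where "B' \<in> carrier_mat n (Suc k)" "inj_mat B'"
    "\<And>v. v \<in> carrier_vec (Suc k) \<Longrightarrow> B' *\<^sub>v v = B *\<^sub>v vec k (\<lambda>j. v $ j) + v $ k \<cdot>\<^sub>v w"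
proof -
  define B' where "B' = mat n (Suc k) (\<lambda>(i,j). if j < k then B $$ (i,j) else w $ i)"
  have B': "B' \<in> carrier_mat n (Suc k)" by (simp add: B'_def)
  have app: "B' *\<^sub>v v = B *\<^sub>v vec k (\<lambda>j. v $ j) + v $ k \<cdot>\<^sub>v w"
    if "v \<in> carrier_vec (Suc k)" for v
    using that B w by (intro eq_vecI) (auto simp: B'_def scalar_prod_def mult.commute)
  have "inj_mat B'"
    unfolding inj_mat_def
  proof (intro ballI impI)
    fix v assume "v \<in> carrier_vec (dim_col B')" and z: "B' *\<^sub>v v = 0\<^sub>v (dim_row B')"
    then have v: "v \<in> carrier_vec (Suc k)" using B' by simp
    let ?u = "vec k (\<lambda>j. v $ j)"
    have eq: "B *\<^sub>v ?u + v $ k \<cdot>\<^sub>v w = 0\<^sub>v n" using z app[OF v] B' by simp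
    have vk: "v $ k = 0"
    proof (rule ccontr)
      assume nz: "v $ k \<noteq> 0"
      have "B *\<^sub>v ((- inverse (v $ k)) \<cdot>\<^sub>v ?u) = w"
      proof (rule eq_vecI)
        fix i assume i: "i < dim_vec w"
        then have "(B *\<^sub>v ?u + v $ k \<cdot>\<^sub>v w) $ i = 0" using eq w by simp
        then have "(B *\<^sub>v ?u) $ i = - (v $ k) * w $ i"
          using i w B by (simp add: add_eq_0_iff del: index_mult_mat_vec)
        moreover have "(B *\<^sub>v ((- inverse (v $ k)) \<cdot>\<^sub>v ?u)) $ i = - inverse (v $ k) * (B *\<^sub>v ?u) $ i"
          using mult_mat_vec[OF B, of ?u] i w B by simp
        ultimately show "(B *\<^sub>v ((- inverse (v $ k)) \<cdot>\<^sub>v ?u)) $ i = w $ i"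
          using nz by simp
      qed (use B w in simp)
      then show False using new[of "(- inverse (v $ k)) \<cdot>\<^sub>v ?u"] by simp
    qed
    have "B *\<^sub>v ?u = 0\<^sub>v n"
    proof (rule eq_vecI)
      fix i assume i: "i < dim_vec (0\<^sub>v n :: complex vec)"
      then have "(B *\<^sub>v ?u + v $ k \<cdot>\<^sub>v w) $ i = 0" using eq by simp
      then show "(B *\<^sub>v ?u) $ i = 0\<^sub>v n $ i" using vk i w by simp
    qed (use B in simp)
    then have u0: "?u = 0\<^sub>v k" using inj B unfolding inj_mat_def by auto
    have vj: "v $ j = 0" if "j < k" for j
      using arg_cong[OF u0, of "\<lambda>x. x $ j"] that by simp
    show "v = 0\<^sub>v (dim_col B')"
      using v B' vk vj by (intro eq_vecI) (auto simp: less_Suc_eq)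
  qed
  with B' app show ?thesis using that by blast
qed

text \<open>A vector outside the range could be appended as a column, against \<open>inj_mat_dim_le\<close>.\<close>

lemma inj_mat_square_surj:
  assumes B: "B \<in> carrier_mat n n" and inj: "inj_mat B" and w: "w \<in> carrier_vec n"
  shows "\<exists>v\<in>carrier_vec n. B *\<^sub>v v = w"
proof (rule ccontr)
  assume "\<not> ?thesis"
  then obtain B' where "B' \<in> carrier_mat n (Suc n)" "inj_mat B'"
    using inj_mat_append_col[OF B inj w] by blast
  from inj_mat_dim_le[OF this] show False by simp
qed

text \<open>Bases of subspaces occur below only as the columns of an injective matrix; multiplying by it
  turns coordinates into vectors. A matrix with the largest possible number of columns will do.\<close>

lemma subspace_basis_mat:
  assumes W: "linear_subspace n W"
  obtains k B where "B \<in> carrier_mat n k" "inj_mat B" "k \<le> n"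
    "(*\<^sub>v) B ` carrier_vec k = W"
proof -
  define Q where "Q k \<longleftrightarrow> (\<exists>B\<in>carrier_mat n k. inj_mat B \<and> (*\<^sub>v) B ` carrier_vec k \<subseteq> W)" for k
  have "(0\<^sub>m n 0 :: complex mat) *\<^sub>v v = 0\<^sub>v n" if "v \<in> carrier_vec 0" for v
    using that by (intro eq_vecI) (auto simp: scalar_prod_def)
  then have Q0: "Q 0" using W unfolding Q_def inj_mat_def linear_subspace_def
    by (intro bexI[of _ "0\<^sub>m n 0"]) auto
  have bound: "\<forall>k. Q k \<longrightarrow> k \<le> n" using inj_mat_dim_le unfolding Q_def by blast
  define k where "k = (GREATEST k. Q k)"
  have "Q k" unfolding k_def using GreatestI_nat[of Q 0 n] Q0 bound by blast
  then obtain B where B: "B \<in> carrier_mat n k" "inj_mat B" and BW: "(*\<^sub>v) B ` carrier_vec k \<subseteq> W"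
    unfolding Q_def by blast
  have "(*\<^sub>v) B ` carrier_vec k = W"
  proof (rule ccontr)
    assume "(*\<^sub>v) B ` carrier_vec k \<noteq> W"
    then obtain w where w: "w \<in> W" "\<And>v. v \<in> carrier_vec k \<Longrightarrow> B *\<^sub>v v \<noteq> w" using BW by blast
    have wn: "w \<in> carrier_vec n" using w W unfolding linear_subspace_def by blast
    obtain B' where B': "B' \<in> carrier_mat n (Suc k)" "inj_mat B'"
      "\<And>v. v \<in> carrier_vec (Suc k) \<Longrightarrow> B' *\<^sub>v v = B *\<^sub>v vec k (\<lambda>j. v $ j) + v $ k \<cdot>\<^sub>v w"
      using inj_mat_append_col[OF B wn w(2)] by blast
    have "B' *\<^sub>v v \<in> W" if "v \<in> carrier_vec (Suc k)" for v
    proof -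
      have "B *\<^sub>v vec k (\<lambda>j. v $ j) \<in> W" by (rule subsetD[OF BW], rule imageI) simp
      then show ?thesis using B'(3)[OF that] W w(1) unfolding linear_subspace_def by simp
    qed
    then have "Q (Suc k)" unfolding Q_def using B' by blast
    then have "Suc k \<le> (GREATEST k. Q k)" by (rule Greatest_le_nat[where b = n]) (use bound in blast)
    then show False unfolding k_def[symmetric] by simp
  qed
  then show ?thesis using that B bound \<open>Q k\<close> by blast
qed

lemma range_factor:
  fixes B :: "'a::comm_semiring_1 mat"
  assumes B: "B \<in> carrier_mat n k" and A: "A \<in> carrier_mat n m"
    and sub: "\<And>v. v \<in> carrier_vec m \<Longrightarrow> A *\<^sub>v v \<in> (*\<^sub>v) B ` carrier_vec k"
  obtains C where "C \<in> carrier_mat k m" "A = B * C"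
proof -
  have "\<exists>v. v \<in> carrier_vec k \<and> B *\<^sub>v v = col A j" if "j < m" for j
    using sub[of "unit_vec m j"] mat_mult_unit_vec[OF A that] by (auto simp: image_iff)
  then obtain c where c: "\<And>j. j < m \<Longrightarrow> c j \<in> carrier_vec k \<and> B *\<^sub>v c j = col A j" by metis
  define C where "C = mat k m (\<lambda>(i,j). c j $ i)"
  have C: "C \<in> carrier_mat k m" by (simp add: C_def)
  have cC: "col C j = c j" if "j < m" for j
    using c[OF that] that by (intro eq_vecI) (auto simp: C_def)
  have "A = B * C"
  proof (rule eq_matI)
    fix i j assume "i < dim_row (B * C)" "j < dim_col (B * C)"
    then have ij: "i < n" "j < m" using B C by auto
    then have "(B * C) $$ (i,j) = (B *\<^sub>v c j) $ i" using B C cC by simp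
    then show "A $$ (i,j) = (B * C) $$ (i,j)" using c[OF ij(2)] ij A by simp
  qed (use A B C in auto)
  with C that show ?thesis by blast
qed

lemma inj_mat_cancel:
  assumes B: "B \<in> carrier_mat n k" and inj: "inj_mat B"
    and C: "C \<in> carrier_mat k m" and D: "D \<in> carrier_mat k m" and eq: "B * C = B * D"
  shows "C = D"
proof (rule mat_eqI_mult_vec[OF C D])
  fix v :: "complex vec" assume v: "v \<in> carrier_vec m"
  have Cv: "C *\<^sub>v v \<in> carrier_vec k" "D *\<^sub>v v \<in> carrier_vec k" using C D v by auto
  have "B *\<^sub>v (C *\<^sub>v v) = B *\<^sub>v (D *\<^sub>v v)"
    using assoc_mult_mat_vec[OF B C v] assoc_mult_mat_vec[OF B D v] eq by simp
  then have "B *\<^sub>v (C *\<^sub>v v - D *\<^sub>v v) = 0\<^sub>v n"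
    using mult_minus_distrib_mat_vec[OF B Cv] B Cv by simp
  then have "C *\<^sub>v v - D *\<^sub>v v = 0\<^sub>v k" using inj B Cv unfolding inj_mat_def by auto
  then have "(C *\<^sub>v v - D *\<^sub>v v) $ i = 0" if "i < k" for i using that by simp
  then show "C *\<^sub>v v = D *\<^sub>v v" using C D by (intro eq_vecI) auto
qed

lemma mat_trace_comm:
  fixes A :: "'a::comm_semiring_0 mat"
  assumes "A \<in> carrier_mat n m" "B \<in> carrier_mat m n"
  shows "mat_trace (A * B) = mat_trace (B * A)"
proof -
  have "mat_trace (A * B) = (\<Sum>i<n. \<Sum>j<m. A $$ (i,j) * B $$ (j,i))"
    using assms by (auto simp: mat_trace_def scalar_prod_def atLeast0LessThan)
  also have "\<dots> = (\<Sum>j<m. \<Sum>i<n. B $$ (j,i) * A $$ (i,j))"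
    by (subst sum.swap) (simp add: mult.commute)
  also have "\<dots> = mat_trace (B * A)"
    using assms by (auto simp: mat_trace_def scalar_prod_def atLeast0LessThan)
  finally show ?thesis .
qed

lemma mat_trace_one: "mat_trace (1\<^sub>m n :: 'a::semiring_1 mat) = of_nat n"
  by (simp add: mat_trace_def)

lemma mat_trace_smult_one: "mat_trace (c \<cdot>\<^sub>m 1\<^sub>m n :: 'a::comm_semiring_1 mat) = c * of_nat n"
  by (simp add: mat_trace_def mult.commute)

lemma range_is_subspace:
  assumes A: "A \<in> carrier_mat n m"
  shows "linear_subspace n ((*\<^sub>v) A ` carrier_vec m)"
  unfolding linear_subspace_def
proof (intro conjI ballI allI)
  show "(*\<^sub>v) A ` carrier_vec m \<subseteq> carrier_vec n" using A by auto
  have "A *\<^sub>v 0\<^sub>v m = 0\<^sub>v n" using A by (intro eq_vecI) auto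
  then show "0\<^sub>v n \<in> (*\<^sub>v) A ` carrier_vec m" by (intro image_eqI[of _ _ "0\<^sub>v m"]) auto
next
  fix v w assume "v \<in> (*\<^sub>v) A ` carrier_vec m" "w \<in> (*\<^sub>v) A ` carrier_vec m"
  then obtain x y where "x \<in> carrier_vec m" "y \<in> carrier_vec m" "v = A *\<^sub>v x" "w = A *\<^sub>v y" by blast
  then show "v + w \<in> (*\<^sub>v) A ` carrier_vec m"
    using mult_add_distrib_mat_vec[OF A, of x y] by (intro image_eqI[of _ _ "x + y"]) auto
next
  fix c :: complex and v assume "v \<in> (*\<^sub>v) A ` carrier_vec m"
  then obtain x where "x \<in> carrier_vec m" "v = A *\<^sub>v x" by blast
  then show "c \<cdot>\<^sub>v v \<in> (*\<^sub>v) A ` carrier_vec m"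
    using mult_mat_vec[OF A, of x c] by (intro image_eqI[of _ _ "c \<cdot>\<^sub>v x"]) auto
qed

text \<open>Factor \<open>P = B C\<close>, where the columns of \<open>B\<close> form a basis of the range. Since \<open>P\<close> is the identity
  on its range, \<open>C B = 1\<close>, and the trace of \<open>P\<close> equals that of \<open>C B\<close>.\<close>

lemma idempotent_trace:
  assumes P: "P \<in> carrier_mat n n" and idem: "P * P = (P :: complex mat)"
  obtains k where "k \<le> n" "mat_trace P = of_nat k"
proof -
  obtain k B where B: "B \<in> carrier_mat n k" "inj_mat B" and k: "k \<le> n"
    and rng: "(*\<^sub>v) B ` carrier_vec k = (*\<^sub>v) P ` carrier_vec n"
    by (rule subspace_basis_mat[OF range_is_subspace[OF P]])
  obtain C where C: "C \<in> carrier_mat k n" "P = B * C"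
    using range_factor[OF B(1) P] rng by blast
  have "P * B = B"
  proof (rule mat_eqI_mult_vec)
    fix v :: "complex vec" assume v: "v \<in> carrier_vec k"
    then obtain u where u: "u \<in> carrier_vec n" "B *\<^sub>v v = P *\<^sub>v u" using rng by blast
    then have "(P * B) *\<^sub>v v = (P * P) *\<^sub>v u"
      using assoc_mult_mat_vec[OF P B(1) v] assoc_mult_mat_vec[OF P P u(1)] by simp
    then show "(P * B) *\<^sub>v v = B *\<^sub>v v" using idem u by simp
  qed (use P B in auto)
  then have "B * (C * B) = B * 1\<^sub>m k"
    using C B by (simp add: assoc_mult_mat[OF B(1) C(1) B(1)])
  then have "C * B = 1\<^sub>m k"
    using inj_mat_cancel[OF B, of "C * B" k "1\<^sub>m k"] C B by simp
  then have "mat_trace P = of_nat k"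
    using mat_trace_comm[OF B(1) C(1)] C(2) mat_trace_one by metis
  with k that show ?thesis by blast
qed

section \<open>Representations of a finite group\<close>

locale fin_group = group G for G (structure) +
  assumes fin: "finite (carrier G)"
begin

abbreviation cN :: complex where "cN \<equiv> of_nat (Coset.order G)"

lemma order_pos: "0 < Coset.order G"
  using order_gt_0_iff_finite fin by blast

lemma cN_nonzero: "cN \<noteq> 0" using order_pos by simp

lemma sum_left_translate:
  assumes "h \<in> carrier G"
  shows "(\<Sum>g\<in>carrier G. F (h \<otimes> g)) = (\<Sum>g\<in>carrier G. F g)"
  by (rule sum.reindex_bij_witness[where i = "\<lambda>g. inv h \<otimes> g" and j = "\<lambda>g. h \<otimes> g"])
     (use assms in \<open>auto simp: m_assoc[symmetric]\<close>)

lemma sum_right_translate: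
  assumes "h \<in> carrier G"
  shows "(\<Sum>g\<in>carrier G. F (g \<otimes> h)) = (\<Sum>g\<in>carrier G. F g)"
  by (rule sum.reindex_bij_witness[where i = "\<lambda>g. g \<otimes> inv h" and j = "\<lambda>g. g \<otimes> h"])
     (use assms in \<open>auto simp: m_assoc\<close>)

lemma sum_inverse: "(\<Sum>g\<in>carrier G. F (inv g)) = (\<Sum>g\<in>carrier G. F g)"
  by (rule sum.reindex_bij_witness[where i = "\<lambda>g. inv g" and j = "\<lambda>g. inv g"]) auto

text \<open>Invertibility of the matrices is automatic, since \<open>\<rho> (inv g)\<close> is inverse to \<open>\<rho> g\<close>.\<close>

lemma complex_rep_iff:
  "complex_rep G n \<rho> \<longleftrightarrow>
     (\<forall>g\<in>carrier G. \<rho> g \<in> carrier_mat n n) \<and>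
     (\<forall>g\<in>carrier G. \<forall>h\<in>carrier G. \<rho> (g \<otimes> h) = \<rho> g * \<rho> h) \<and> \<rho> \<one> = 1\<^sub>m n"
proof -
  let ?R = "ring_mat TYPE(complex) n ()"
  interpret R: ring ?R by (rule ring_mat)
  have U: "Group.group (units_of ?R)" by (rule R.units_group)
  have mono: "x \<in> carrier ?R \<longleftrightarrow> x \<in> carrier_mat n n" for x by (simp add: ring_mat_simps)
  show ?thesis
  proof
    assume "complex_rep G n \<rho>"
    then have hom: "\<rho> \<in> hom G (units_of ?R)" by (simp add: complex_rep_def)
    then interpret h: group_hom G "units_of ?R" \<rho>
      using U by (simp add: group_hom_def group_hom_axioms_def is_group)
    have "\<rho> g \<in> carrier_mat n n" if "g \<in> carrier G" for g
      using h.hom_closed[OF that] R.Units_closed by (simp add: units_of_def ring_mat_simps)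
    moreover have "\<rho> (g \<otimes> h) = \<rho> g * \<rho> h" if "g \<in> carrier G" "h \<in> carrier G" for g h
      using h.hom_mult[OF that] by (simp add: units_of_def ring_mat_simps)
    moreover have "\<rho> \<one> = 1\<^sub>m n"
      using h.hom_one by (simp add: units_of_def ring_mat_simps)
    ultimately show "(\<forall>g\<in>carrier G. \<rho> g \<in> carrier_mat n n) \<and>
     (\<forall>g\<in>carrier G. \<forall>h\<in>carrier G. \<rho> (g \<otimes> h) = \<rho> g * \<rho> h) \<and> \<rho> \<one> = 1\<^sub>m n" by blast
  next
    assume *: "(\<forall>g\<in>carrier G. \<rho> g \<in> carrier_mat n n) \<and>
     (\<forall>g\<in>carrier G. \<forall>h\<in>carrier G. \<rho> (g \<otimes> h) = \<rho> g * \<rho> h) \<and> \<rho> \<one> = 1\<^sub>m n"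
    have "\<rho> g \<in> Units ?R" if g: "g \<in> carrier G" for g
    proof -
      have "\<rho> (inv g) * \<rho> g = 1\<^sub>m n" "\<rho> g * \<rho> (inv g) = 1\<^sub>m n"
        using * g by (metis inv_closed l_inv, metis inv_closed r_inv)
      then show ?thesis using * g unfolding Units_def ring_mat_simps
        by (auto intro!: bexI[of _ "\<rho> (inv g)"])
    qed
    then show "complex_rep G n \<rho>"
      using * unfolding complex_rep_def hom_def units_of_def by (auto simp: ring_mat_simps)
  qed
qed

lemma rep_carrier: "complex_rep G n \<rho> \<Longrightarrow> g \<in> carrier G \<Longrightarrow> \<rho> g \<in> carrier_mat n n"
  and rep_mult: "complex_rep G n \<rho> \<Longrightarrow> g \<in> carrier G \<Longrightarrow> h \<in> carrier G \<Longrightarrow> \<rho> (g \<otimes> h) = \<rho> g * \<rho> h"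
  and rep_one: "complex_rep G n \<rho> \<Longrightarrow> \<rho> \<one> = 1\<^sub>m n"
  by (auto simp: complex_rep_iff)

lemma irreducible_rep_iff:
  "irreducible_rep G n \<rho> \<longleftrightarrow> complex_rep G n \<rho> \<and> 0 < n \<and>
     (\<forall>W. linear_subspace n W \<longrightarrow> (\<forall>g\<in>carrier G. \<forall>w\<in>W. \<rho> g *\<^sub>v w \<in> W) \<longrightarrow>
        W = {0\<^sub>v n} \<or> W = carrier_vec n)"
  by (simp add: irreducible_rep_def subspace_iff_linear_subspace)

lemma irreducible_repD:
  assumes "irreducible_rep G n \<rho>"
  shows "complex_rep G n \<rho>" "0 < n"
    "\<And>W. linear_subspace n W \<Longrightarrow> (\<And>g w. g \<in> carrier G \<Longrightarrow> w \<in> W \<Longrightarrow> \<rho> g *\<^sub>v w \<in> W) \<Longrightarrow>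
       W = {0\<^sub>v n} \<or> W = carrier_vec n"
  using assms unfolding irreducible_rep_iff by auto

lemma mat_mult_entry:
  fixes A :: "'x::semiring_0 mat"
  assumes "A \<in> carrier_mat n m" "B \<in> carrier_mat m k" "i < n" "j < k"
  shows "(A * B) $$ (i,j) = (\<Sum>l<m. A $$ (i,l) * B $$ (l,j))"
  using assms by (simp add: scalar_prod_def atLeast0LessThan)

text \<open>The matrix by which the element \<open>\<Sum>g. f g \<cdot> g\<close> of the complex group algebra acts. Elements of the
  group algebra are given by their coefficient functions; \<open>convol\<close> is their product, and the class
  functions are the central elements.\<close>

definition act :: "nat \<Rightarrow> ('a \<Rightarrow> complex mat) \<Rightarrow> ('a \<Rightarrow> complex) \<Rightarrow> complex mat" where
  "act n \<rho> f = mat n n (\<lambda>(i,j). \<Sum>g\<in>carrier G. f g * \<rho> g $$ (i,j))"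

lemma act_carrier [simp]: "act n \<rho> f \<in> carrier_mat n n"
  by (simp add: act_def)

lemma act_mult_entry:
  assumes rep: "complex_rep G n \<rho>" and A: "A \<in> carrier_mat n m" and "i < n" "j < m"
  shows "(act n \<rho> f * A) $$ (i,j) = (\<Sum>g\<in>carrier G. f g * (\<rho> g * A) $$ (i,j))"
proof -
  have "(act n \<rho> f * A) $$ (i,j) =
      (\<Sum>l<n. (\<Sum>g\<in>carrier G. f g * \<rho> g $$ (i,l)) * A $$ (l,j))"
    using assms by (subst mat_mult_entry[OF act_carrier A]) (auto simp: act_def)
  also have "\<dots> = (\<Sum>g\<in>carrier G. \<Sum>l<n. f g * \<rho> g $$ (i,l) * A $$ (l,j))"
    by (simp add: sum_distrib_right) (rule sum.swap)
  also have "\<dots> = (\<Sum>g\<in>carrier G. f g * (\<rho> g * A) $$ (i,j))"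
  proof (rule sum.cong[OF refl])
    fix g assume "g \<in> carrier G"
    then show "(\<Sum>l<n. f g * \<rho> g $$ (i,l) * A $$ (l,j)) = f g * (\<rho> g * A) $$ (i,j)"
      using mat_mult_entry[OF rep_carrier[OF rep] A \<open>i < n\<close> \<open>j < m\<close>]
      by (simp add: sum_distrib_left mult.assoc)
  qed
  finally show ?thesis .
qed

lemma mult_act_entry:
  assumes rep: "complex_rep G n \<rho>" and A: "A \<in> carrier_mat m n" and "i < m" "j < n"
  shows "(A * act n \<rho> f) $$ (i,j) = (\<Sum>g\<in>carrier G. f g * (A * \<rho> g) $$ (i,j))"
proof -
  have "(A * act n \<rho> f) $$ (i,j) =
      (\<Sum>l<n. A $$ (i,l) * (\<Sum>g\<in>carrier G. f g * \<rho> g $$ (l,j)))"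
    using assms by (subst mat_mult_entry[OF A act_carrier]) (auto simp: act_def)
  also have "\<dots> = (\<Sum>g\<in>carrier G. \<Sum>l<n. f g * (A $$ (i,l) * \<rho> g $$ (l,j)))"
    by (simp add: sum_distrib_left mult.left_commute) (rule sum.swap)
  also have "\<dots> = (\<Sum>g\<in>carrier G. f g * (A * \<rho> g) $$ (i,j))"
  proof (rule sum.cong[OF refl])
    fix g assume "g \<in> carrier G"
    then show "(\<Sum>l<n. f g * (A $$ (i,l) * \<rho> g $$ (l,j))) = f g * (A * \<rho> g) $$ (i,j)"
      using mat_mult_entry[OF A rep_carrier[OF rep] \<open>i < m\<close> \<open>j < n\<close>]
      by (simp add: sum_distrib_left)
  qed
  finally show ?thesis .
qed

lemma act_intertwine:
  assumes rho: "complex_rep G n \<rho>" and sig: "complex_rep G m \<sigma>" and A: "A \<in> carrier_mat n m"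
    and int: "\<And>g. g \<in> carrier G \<Longrightarrow> \<rho> g * A = A * \<sigma> g"
  shows "act n \<rho> f * A = A * act m \<sigma> f"
proof (rule eq_matI)
  fix i j assume "i < dim_row (A * act m \<sigma> f)" "j < dim_col (A * act m \<sigma> f)"
  then have "i < n" "j < m" using A by (auto simp: act_def)
  then show "(act n \<rho> f * A) $$ (i,j) = (A * act m \<sigma> f) $$ (i,j)"
    using act_mult_entry[OF rho A] mult_act_entry[OF sig A] int by simp
qed (use A in \<open>auto simp: act_def\<close>)

lemma act_trace:
  assumes "complex_rep G n \<rho>"
  shows "mat_trace (act n \<rho> f) = (\<Sum>g\<in>carrier G. f g * mat_trace (\<rho> g))"
proof -
  have "mat_trace (act n \<rho> f) = (\<Sum>i<n. \<Sum>g\<in>carrier G. f g * \<rho> g $$ (i,i))"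
    by (simp add: mat_trace_def act_def)
  also have "\<dots> = (\<Sum>g\<in>carrier G. \<Sum>i<n. f g * \<rho> g $$ (i,i))" by (rule sum.swap)
  also have "\<dots> = (\<Sum>g\<in>carrier G. f g * mat_trace (\<rho> g))"
    using rep_carrier[OF assms] by (intro sum.cong[OF refl]) (auto simp: mat_trace_def sum_distrib_left)
  finally show ?thesis .
qed

definition convol :: "('a \<Rightarrow> complex) \<Rightarrow> ('a \<Rightarrow> complex) \<Rightarrow> 'a \<Rightarrow> complex" where
  "convol f f' x = (\<Sum>g\<in>carrier G. f g * f' (inv g \<otimes> x))"

lemma act_convol:
  assumes rep: "complex_rep G n \<rho>"
  shows "act n \<rho> f * act n \<rho> f' = act n \<rho> (convol f f')"
proof (rule eq_matI)
  fix i j assume "i < dim_row (act n \<rho> (convol f f'))" "j < dim_col (act n \<rho> (convol f f'))"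
  then have ij: "i < n" "j < n" by (auto simp: act_def)
  have "(act n \<rho> f * act n \<rho> f') $$ (i,j)
      = (\<Sum>g\<in>carrier G. f g * (\<Sum>h\<in>carrier G. f' h * \<rho> (g \<otimes> h) $$ (i,j)))"
    unfolding act_mult_entry[OF rep act_carrier ij]
    using mult_act_entry[OF rep rep_carrier[OF rep] ij] rep_mult[OF rep] by simp
  also have "\<dots> = (\<Sum>g\<in>carrier G. f g * (\<Sum>x\<in>carrier G. f' (inv g \<otimes> x) * \<rho> x $$ (i,j)))"
  proof (rule sum.cong[OF refl])
    fix g assume g: "g \<in> carrier G"
    have "(\<Sum>h\<in>carrier G. f' h * \<rho> (g \<otimes> h) $$ (i,j))
        = (\<Sum>h\<in>carrier G. f' (inv g \<otimes> (g \<otimes> h)) * \<rho> (g \<otimes> h) $$ (i,j))"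
      using g by (intro sum.cong) (auto simp: m_assoc[symmetric])
    also have "\<dots> = (\<Sum>x\<in>carrier G. f' (inv g \<otimes> x) * \<rho> x $$ (i,j))"
      by (rule sum_left_translate[OF g])
    finally show "f g * (\<Sum>h\<in>carrier G. f' h * \<rho> (g \<otimes> h) $$ (i,j))
        = f g * (\<Sum>x\<in>carrier G. f' (inv g \<otimes> x) * \<rho> x $$ (i,j))" by simp
  qed
  also have "\<dots> = (\<Sum>x\<in>carrier G. convol f f' x * \<rho> x $$ (i,j))"
    by (simp add: convol_def sum_distrib_left sum_distrib_right mult.assoc) (rule sum.swap)
  finally show "(act n \<rho> f * act n \<rho> f') $$ (i,j) = act n \<rho> (convol f f') $$ (i,j)"
    using ij by (simp add: act_def)
qed (auto simp: act_def)

definition class_fun :: "('a \<Rightarrow> complex) \<Rightarrow> bool" where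
  "class_fun f \<longleftrightarrow> (\<forall>g\<in>carrier G. \<forall>h\<in>carrier G. f (g \<otimes> h) = f (h \<otimes> g))"

lemma act_class_fun_commute:
  assumes rep: "complex_rep G n \<rho>" and f: "class_fun f" and h: "h \<in> carrier G"
  shows "\<rho> h * act n \<rho> f = act n \<rho> f * \<rho> h"
proof (rule eq_matI)
  fix i j assume "i < dim_row (act n \<rho> f * \<rho> h)" "j < dim_col (act n \<rho> f * \<rho> h)"
  then have ij: "i < n" "j < n" using rep_carrier[OF rep h] by (auto simp: act_def)
  let ?F = "\<lambda>x. f (inv h \<otimes> x) * \<rho> x $$ (i,j)" and ?F' = "\<lambda>x. f (x \<otimes> inv h) * \<rho> x $$ (i,j)"
  have "(\<rho> h * act n \<rho> f) $$ (i,j) = (\<Sum>g\<in>carrier G. ?F (h \<otimes> g))"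
    unfolding mult_act_entry[OF rep rep_carrier[OF rep h] ij]
    using h rep_mult[OF rep] by (intro sum.cong) (auto simp: m_assoc[symmetric])
  also have "\<dots> = (\<Sum>x\<in>carrier G. ?F x)" by (rule sum_left_translate[OF h])
  also have "\<dots> = (\<Sum>x\<in>carrier G. ?F' x)"
    using f h unfolding class_fun_def by (intro sum.cong) auto
  also have "\<dots> = (\<Sum>g\<in>carrier G. ?F' (g \<otimes> h))" by (rule sum_right_translate[OF h, symmetric])
  also have "\<dots> = (act n \<rho> f * \<rho> h) $$ (i,j)"
    unfolding act_mult_entry[OF rep rep_carrier[OF rep h] ij]
    using h rep_mult[OF rep] by (intro sum.cong) (auto simp: m_assoc)
  finally show "(\<rho> h * act n \<rho> f) $$ (i,j) = (act n \<rho> f * \<rho> h) $$ (i,j)" .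
qed (use rep_carrier[OF rep h] in \<open>auto simp: act_def\<close>)

text \<open>The action of \<open>G\<close> on the range of \<open>B\<close>, in the coordinates given by the columns of \<open>B\<close>.\<close>

lemma subrep:
  assumes rep: "complex_rep G n \<rho>" and B: "B \<in> carrier_mat n k" and inj: "inj_mat B"
    and inv: "\<And>g v. g \<in> carrier G \<Longrightarrow> v \<in> carrier_vec k \<Longrightarrow> \<rho> g *\<^sub>v (B *\<^sub>v v) \<in> (*\<^sub>v) B ` carrier_vec k"
  obtains \<sigma> where "complex_rep G k \<sigma>" "\<And>g. g \<in> carrier G \<Longrightarrow> \<rho> g * B = B * \<sigma> g"
proof -
  have "\<exists>C. C \<in> carrier_mat k k \<and> \<rho> g * B = B * C" if g: "g \<in> carrier G" for g
  proof -
    have c: "\<rho> g * B \<in> carrier_mat n k" using rep_carrier[OF rep g] B by simp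
    have "(\<rho> g * B) *\<^sub>v v \<in> (*\<^sub>v) B ` carrier_vec k" if "v \<in> carrier_vec k" for v
      using inv[OF g that] assoc_mult_mat_vec[OF rep_carrier[OF rep g] B that] by simp
    from range_factor[OF B c this] show ?thesis by blast
  qed
  then obtain \<sigma> where s: "\<And>g. g \<in> carrier G \<Longrightarrow> \<sigma> g \<in> carrier_mat k k"
    "\<And>g. g \<in> carrier G \<Longrightarrow> \<rho> g * B = B * \<sigma> g" by metis
  have "\<sigma> (g \<otimes> h) = \<sigma> g * \<sigma> h" if g: "g \<in> carrier G" and h: "h \<in> carrier G" for g h
  proof (rule inj_mat_cancel[OF B inj])
    have "B * \<sigma> (g \<otimes> h) = \<rho> g * \<rho> h * B" using s(2)[of "g \<otimes> h"] g h rep_mult[OF rep g h] by simp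
    also have "\<dots> = \<rho> g * (B * \<sigma> h)"
      using assoc_mult_mat[OF rep_carrier[OF rep g] rep_carrier[OF rep h] B] s(2)[OF h] by simp
    also have "\<dots> = B * \<sigma> g * \<sigma> h"
      using assoc_mult_mat[OF rep_carrier[OF rep g] B s(1)[OF h]] s(2)[OF g] by simp
    also have "\<dots> = B * (\<sigma> g * \<sigma> h)"
      using assoc_mult_mat[OF B s(1)[OF g] s(1)[OF h]] by simp
    finally show "B * \<sigma> (g \<otimes> h) = B * (\<sigma> g * \<sigma> h)" .
  qed (use s(1) g h in \<open>auto intro: mult_carrier_mat\<close>)
  moreover have "\<sigma> \<one> = 1\<^sub>m k"
    by (rule inj_mat_cancel[OF B inj]) (use s(1,2)[of \<one>] rep_one[OF rep] B in auto)
  ultimately have "complex_rep G k \<sigma>" using s(1) unfolding complex_rep_iff by blast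
  with s(2) that show ?thesis by blast
qed

lemma zero_range_if_dim_0:
  assumes "B \<in> carrier_mat n 0"
  shows "(*\<^sub>v) B ` carrier_vec 0 = {0\<^sub>v n}"
proof -
  have z: "B *\<^sub>v v = 0\<^sub>v n" if "v \<in> carrier_vec 0" for v
    using that assms by (intro eq_vecI) (auto simp: scalar_prod_def)
  have "0\<^sub>v n \<in> (*\<^sub>v) B ` carrier_vec 0"
    by (rule image_eqI[of _ _ "0\<^sub>v 0"]) (use z in auto)
  moreover have "(*\<^sub>v) B ` carrier_vec 0 \<subseteq> {0\<^sub>v n}" by (rule image_subsetI) (simp add: z)
  ultimately show ?thesis by (intro equalityI) auto
qed

text \<open>An invariant injective matrix with the least positive number of columns spans an irreducible
  subspace: a proper nonzero invariant subspace in its coordinates would yield one with fewer columns.\<close>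

lemma irreducible_subrep:
  assumes rep: "complex_rep G n \<rho>" and W: "linear_subspace n W" and nz: "W \<noteq> {0\<^sub>v n}"
    and inv: "\<And>g w. g \<in> carrier G \<Longrightarrow> w \<in> W \<Longrightarrow> \<rho> g *\<^sub>v w \<in> W"
  obtains k \<sigma> B where "irreducible_rep G k \<sigma>" "B \<in> carrier_mat n k" "inj_mat B"
    "(*\<^sub>v) B ` carrier_vec k \<subseteq> W" "\<And>g. g \<in> carrier G \<Longrightarrow> \<rho> g * B = B * \<sigma> g"
proof -
  define Q where "Q k \<longleftrightarrow> 0 < k \<and> (\<exists>B \<sigma>. B \<in> carrier_mat n k \<and> inj_mat B \<and>
    (*\<^sub>v) B ` carrier_vec k \<subseteq> W \<and> complex_rep G k \<sigma> \<and> (\<forall>g\<in>carrier G. \<rho> g * B = B * \<sigma> g))" for k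
  obtain k0 B0 where B0: "B0 \<in> carrier_mat n k0" "inj_mat B0" "k0 \<le> n"
    "(*\<^sub>v) B0 ` carrier_vec k0 = W" by (rule subspace_basis_mat[OF W])
  have "k0 \<noteq> 0" using zero_range_if_dim_0[of B0 n] B0 nz by auto
  have inv0: "\<rho> g *\<^sub>v (B0 *\<^sub>v v) \<in> (*\<^sub>v) B0 ` carrier_vec k0"
    if "g \<in> carrier G" "v \<in> carrier_vec k0" for g v
    unfolding B0(4) using that inv B0(4) by blast
  obtain \<sigma>0 where "complex_rep G k0 \<sigma>0" "\<And>g. g \<in> carrier G \<Longrightarrow> \<rho> g * B0 = B0 * \<sigma>0 g"
    using subrep[OF rep B0(1,2) inv0] by blast
  then have "Q k0" unfolding Q_def using B0 \<open>k0 \<noteq> 0\<close> inv0 by auto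
  define k where "k = (LEAST k. Q k)"
  have "Q k" unfolding k_def using \<open>Q k0\<close> by (rule LeastI)
  have min: "k \<le> k'" if "Q k'" for k' unfolding k_def using that by (rule Least_le)
  obtain B \<sigma> where k: "0 < k" and B: "B \<in> carrier_mat n k" "inj_mat B"
    "(*\<^sub>v) B ` carrier_vec k \<subseteq> W" and s: "complex_rep G k \<sigma>"
    and int: "\<And>g. g \<in> carrier G \<Longrightarrow> \<rho> g * B = B * \<sigma> g" using \<open>Q k\<close> unfolding Q_def by blast
  have "U = {0\<^sub>v k} \<or> U = carrier_vec k"
    if U: "linear_subspace k U" and Uinv: "\<forall>g\<in>carrier G. \<forall>w\<in>U. \<sigma> g *\<^sub>v w \<in> U" for U
  proof (rule ccontr)
    assume contr: "\<not> (U = {0\<^sub>v k} \<or> U = carrier_vec k)"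
    obtain k1 B1 where B1: "B1 \<in> carrier_mat k k1" "inj_mat B1" "k1 \<le> k"
      "(*\<^sub>v) B1 ` carrier_vec k1 = U" by (rule subspace_basis_mat[OF U])
    have "k1 \<noteq> 0" using zero_range_if_dim_0[of B1 k] B1 contr by auto
    have "k1 \<noteq> k"
    proof
      assume "k1 = k"
      then have "w \<in> U" if "w \<in> carrier_vec k" for w
        using inj_mat_square_surj[of B1 k w] B1 that by auto
      then have "carrier_vec k \<subseteq> U" by blast
      then show False using contr U unfolding linear_subspace_def by blast
    qed
    have inv1: "\<sigma> g *\<^sub>v (B1 *\<^sub>v v) \<in> (*\<^sub>v) B1 ` carrier_vec k1"
      if "g \<in> carrier G" "v \<in> carrier_vec k1" for g v
      unfolding B1(4) using that Uinv B1(4) by blast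
    obtain \<tau> where t: "complex_rep G k1 \<tau>" "\<And>g. g \<in> carrier G \<Longrightarrow> \<sigma> g * B1 = B1 * \<tau> g"
      using subrep[OF s B1(1,2) inv1] by blast
    have c: "B * B1 \<in> carrier_mat n k1" using B B1 by simp
    have mv: "(B * B1) *\<^sub>v v = B *\<^sub>v (B1 *\<^sub>v v)" if "v \<in> carrier_vec k1" for v
      using that B(1) B1(1) by simp
    have "inj_mat (B * B1)"
      unfolding inj_mat_def
    proof (intro ballI impI)
      fix v assume "v \<in> carrier_vec (dim_col (B * B1))" "B * B1 *\<^sub>v v = 0\<^sub>v (dim_row (B * B1))"
      then have v: "v \<in> carrier_vec k1" "B *\<^sub>v (B1 *\<^sub>v v) = 0\<^sub>v n" using mv c B B1 by auto
      then have "B1 *\<^sub>v v = 0\<^sub>v k" using B B1 unfolding inj_mat_def by auto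
      then show "v = 0\<^sub>v (dim_col (B * B1))" using v B1 unfolding inj_mat_def by auto
    qed
    moreover have "(*\<^sub>v) (B * B1) ` carrier_vec k1 \<subseteq> W"
      using mv B(3) B1(1) by (auto simp: image_subset_iff)
    moreover have "\<rho> g * (B * B1) = (B * B1) * \<tau> g" if g: "g \<in> carrier G" for g
      using assoc_mult_mat[OF rep_carrier[OF rep g] B(1) B1(1)] int[OF g] t(2)[OF g]
        assoc_mult_mat[OF B(1) rep_carrier[OF s g] B1(1)]
        assoc_mult_mat[OF B(1) B1(1) rep_carrier[OF t(1) g]] by simp
    ultimately have "Q k1" unfolding Q_def using \<open>k1 \<noteq> 0\<close> c t(1) by blast
    then show False using min \<open>k1 \<noteq> k\<close> B1(3) by fastforce
  qed
  then have "irreducible_rep G k \<sigma>" unfolding irreducible_rep_iff using s k by blast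
  with B int that show ?thesis by blast
qed

text \<open>Schur's lemma for two representations: the kernel and the range of \<open>T\<close> are invariant, so
  \<open>T\<close> is invertible and conjugates \<open>\<sigma>\<close> into \<open>\<rho>\<close>.\<close>

lemma schur_intertwiner:
  assumes rho: "irreducible_rep G n \<rho>" and sig: "irreducible_rep G m \<sigma>"
    and T: "T \<in> carrier_mat n m" and int: "\<And>g. g \<in> carrier G \<Longrightarrow> \<rho> g * T = T * \<sigma> g"
    and nz: "T \<noteq> 0\<^sub>m n m" and g: "g \<in> carrier G"
  shows "mat_trace (\<rho> g) = mat_trace (\<sigma> g)"
proof -
  note rr = irreducible_repD[OF rho] and ss = irreducible_repD[OF sig]
  have act: "\<rho> h *\<^sub>v (T *\<^sub>v v) = T *\<^sub>v (\<sigma> h *\<^sub>v v)" if "h \<in> carrier G" "v \<in> carrier_vec m" for h v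
    using int[OF that(1)] assoc_mult_mat_vec[OF rep_carrier[OF rr(1) that(1)] T that(2)]
      assoc_mult_mat_vec[OF T rep_carrier[OF ss(1) that(1)] that(2)] by simp
  have T0: "T *\<^sub>v 0\<^sub>v m = 0\<^sub>v n" using T by (intro eq_vecI) auto
  have notall: "\<not> (\<forall>v\<in>carrier_vec m. T *\<^sub>v v = 0\<^sub>v n)"
  proof
    assume all: "\<forall>v\<in>carrier_vec m. T *\<^sub>v v = 0\<^sub>v n"
    have "T = 0\<^sub>m n m"
      by (rule mat_eqI_mult_vec[OF T]) (use all in \<open>auto intro!: eq_vecI\<close>)
    then show False using nz by simp
  qed
  let ?K = "{v \<in> carrier_vec m. T *\<^sub>v v = 0\<^sub>v n}"
  have "linear_subspace m ?K"
    unfolding linear_subspace_def using T0 mult_add_distrib_mat_vec[OF T] mult_mat_vec[OF T]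
    by auto
  moreover have "\<sigma> h *\<^sub>v w \<in> ?K" if h: "h \<in> carrier G" and w: "w \<in> ?K" for h w
  proof -
    have c: "\<rho> h \<in> carrier_mat n n" by (rule rep_carrier[OF rr(1) h])
    have z: "\<rho> h *\<^sub>v 0\<^sub>v n = 0\<^sub>v n" using c by (intro eq_vecI) auto
    have "\<sigma> h *\<^sub>v w \<in> carrier_vec m" using rep_carrier[OF ss(1) h] w by auto
    then show ?thesis using act[OF h, of w] w z by simp
  qed
  ultimately have "?K = {0\<^sub>v m} \<or> ?K = carrier_vec m" by (rule ss(3))
  then have K: "?K = {0\<^sub>v m}" using notall by blast
  have inj: "inj_mat T" unfolding inj_mat_def using K T by auto
  let ?I = "(*\<^sub>v) T ` carrier_vec m"
  have "?I = {0\<^sub>v n} \<or> ?I = carrier_vec n"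
  proof (rule rr(3)[OF range_is_subspace[OF T]])
    fix h w assume "h \<in> carrier G" "w \<in> ?I"
    then show "\<rho> h *\<^sub>v w \<in> ?I" using act rep_carrier[OF ss(1)] by fastforce
  qed
  then have I: "?I = carrier_vec n" using notall by auto
  obtain R where R: "R \<in> carrier_mat m n" "1\<^sub>m n = T * R"
    by (rule range_factor[OF T one_carrier_mat[of n]]) (use I in auto)
  have "R * T = 1\<^sub>m m"
  proof (rule inj_mat_cancel[OF T inj])
    show "T * (R * T) = T * 1\<^sub>m m"
      using assoc_mult_mat[OF T R(1) T] R(2)[symmetric] T by simp
  qed (use T R in auto)
  have rg: "\<rho> g \<in> carrier_mat n n" and sg: "\<sigma> g \<in> carrier_mat m m"
    using rep_carrier[OF rr(1) g] rep_carrier[OF ss(1) g] by auto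
  have "\<rho> g = \<rho> g * (T * R)" using R(2) rg by (metis right_mult_one_mat)
  also have "\<dots> = T * (\<sigma> g * R)"
    using assoc_mult_mat[OF rg T R(1)] int[OF g] assoc_mult_mat[OF T sg R(1)] by simp
  finally have "mat_trace (\<rho> g) = mat_trace (\<sigma> g * R * T)"
    using mat_trace_comm[OF T, of "\<sigma> g * R"] sg R(1) by simp
  also have "\<sigma> g * R * T = \<sigma> g" using assoc_mult_mat[OF sg R(1) T] \<open>R * T = 1\<^sub>m m\<close> sg by simp
  finally show ?thesis .
qed

text \<open>Schur's lemma for a single representation: an eigenspace of \<open>T\<close> is invariant.\<close>

lemma schur_scalar:
  assumes rho: "irreducible_rep G n \<rho>" and T: "T \<in> carrier_mat n n"
    and comm: "\<And>g. g \<in> carrier G \<Longrightarrow> \<rho> g * T = T * \<rho> g"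
  obtains c where "T = c \<cdot>\<^sub>m 1\<^sub>m n"
proof -
  note rr = irreducible_repD[OF rho]
  obtain c where "c \<in> spectrum T" using spectrum_non_empty[OF T] rr(2) by blast
  then obtain v where v: "v \<in> carrier_vec n" "v \<noteq> 0\<^sub>v n" "T *\<^sub>v v = c \<cdot>\<^sub>v v"
    unfolding spectrum_def eigenvalue_def eigenvector_def using T by auto
  let ?K = "{v \<in> carrier_vec n. T *\<^sub>v v = c \<cdot>\<^sub>v v}"
  have "T *\<^sub>v 0\<^sub>v n = c \<cdot>\<^sub>v 0\<^sub>v n" using T by (intro eq_vecI) auto
  then have "linear_subspace n ?K"
    unfolding linear_subspace_def using mult_add_distrib_mat_vec[OF T] mult_mat_vec[OF T]
    by (auto simp: smult_add_distrib_vec smult_smult_assoc mult.commute)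
  moreover have "\<rho> h *\<^sub>v w \<in> ?K" if h: "h \<in> carrier G" and w: "w \<in> ?K" for h w
  proof -
    have c: "\<rho> h \<in> carrier_mat n n" by (rule rep_carrier[OF rr(1) h])
    have "T *\<^sub>v (\<rho> h *\<^sub>v w) = \<rho> h *\<^sub>v (T *\<^sub>v w)"
      using comm[OF h] assoc_mult_mat_vec[OF T c, of w] assoc_mult_mat_vec[OF c T, of w] w by simp
    then show ?thesis using w c mult_mat_vec[OF c, of w] by auto
  qed
  ultimately have "?K = {0\<^sub>v n} \<or> ?K = carrier_vec n" by (rule rr(3))
  then have K: "?K = carrier_vec n" using v by blast
  have "T = c \<cdot>\<^sub>m 1\<^sub>m n"
  proof (rule mat_eqI_mult_vec[OF T])
    fix w :: "complex vec" assume w: "w \<in> carrier_vec n"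
    then have "T *\<^sub>v w = c \<cdot>\<^sub>v w" using K by blast
    also have "\<dots> = (c \<cdot>\<^sub>m 1\<^sub>m n) *\<^sub>v w"
      using w by (intro eq_vecI) (auto simp: row_smult)
    finally show "T *\<^sub>v w = (c \<cdot>\<^sub>m 1\<^sub>m n) *\<^sub>v w" .
  qed simp
  with that show ?thesis .
qed

end

section \<open>Irreducible characters and column orthogonality at the identity\<close>

context fin_group
begin

lemma rep_character_apply: "g \<in> carrier G \<Longrightarrow> rep_character G \<rho> g = mat_trace (\<rho> g)"
  by (simp add: rep_character_def)

lemma IrrE:
  assumes "\<chi> \<in> Irr G"
  obtains n \<rho> where "irreducible_rep G n \<rho>" "\<And>g. g \<in> carrier G \<Longrightarrow> \<chi> g = mat_trace (\<rho> g)"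
    "\<chi> = rep_character G \<rho>" "\<chi> \<one> = of_nat n" "0 < n"
proof -
  obtain n \<rho> where irr: "irreducible_rep G n \<rho>" and chi: "\<chi> = rep_character G \<rho>"
    using assms unfolding Irr_def by blast
  have "\<chi> \<one> = of_nat n"
    using rep_one[OF irreducible_repD(1)[OF irr]] by (simp add: chi rep_character_apply mat_trace_one)
  then show ?thesis using that irr chi rep_character_apply irreducible_repD(2)[OF irr] by blast
qed

definition deg :: "('a \<Rightarrow> complex) \<Rightarrow> nat" where
  "deg \<chi> = nat \<lfloor>Re (\<chi> \<one>)\<rfloor>"

lemma Irr_one: "\<chi> \<in> Irr G \<Longrightarrow> \<chi> \<one> = of_nat (deg \<chi>)"
  by (erule IrrE) (simp add: deg_def)

lemma deg_pos: "\<chi> \<in> Irr G \<Longrightarrow> 0 < deg \<chi>"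
  by (erule IrrE) (simp add: deg_def)

lemma Irr_one_nonzero: "\<chi> \<in> Irr G \<Longrightarrow> \<chi> \<one> \<noteq> 0"
  using Irr_one deg_pos by fastforce

lemma Irr_commute:
  assumes "\<chi> \<in> Irr G" "g \<in> carrier G" "h \<in> carrier G"
  shows "\<chi> (g \<otimes> h) = \<chi> (h \<otimes> g)"
proof -
  obtain n \<rho> where irr: "irreducible_rep G n \<rho>" and chi: "\<And>g. g \<in> carrier G \<Longrightarrow> \<chi> g = mat_trace (\<rho> g)"
    using IrrE[OF assms(1)] by metis
  note rep = irreducible_repD(1)[OF irr]
  show ?thesis
    using assms chi rep_mult[OF rep] mat_trace_comm[OF rep_carrier[OF rep] rep_carrier[OF rep]] by simp
qed

lemma act_class_fun_scalar:
  assumes irr: "irreducible_rep G n \<rho>" and f: "class_fun f"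
  obtains c where "act n \<rho> f = c \<cdot>\<^sub>m 1\<^sub>m n"
    "c * of_nat n = (\<Sum>g\<in>carrier G. f g * mat_trace (\<rho> g))"
proof -
  note rep = irreducible_repD(1)[OF irr]
  obtain c where c: "act n \<rho> f = c \<cdot>\<^sub>m 1\<^sub>m n"
    by (rule schur_scalar[OF irr act_carrier act_class_fun_commute[OF rep f]])
  then show ?thesis using that act_trace[OF rep, of f] mat_trace_smult_one[of c n] by metis
qed

text \<open>The central element with coefficients \<open>f\<close> acts as a scalar, which is found by comparing traces;
  the claim is the trace of this scalar times \<open>\<rho> h\<close>.\<close>

lemma Irr_central:
  assumes chi: "\<chi> \<in> Irr G" and f: "class_fun f" and h: "h \<in> carrier G"
  shows "\<chi> \<one> * (\<Sum>g\<in>carrier G. f g * \<chi> (g \<otimes> h)) = (\<Sum>g\<in>carrier G. f g * \<chi> g) * \<chi> h"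
proof -
  obtain n \<rho> where irr: "irreducible_rep G n \<rho>" and chi: "\<And>g. g \<in> carrier G \<Longrightarrow> \<chi> g = mat_trace (\<rho> g)"
    and one: "\<chi> \<one> = of_nat n" using IrrE[OF chi] by metis
  note rep = irreducible_repD(1)[OF irr]
  obtain c where c: "act n \<rho> f = c \<cdot>\<^sub>m 1\<^sub>m n" "c * of_nat n = (\<Sum>g\<in>carrier G. f g * mat_trace (\<rho> g))"
    by (rule act_class_fun_scalar[OF irr f])
  have rh: "\<rho> h \<in> carrier_mat n n" by (rule rep_carrier[OF rep h])
  have "(\<Sum>g\<in>carrier G. f g * \<chi> (g \<otimes> h)) = (\<Sum>g\<in>carrier G. \<Sum>i<n. f g * (\<rho> g * \<rho> h) $$ (i,i))"
  proof (rule sum.cong[OF refl])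
    fix g assume g: "g \<in> carrier G"
    then have "dim_row (\<rho> g * \<rho> h) = n" using rep_carrier[OF rep g] by simp
    then show "f g * \<chi> (g \<otimes> h) = (\<Sum>i<n. f g * (\<rho> g * \<rho> h) $$ (i,i))"
      using chi[of "g \<otimes> h"] rep_mult[OF rep g h] g h by (simp add: mat_trace_def sum_distrib_left)
  qed
  also have "\<dots> = (\<Sum>i<n. \<Sum>g\<in>carrier G. f g * (\<rho> g * \<rho> h) $$ (i,i))" by (rule sum.swap)
  also have "\<dots> = mat_trace (act n \<rho> f * \<rho> h)"
    using act_mult_entry[OF rep rh, of _ _ f] rh by (simp add: mat_trace_def act_def)
  also have "act n \<rho> f * \<rho> h = c \<cdot>\<^sub>m \<rho> h" using c(1) mult_smult_assoc_mat[OF one_carrier_mat rh] rh by simp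
  also have "mat_trace (c \<cdot>\<^sub>m \<rho> h) = c * \<chi> h"
    using rh chi[OF h] by (simp add: mat_trace_def sum_distrib_left)
  finally have "\<chi> \<one> * (\<Sum>g\<in>carrier G. f g * \<chi> (g \<otimes> h)) = (c * of_nat n) * \<chi> h"
    using one by simp
  then show ?thesis using c(2) chi by simp
qed

text \<open>The sum over \<open>g\<close> of \<open>\<rho> g E \<sigma> (inv g)\<close>, where \<open>E\<close> is the matrix unit with entry \<open>1\<close> at \<open>(a, b)\<close>.
  It intertwines \<open>\<sigma>\<close> and \<open>\<rho>\<close>.\<close>

definition avg :: "nat \<Rightarrow> nat \<Rightarrow> ('a \<Rightarrow> complex mat) \<Rightarrow> ('a \<Rightarrow> complex mat) \<Rightarrow> nat \<Rightarrow> nat \<Rightarrow> complex mat" where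
  "avg n m \<rho> \<sigma> a b = mat n m (\<lambda>(i,j). \<Sum>g\<in>carrier G. \<rho> g $$ (i,a) * \<sigma> (inv g) $$ (b,j))"

lemma avg_carrier [simp]: "avg n m \<rho> \<sigma> a b \<in> carrier_mat n m"
  by (simp add: avg_def)

lemma avg_intertwines:
  assumes rho: "complex_rep G n \<rho>" and sig: "complex_rep G m \<sigma>"
    and ab: "a < n" "b < m" and h: "h \<in> carrier G"
  shows "\<rho> h * avg n m \<rho> \<sigma> a b = avg n m \<rho> \<sigma> a b * \<sigma> h"
proof (rule eq_matI)
  fix i j assume "i < dim_row (avg n m \<rho> \<sigma> a b * \<sigma> h)" "j < dim_col (avg n m \<rho> \<sigma> a b * \<sigma> h)"
  then have ij: "i < n" "j < m" using rep_carrier[OF sig h] by (auto simp: avg_def)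
  let ?F = "\<lambda>x. \<rho> x $$ (i,a) * \<sigma> (inv x \<otimes> h) $$ (b,j)"
  have "(\<rho> h * avg n m \<rho> \<sigma> a b) $$ (i,j)
      = (\<Sum>l<n. \<rho> h $$ (i,l) * (\<Sum>g\<in>carrier G. \<rho> g $$ (l,a) * \<sigma> (inv g) $$ (b,j)))"
    using mat_mult_entry[OF rep_carrier[OF rho h] avg_carrier ij] ij by (simp add: avg_def)
  also have "\<dots> = (\<Sum>g\<in>carrier G. \<Sum>l<n. \<rho> h $$ (i,l) * \<rho> g $$ (l,a) * \<sigma> (inv g) $$ (b,j))"
    by (simp add: sum_distrib_left mult.assoc) (rule sum.swap)
  also have "\<dots> = (\<Sum>g\<in>carrier G. ?F (h \<otimes> g))"
  proof (rule sum.cong[OF refl])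
    fix g assume g: "g \<in> carrier G"
    have "\<rho> (h \<otimes> g) $$ (i,a) = (\<Sum>l<n. \<rho> h $$ (i,l) * \<rho> g $$ (l,a))"
      using rep_mult[OF rho h g]
        mat_mult_entry[OF rep_carrier[OF rho h] rep_carrier[OF rho g] ij(1) ab(1)] by simp
    moreover have "inv (h \<otimes> g) \<otimes> h = inv g" using g h by (simp add: inv_mult_group m_assoc)
    ultimately show "(\<Sum>l<n. \<rho> h $$ (i,l) * \<rho> g $$ (l,a) * \<sigma> (inv g) $$ (b,j)) = ?F (h \<otimes> g)"
      by (simp add: sum_distrib_right)
  qed
  also have "\<dots> = (\<Sum>x\<in>carrier G. ?F x)" by (rule sum_left_translate[OF h])
  also have "\<dots> = (\<Sum>x\<in>carrier G. \<Sum>l<m. \<rho> x $$ (i,a) * (\<sigma> (inv x) $$ (b,l) * \<sigma> h $$ (l,j)))"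
  proof (rule sum.cong[OF refl])
    fix x assume x: "x \<in> carrier G"
    then have ix: "inv x \<in> carrier G" by simp
    show "?F x = (\<Sum>l<m. \<rho> x $$ (i,a) * (\<sigma> (inv x) $$ (b,l) * \<sigma> h $$ (l,j)))"
      using rep_mult[OF sig ix h]
        mat_mult_entry[OF rep_carrier[OF sig ix] rep_carrier[OF sig h] ab(2) ij(2)]
      by (simp add: sum_distrib_left)
  qed
  also have "\<dots> = (\<Sum>l<m. (\<Sum>x\<in>carrier G. \<rho> x $$ (i,a) * \<sigma> (inv x) $$ (b,l)) * \<sigma> h $$ (l,j))"
    by (simp add: sum_distrib_right mult.assoc) (rule sum.swap)
  also have "\<dots> = (avg n m \<rho> \<sigma> a b * \<sigma> h) $$ (i,j)"
    using mat_mult_entry[OF avg_carrier rep_carrier[OF sig h] ij] ij by (simp add: avg_def)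
  finally show "(\<rho> h * avg n m \<rho> \<sigma> a b) $$ (i,j) = (avg n m \<rho> \<sigma> a b * \<sigma> h) $$ (i,j)" .
qed (use rep_carrier[OF rho h] rep_carrier[OF sig h] in \<open>auto simp: avg_def\<close>)

lemma sum_character_product:
  assumes rho: "complex_rep G n \<rho>" and sig: "complex_rep G m \<sigma>"
  shows "(\<Sum>g\<in>carrier G. mat_trace (\<rho> g) * mat_trace (\<sigma> (inv g)))
       = (\<Sum>a<n. \<Sum>b<m. avg n m \<rho> \<sigma> a b $$ (a,b))"
proof -
  have "(\<Sum>g\<in>carrier G. mat_trace (\<rho> g) * mat_trace (\<sigma> (inv g)))
      = (\<Sum>g\<in>carrier G. \<Sum>a<n. \<Sum>b<m. \<rho> g $$ (a,a) * \<sigma> (inv g) $$ (b,b))"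
  proof (intro sum.cong[OF refl])
    fix g assume "g \<in> carrier G"
    then have "dim_row (\<rho> g) = n" "dim_row (\<sigma> (inv g)) = m"
      using rep_carrier[OF rho] rep_carrier[OF sig] by auto
    then show "mat_trace (\<rho> g) * mat_trace (\<sigma> (inv g))
        = (\<Sum>a<n. \<Sum>b<m. \<rho> g $$ (a,a) * \<sigma> (inv g) $$ (b,b))"
      by (simp add: mat_trace_def sum_product)
  qed
  also have "\<dots> = (\<Sum>a<n. \<Sum>g\<in>carrier G. \<Sum>b<m. \<rho> g $$ (a,a) * \<sigma> (inv g) $$ (b,b))"
    by (rule sum.swap)
  also have "\<dots> = (\<Sum>a<n. \<Sum>b<m. \<Sum>g\<in>carrier G. \<rho> g $$ (a,a) * \<sigma> (inv g) $$ (b,b))"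
    by (rule sum.cong[OF refl], rule sum.swap)
  also have "\<dots> = (\<Sum>a<n. \<Sum>b<m. avg n m \<rho> \<sigma> a b $$ (a,b))" by (simp add: avg_def)
  finally show ?thesis .
qed

lemma Irr_orthogonal:
  assumes chi: "\<chi> \<in> Irr G" and psi: "\<psi> \<in> Irr G" and ne: "\<chi> \<noteq> \<psi>"
  shows "(\<Sum>g\<in>carrier G. \<chi> g * \<psi> (inv g)) = 0"
proof -
  obtain n \<rho> where r: "irreducible_rep G n \<rho>" "\<And>g. g \<in> carrier G \<Longrightarrow> \<chi> g = mat_trace (\<rho> g)"
    "\<chi> = rep_character G \<rho>" using IrrE[OF chi] by metis
  obtain m \<sigma> where s: "irreducible_rep G m \<sigma>" "\<And>g. g \<in> carrier G \<Longrightarrow> \<psi> g = mat_trace (\<sigma> g)"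
    "\<psi> = rep_character G \<sigma>" using IrrE[OF psi] by metis
  note rr = irreducible_repD(1)[OF r(1)] and ss = irreducible_repD(1)[OF s(1)]
  have "avg n m \<rho> \<sigma> a b = 0\<^sub>m n m" if "a < n" "b < m" for a b
  proof (rule ccontr)
    assume nz: "avg n m \<rho> \<sigma> a b \<noteq> 0\<^sub>m n m"
    have "\<chi> = \<psi>"
      unfolding r(3) s(3) rep_character_def
      using schur_intertwiner[OF r(1) s(1) avg_carrier avg_intertwines[OF rr ss that] nz]
      by (intro restrict_ext) auto
    then show False using ne by simp
  qed
  then have "(\<Sum>a<n. \<Sum>b<m. avg n m \<rho> \<sigma> a b $$ (a,b)) = 0" by simp
  then show ?thesis using sum_character_product[OF rr ss] r(2) s(2) by simp
qed

text \<open>For \<open>\<sigma> = \<rho>\<close> the intertwiner \<open>avg\<close> is a scalar matrix with trace \<open>\<bar>G\<bar>\<close> if \<open>a = b\<close> and \<open>0\<close> otherwise.\<close>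

lemma Irr_norm:
  assumes chi: "\<chi> \<in> Irr G"
  shows "(\<Sum>g\<in>carrier G. \<chi> g * \<chi> (inv g)) = cN"
proof -
  obtain n \<rho> where r: "irreducible_rep G n \<rho>" "\<And>g. g \<in> carrier G \<Longrightarrow> \<chi> g = mat_trace (\<rho> g)"
    and n: "0 < n" using IrrE[OF chi] by metis
  note rr = irreducible_repD(1)[OF r(1)]
  have val: "avg n n \<rho> \<rho> a b $$ (a,b) = (if a = b then cN / of_nat n else 0)" if ab: "a < n" "b < n" for a b
  proof -
    obtain c where c: "avg n n \<rho> \<rho> a b = c \<cdot>\<^sub>m 1\<^sub>m n"
      by (rule schur_scalar[OF r(1) avg_carrier avg_intertwines[OF rr rr ab]])
    have "c * of_nat n = (\<Sum>i<n. avg n n \<rho> \<rho> a b $$ (i,i))"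
      unfolding c by (simp add: mult.commute)
    also have "\<dots> = (\<Sum>i<n. \<Sum>g\<in>carrier G. \<rho> (inv g) $$ (b,i) * \<rho> g $$ (i,a))"
      by (simp add: avg_def mult.commute)
    also have "\<dots> = (\<Sum>g\<in>carrier G. \<Sum>i<n. \<rho> (inv g) $$ (b,i) * \<rho> g $$ (i,a))" by (rule sum.swap)
    also have "\<dots> = (\<Sum>g\<in>carrier G. 1\<^sub>m n $$ (b,a))"
    proof (rule sum.cong[OF refl])
      fix g assume g: "g \<in> carrier G"
      then have ig: "inv g \<in> carrier G" by simp
      have "\<rho> (inv g) * \<rho> g = 1\<^sub>m n" using rep_mult[OF rr ig g] g rep_one[OF rr] by simp
      then show "(\<Sum>i<n. \<rho> (inv g) $$ (b,i) * \<rho> g $$ (i,a)) = 1\<^sub>m n $$ (b,a)"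
        using mat_mult_entry[OF rep_carrier[OF rr ig] rep_carrier[OF rr g] ab(2,1)] by simp
    qed
    also have "\<dots> = (if a = b then cN else 0)" using ab by (simp add: Coset.order_def)
    finally have "c * of_nat n = (if a = b then cN else 0)" .
    then have "c = (if a = b then cN / of_nat n else 0)" using n by (auto simp: field_simps)
    then show ?thesis using c ab by simp
  qed
  have "(\<Sum>a<n. \<Sum>b<n. avg n n \<rho> \<rho> a b $$ (a,b)) = (\<Sum>a<n. \<Sum>b<n. if a = b then cN / of_nat n else 0)"
    using val by (intro sum.cong[OF refl]) auto
  also have "\<dots> = cN" using n by simp
  finally show ?thesis using sum_character_product[OF rr rr] r(2) by simp
qed

lemma act_cong: "(\<And>g. g \<in> carrier G \<Longrightarrow> f g = f' g) \<Longrightarrow> act n \<rho> f = act n \<rho> f'"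
  by (simp add: act_def)

text \<open>The sum of the central idempotents of the group algebra that belong to the characters in \<open>S\<close>.\<close>

definition char_idem :: "('a \<Rightarrow> complex) set \<Rightarrow> 'a \<Rightarrow> complex" where
  "char_idem S g = (\<Sum>\<chi>\<in>S. \<chi> \<one> * \<chi> (inv g)) / cN"

lemma char_idem_class_fun:
  assumes S: "S \<subseteq> Irr G"
  shows "class_fun (char_idem S)"
  unfolding class_fun_def
proof (intro ballI)
  fix g h assume gh: "g \<in> carrier G" "h \<in> carrier G"
  have *: "\<chi> (inv (g \<otimes> h)) = \<chi> (inv (h \<otimes> g))" if "\<chi> \<in> S" for \<chi>
    using Irr_commute[of \<chi> "inv h" "inv g"] that S gh by (auto simp: inv_mult_group)
  have "(\<Sum>\<chi>\<in>S. \<chi> \<one> * \<chi> (inv (g \<otimes> h))) = (\<Sum>\<chi>\<in>S. \<chi> \<one> * \<chi> (inv (h \<otimes> g)))"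
    by (rule sum.cong[OF refl]) (simp only: *)
  then show "char_idem S (g \<otimes> h) = char_idem S (h \<otimes> g)" by (simp add: char_idem_def)
qed

lemma char_idem_inner:
  assumes S: "S \<subseteq> Irr G" "finite S" and psi: "\<psi> \<in> Irr G"
  shows "(\<Sum>g\<in>carrier G. char_idem S g * \<psi> g) = (if \<psi> \<in> S then \<psi> \<one> else 0)"
proof -
  have "(\<Sum>g\<in>carrier G. char_idem S g * \<psi> g)
      = (\<Sum>g\<in>carrier G. \<Sum>\<chi>\<in>S. \<chi> \<one> / cN * (\<psi> g * \<chi> (inv g)))"
    by (simp add: char_idem_def sum_divide_distrib sum_distrib_left mult_ac)
  also have "\<dots> = (\<Sum>\<chi>\<in>S. \<Sum>g\<in>carrier G. \<chi> \<one> / cN * (\<psi> g * \<chi> (inv g)))" by (rule sum.swap)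
  also have "\<dots> = (\<Sum>\<chi>\<in>S. \<chi> \<one> / cN * (if \<psi> = \<chi> then cN else 0))"
  proof (rule sum.cong[OF refl])
    fix \<chi> assume "\<chi> \<in> S"
    then have "(\<Sum>g\<in>carrier G. \<psi> g * \<chi> (inv g)) = (if \<psi> = \<chi> then cN else 0)"
      using Irr_orthogonal[OF psi, of \<chi>] Irr_norm[OF psi] S by auto
    then show "(\<Sum>g\<in>carrier G. \<chi> \<one> / cN * (\<psi> g * \<chi> (inv g)))
        = \<chi> \<one> / cN * (if \<psi> = \<chi> then cN else 0)"
      by (simp only: sum_distrib_left[symmetric])
  qed
  also have "\<dots> = (\<Sum>\<chi>\<in>S. if \<psi> = \<chi> then \<chi> \<one> else 0)"
    using cN_nonzero by (intro sum.cong[OF refl]) auto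
  also have "\<dots> = (if \<psi> \<in> S then \<psi> \<one> else 0)" using S(2) by simp
  finally show ?thesis .
qed

lemma act_char_idem_irreducible:
  assumes S: "S \<subseteq> Irr G" "finite S" and irr: "irreducible_rep G n \<rho>" and "rep_character G \<rho> \<in> S"
  shows "act n \<rho> (char_idem S) = 1\<^sub>m n"
proof -
  let ?\<psi> = "rep_character G \<rho>"
  obtain c where c: "act n \<rho> (char_idem S) = c \<cdot>\<^sub>m 1\<^sub>m n"
    "c * of_nat n = (\<Sum>g\<in>carrier G. char_idem S g * mat_trace (\<rho> g))"
    by (rule act_class_fun_scalar[OF irr char_idem_class_fun[OF S(1)]])
  have "(\<Sum>g\<in>carrier G. char_idem S g * mat_trace (\<rho> g)) = ?\<psi> \<one>"
    using char_idem_inner[OF S, of ?\<psi>] assms(4) S(1) by (auto simp: rep_character_apply)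
  also have "\<dots> = of_nat n"
    using rep_one[OF irreducible_repD(1)[OF irr]] by (simp add: rep_character_apply mat_trace_one)
  finally have "c = 1" using c(2) irreducible_repD(2)[OF irr] by simp
  then show ?thesis unfolding c(1) by (intro eq_matI) auto
qed

text \<open>Convolving with \<open>\<chi> \<circ> inv\<close> multiplies it by the scalar through which the other factor acts in the
  representation of \<open>\<chi>\<close>, and \<open>char_idem S\<close> acts as the identity there for \<open>\<chi> \<in> S\<close>.\<close>

lemma convol_char_idem:
  assumes S: "S \<subseteq> Irr G" "finite S" and h: "h \<in> carrier G"
  shows "convol (char_idem S) (char_idem S) h = char_idem S h"
proof -
  let ?f = "char_idem S"
  have "convol ?f ?f h = (\<Sum>g\<in>carrier G. \<Sum>\<chi>\<in>S. \<chi> \<one> / cN * (?f (inv g \<otimes> h) * \<chi> (inv g)))"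
    unfolding convol_def
    by (subst (1) char_idem_def) (simp add: sum_divide_distrib sum_distrib_left mult_ac)
  also have "\<dots> = (\<Sum>\<chi>\<in>S. \<Sum>g\<in>carrier G. \<chi> \<one> / cN * (?f (inv g \<otimes> h) * \<chi> (inv g)))" by (rule sum.swap)
  also have "\<dots> = (\<Sum>\<chi>\<in>S. \<chi> \<one> * \<chi> (inv h) / cN)"
  proof (rule sum.cong[OF refl])
    fix \<chi> assume "\<chi> \<in> S"
    then have chi: "\<chi> \<in> Irr G" using S by blast
    have "(\<Sum>g\<in>carrier G. ?f (inv g \<otimes> h) * \<chi> (inv g)) = (\<Sum>g\<in>carrier G. ?f (g \<otimes> h) * \<chi> g)"
      by (rule sum_inverse[of "\<lambda>g. ?f (g \<otimes> h) * \<chi> g"])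
    also have "\<dots> = (\<Sum>g\<in>carrier G. ?f (g \<otimes> h) * \<chi> (g \<otimes> h \<otimes> inv h))"
      using h by (intro sum.cong[OF refl]) (simp add: m_assoc)
    also have "\<dots> = (\<Sum>u\<in>carrier G. ?f u * \<chi> (u \<otimes> inv h))"
      by (rule sum_right_translate[OF h])
    finally have "\<chi> \<one> * (\<Sum>g\<in>carrier G. ?f (inv g \<otimes> h) * \<chi> (inv g)) = \<chi> \<one> * \<chi> (inv h)"
      using Irr_central[OF chi char_idem_class_fun[OF S(1)], of "inv h"] h
        char_idem_inner[OF S chi] \<open>\<chi> \<in> S\<close> by simp
    then show "(\<Sum>g\<in>carrier G. \<chi> \<one> / cN * (?f (inv g \<otimes> h) * \<chi> (inv g))) = \<chi> \<one> * \<chi> (inv h) / cN"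
      using cN_nonzero by (subst sum_distrib_left[symmetric]) (simp add: field_simps)
  qed
  also have "\<dots> = ?f h" by (simp add: char_idem_def sum_divide_distrib)
  finally show ?thesis .
qed

lemma act_char_idem_idem:
  assumes "S \<subseteq> Irr G" "finite S" "complex_rep G n \<rho>"
  shows "act n \<rho> (char_idem S) * act n \<rho> (char_idem S) = act n \<rho> (char_idem S)"
  using act_convol[OF assms(3)] act_cong[OF convol_char_idem[OF assms(1,2)]] by simp

text \<open>Left translation permutes the group elements, numbered by \<open>e\<close>. The coefficients of an element of
  the group algebra can be read off from its action.\<close>

lemma regular_rep:
  obtains \<rho> e where "bij_betw e {..<Coset.order G} (carrier G)" "complex_rep G (Coset.order G) \<rho>"
    "\<forall>f. \<forall>i<Coset.order G. \<forall>j<Coset.order G.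
       act (Coset.order G) \<rho> f $$ (i,j) = f (e i \<otimes> inv (e j))"
proof -
  let ?N = "Coset.order G"
  obtain e where e: "bij_betw e {..<?N} (carrier G)"
    using ex_bij_betw_nat_finite[OF fin] by (auto simp: Coset.order_def atLeast0LessThan)
  have ec: "e i \<in> carrier G" if "i < ?N" for i using e that by (auto simp: bij_betw_def)
  have einj: "e i = e j \<longleftrightarrow> i = j" if "i < ?N" "j < ?N" for i j
    using e that by (auto simp: bij_betw_def inj_on_def)
  define \<rho> where "\<rho> g = mat ?N ?N (\<lambda>(i,j). if e i = g \<otimes> e j then 1 else 0 :: complex)" for g
  have rc: "\<rho> g \<in> carrier_mat ?N ?N" for g by (simp add: \<rho>_def)
  have "\<rho> (g \<otimes> h) = \<rho> g * \<rho> h" if g: "g \<in> carrier G" and h: "h \<in> carrier G" for g h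
  proof (rule eq_matI)
    fix i j assume "i < dim_row (\<rho> g * \<rho> h)" "j < dim_col (\<rho> g * \<rho> h)"
    then have ij: "i < ?N" "j < ?N" by (auto simp: \<rho>_def)
    have "h \<otimes> e j \<in> e ` {..<?N}" using e ec[OF ij(2)] h by (auto simp: bij_betw_def)
    then obtain l0 where l0: "l0 < ?N" "e l0 = h \<otimes> e j" by auto
    have "(\<rho> g * \<rho> h) $$ (i,j) = (\<Sum>l<?N. (if e i = g \<otimes> e l then 1 else 0) * (if e l = h \<otimes> e j then 1 else 0))"
      unfolding mat_mult_entry[OF rc rc ij] using ij by (intro sum.cong) (auto simp: \<rho>_def)
    also have "\<dots> = (\<Sum>l<?N. if l = l0 then (if e i = g \<otimes> e l0 then 1 else 0) else 0)"
      using einj[OF _ l0(1)] by (intro sum.cong[OF refl]) (simp add: l0(2)[symmetric])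
    also have "\<dots> = (if e i = g \<otimes> e l0 then 1 else 0)" using l0 by simp
    also have "\<dots> = \<rho> (g \<otimes> h) $$ (i,j)"
      using ij l0 g h ec by (simp add: \<rho>_def m_assoc)
    finally show "\<rho> (g \<otimes> h) $$ (i,j) = (\<rho> g * \<rho> h) $$ (i,j)" by simp
  qed (auto simp: \<rho>_def)
  moreover have "\<rho> \<one> = 1\<^sub>m ?N"
    by (rule eq_matI) (use ec einj in \<open>auto simp: \<rho>_def\<close>)
  ultimately have rep: "complex_rep G ?N \<rho>" using rc unfolding complex_rep_iff by blast
  have "act ?N \<rho> f $$ (i,j) = f (e i \<otimes> inv (e j))" if ij: "i < ?N" "j < ?N" for f i j
  proof -
    have "act ?N \<rho> f $$ (i,j) = (\<Sum>g\<in>carrier G. if g = e i \<otimes> inv (e j) then f (e i \<otimes> inv (e j)) else 0)"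
      unfolding act_def using ij ec[OF ij(1)] ec[OF ij(2)]
      by (simp, intro sum.cong[OF refl]) (auto simp: \<rho>_def m_assoc inv_solve_right')
    also have "\<dots> = f (e i \<otimes> inv (e j))" using fin ec[OF ij(1)] ec[OF ij(2)] by simp
    finally show ?thesis .
  qed
  with e rep that show ?thesis by simp
qed

text \<open>The idempotent \<open>char_idem S\<close> has coefficient \<open>(\<Sum>\<chi>\<in>S. (\<chi> 1)\<^sup>2) / \<bar>G\<bar>\<close> at the identity, hence this sum
  as its trace in the regular representation, and the trace of an idempotent is at most its size.
  That bounds finite sets of characters before \<open>Irr G\<close> is known to be finite.\<close>

lemma sum_deg_squares_le:
  assumes S: "S \<subseteq> Irr G" "finite S"
  shows "(\<Sum>\<chi>\<in>S. (deg \<chi>)\<^sup>2) \<le> Coset.order G"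
proof -
  let ?N = "Coset.order G"
  obtain \<rho> e where e: "bij_betw e {..<?N} (carrier G)" and rep: "complex_rep G ?N \<rho>"
    and ent: "\<forall>f. \<forall>i<?N. \<forall>j<?N. act ?N \<rho> f $$ (i,j) = f (e i \<otimes> inv (e j))"
    by (rule regular_rep)
  obtain k where k: "k \<le> ?N" "mat_trace (act ?N \<rho> (char_idem S)) = of_nat k"
    by (rule idempotent_trace[OF act_carrier act_char_idem_idem[OF S rep]])
  have ec: "e i \<in> carrier G" if "i < ?N" for i using e that by (auto simp: bij_betw_def)
  have "mat_trace (act ?N \<rho> (char_idem S)) = (\<Sum>i<?N. act ?N \<rho> (char_idem S) $$ (i,i))"
    by (simp add: mat_trace_def act_def)
  also have "\<dots> = (\<Sum>i<?N. char_idem S \<one>)"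
    using ent ec by (intro sum.cong[OF refl]) simp
  also have "\<dots> = (\<Sum>\<chi>\<in>S. \<chi> \<one> * \<chi> \<one>)" using cN_nonzero by (simp add: char_idem_def)
  also have "\<dots> = of_nat (\<Sum>\<chi>\<in>S. (deg \<chi>)\<^sup>2)"
    using S by (simp add: power2_eq_square) (intro sum.cong[OF refl], auto simp: Irr_one)
  finally have "(of_nat k :: complex) = of_nat (\<Sum>\<chi>\<in>S. (deg \<chi>)\<^sup>2)" using k(2) by simp
  then show ?thesis using k(1) of_nat_eq_iff by metis
qed

lemma finite_Irr: "finite (Irr G)"
proof (rule ccontr)
  assume "infinite (Irr G)"
  then obtain S where S: "S \<subseteq> Irr G" "finite S" "card S = Suc (Coset.order G)"
    using infinite_arbitrarily_large by blast
  have "card S = (\<Sum>\<chi>\<in>S. 1)" by simp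
  also have "\<dots> \<le> (\<Sum>\<chi>\<in>S. (deg \<chi>)\<^sup>2)" using S deg_pos by (intro sum_mono) (auto simp: Suc_le_eq)
  also have "\<dots> \<le> Coset.order G" by (rule sum_deg_squares_le[OF S(1,2)])
  finally show False using S(3) by simp
qed

text \<open>The kernel of this idempotent is invariant. If it were nonzero, it would contain an irreducible
  representation, where the idempotent acts as the identity.\<close>

lemma act_char_idem_all:
  assumes rep: "complex_rep G n \<rho>"
  shows "act n \<rho> (char_idem (Irr G)) = 1\<^sub>m n"
proof -
  let ?E = "char_idem (Irr G)" and ?P = "act n \<rho> (char_idem (Irr G))"
  note P = act_carrier[of n \<rho> ?E]
  note idem = act_char_idem_idem[OF order_refl finite_Irr rep]
  let ?K = "{v \<in> carrier_vec n. ?P *\<^sub>v v = 0\<^sub>v n}"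
  have P0: "?P *\<^sub>v 0\<^sub>v n = 0\<^sub>v n" by (intro eq_vecI) (auto simp: act_def)
  have sub: "linear_subspace n ?K"
    unfolding linear_subspace_def using P0 mult_add_distrib_mat_vec[OF P] mult_mat_vec[OF P] by auto
  have inv: "\<rho> g *\<^sub>v w \<in> ?K" if g: "g \<in> carrier G" and w: "w \<in> ?K" for g w
  proof -
    have c: "\<rho> g \<in> carrier_mat n n" by (rule rep_carrier[OF rep g])
    have z: "\<rho> g *\<^sub>v 0\<^sub>v n = 0\<^sub>v n" using c by (intro eq_vecI) auto
    have wn: "w \<in> carrier_vec n" using w by simp
    have "?P *\<^sub>v (\<rho> g *\<^sub>v w) = \<rho> g *\<^sub>v (?P *\<^sub>v w)"
      using act_class_fun_commute[OF rep char_idem_class_fun[OF order_refl] g]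
        assoc_mult_mat_vec[OF P c wn] assoc_mult_mat_vec[OF c P wn] by simp
    then show ?thesis using w z c wn by simp
  qed
  have "?K = {0\<^sub>v n}"
  proof (rule ccontr)
    assume nz: "?K \<noteq> {0\<^sub>v n}"
    obtain k \<sigma> B where irr: "irreducible_rep G k \<sigma>" and B: "B \<in> carrier_mat n k" "inj_mat B"
      and BK: "(*\<^sub>v) B ` carrier_vec k \<subseteq> ?K" and int: "\<And>g. g \<in> carrier G \<Longrightarrow> \<rho> g * B = B * \<sigma> g"
      using irreducible_subrep[OF rep sub nz inv] by blast
    have s: "complex_rep G k \<sigma>" and k: "0 < k" using irreducible_repD[OF irr] by auto
    have "rep_character G \<sigma> \<in> Irr G" using irr unfolding Irr_def by blast
    then have "act k \<sigma> ?E = 1\<^sub>m k" by (rule act_char_idem_irreducible[OF order_refl finite_Irr irr])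
    then have PB: "?P * B = B" using act_intertwine[OF rep s B(1) int, of ?E] B(1) by simp
    let ?u = "unit_vec k 0 :: complex vec"
    have "B *\<^sub>v ?u \<in> ?K" by (rule subsetD[OF BK], rule imageI) simp
    then have "(?P * B) *\<^sub>v ?u = 0\<^sub>v n" using assoc_mult_mat_vec[OF P B(1), of ?u] by simp
    then have "?u = 0\<^sub>v k" using PB B unfolding inj_mat_def by simp
    then show False using k by (simp add: unit_vec_nonzero)
  qed
  then have "inj_mat ?P" unfolding inj_mat_def by (auto simp: act_def)
  from inj_mat_cancel[OF P this P one_carrier_mat[of n]] show ?thesis using idem P by simp
qed

text \<open>In the regular representation \<open>char_idem (Irr G)\<close> acts as the identity, so it is the identity
  element of the group algebra; compare coefficients.\<close>

theorem column_orthogonality_one: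
  assumes g: "g \<in> carrier G"
  shows "(\<Sum>\<chi>\<in>Irr G. \<chi> \<one> * \<chi> g) = (if g = \<one> then cN else 0)"
proof -
  let ?N = "Coset.order G"
  obtain \<rho> e where e: "bij_betw e {..<?N} (carrier G)" and rep: "complex_rep G ?N \<rho>"
    and ent: "\<forall>f. \<forall>i<?N. \<forall>j<?N. act ?N \<rho> f $$ (i,j) = f (e i \<otimes> inv (e j))"
    by (rule regular_rep)
  have "inv g \<in> e ` {..<?N}" "\<one> \<in> e ` {..<?N}" using e g by (auto simp: bij_betw_def)
  then obtain i j where ij: "i < ?N" "e i = inv g" "j < ?N" "e j = \<one>" by auto
  have "char_idem (Irr G) (inv g) = (if i = j then 1 else 0)"
    using ent[rule_format, OF ij(1,3), of "char_idem (Irr G)"] act_char_idem_all[OF rep] ij g by simp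
  moreover have "i = j \<longleftrightarrow> g = \<one>"
    using ij e g by (auto simp: bij_betw_def inj_on_def) (metis inv_inv inv_one)
  ultimately have "(\<Sum>\<chi>\<in>Irr G. \<chi> \<one> * \<chi> g) / cN = (if g = \<one> then 1 else 0)"
    using g by (simp add: char_idem_def)
  then show ?thesis using cN_nonzero by (auto simp: field_simps split: if_splits)
qed

lemma sum_deg_squares: "(\<Sum>\<chi>\<in>Irr G. (deg \<chi>)\<^sup>2) = Coset.order G"
proof -
  have "of_nat (\<Sum>\<chi>\<in>Irr G. (deg \<chi>)\<^sup>2) = (\<Sum>\<chi>\<in>Irr G. \<chi> \<one> * \<chi> \<one>)"
    by (simp add: power2_eq_square) (intro sum.cong[OF refl], auto simp: Irr_one)
  also have "\<dots> = cN" using column_orthogonality_one[OF one_closed] by simp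
  finally show ?thesis using of_nat_eq_iff by blast
qed

text \<open>The number \<open>k\<close> is the multiplicity of the trivial character in the restriction of \<open>\<chi>\<close> to \<open>R\<close>:
  averaging over \<open>R\<close> is an idempotent of the group algebra, and \<open>k\<close> is the trace of its action.\<close>

lemma restriction_multiplicity:
  assumes chi: "\<chi> \<in> Irr G" and R: "subgroup R G"
  obtains k where "(\<Sum>g\<in>R. \<chi> g) = of_nat (card R) * of_nat k"
proof -
  obtain n \<rho> where irr: "irreducible_rep G n \<rho>" and chi: "\<And>g. g \<in> carrier G \<Longrightarrow> \<chi> g = mat_trace (\<rho> g)"
    using IrrE[OF chi] by metis
  note rep = irreducible_repD(1)[OF irr]
  have RG: "R \<subseteq> carrier G" by (rule subgroup.subset[OF R])
  have finR: "finite R" using RG fin finite_subset by blast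
  have cR: "of_nat (card R) \<noteq> (0::complex)"
    using finR subgroup.one_closed[OF R] by (auto simp: card_gt_0_iff)
  define f where "f g = (if g \<in> R then 1 / of_nat (card R) else 0 :: complex)" for g
  have "convol f f x = f x" if x: "x \<in> carrier G" for x
  proof -
    have "convol f f x = (\<Sum>g\<in>R. 1 / of_nat (card R) * f (inv g \<otimes> x))"
      unfolding convol_def using RG fin by (intro sum.mono_neutral_cong_right) (auto simp: f_def)
    also have "\<dots> = (\<Sum>g\<in>R. 1 / of_nat (card R) * f x)"
    proof (intro sum.cong[OF refl])
      fix g assume g: "g \<in> R"
      have "inv g \<otimes> x \<in> R \<longleftrightarrow> x \<in> R"
      proof
        assume "inv g \<otimes> x \<in> R"
        then have "g \<otimes> (inv g \<otimes> x) \<in> R" using g subgroup.m_closed[OF R] by blast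
        then show "x \<in> R" using g RG x by (auto simp: m_assoc[symmetric])
      qed (use g subgroup.m_closed[OF R] subgroup.m_inv_closed[OF R] in blast)
      then show "1 / of_nat (card R) * f (inv g \<otimes> x) = 1 / of_nat (card R) * f x" by (simp add: f_def)
    qed
    also have "\<dots> = f x" using cR by simp
    finally show ?thesis .
  qed
  then have "act n \<rho> f * act n \<rho> f = act n \<rho> f" using act_convol[OF rep] act_cong by metis
  then obtain k where "mat_trace (act n \<rho> f) = of_nat k"
    by (rule idempotent_trace[OF act_carrier])
  moreover have "mat_trace (act n \<rho> f) = (\<Sum>g\<in>R. 1 / of_nat (card R) * \<chi> g)"
    unfolding act_trace[OF rep] using RG fin chi
    by (intro sum.mono_neutral_cong_right) (auto simp: f_def)
  ultimately have "(\<Sum>g\<in>R. \<chi> g) / of_nat (card R) = of_nat k" by (simp add: sum_divide_distrib)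
  then have "(\<Sum>g\<in>R. \<chi> g) = of_nat (card R) * of_nat k" using cR by (simp add: field_simps)
  then show ?thesis by (rule that)
qed

lemma trivial_character: "(\<lambda>g\<in>carrier G. 1) \<in> Irr G"
proof -
  let ?\<rho> = "\<lambda>g::'a. 1\<^sub>m 1 :: complex mat"
  have "complex_rep G 1 ?\<rho>" unfolding complex_rep_iff by simp
  moreover have "W = {0\<^sub>v 1} \<or> W = carrier_vec 1" if W: "linear_subspace 1 W" for W
  proof (rule disjCI)
    assume "W \<noteq> carrier_vec 1"
    show "W = {0\<^sub>v 1}"
    proof (rule ccontr)
      assume "W \<noteq> {0\<^sub>v 1}"
      then obtain w where w: "w \<in> W" "w \<noteq> 0\<^sub>v 1" using W unfolding linear_subspace_def by blast
      have wc: "w \<in> carrier_vec 1" using w W unfolding linear_subspace_def by blast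
      have w0: "w $ 0 \<noteq> 0"
      proof
        assume "w $ 0 = 0"
        then have "w = 0\<^sub>v 1" using wc by (intro eq_vecI) auto
        then show False using w by simp
      qed
      have "v \<in> W" if v: "v \<in> carrier_vec 1" for v
      proof -
        have "v = (v $ 0 / w $ 0) \<cdot>\<^sub>v w" using v wc w0 by (intro eq_vecI) auto
        then show ?thesis using w(1) W unfolding linear_subspace_def by metis
      qed
      then show False using \<open>W \<noteq> carrier_vec 1\<close> W unfolding linear_subspace_def by blast
    qed
  qed
  ultimately have "irreducible_rep G 1 ?\<rho>" unfolding irreducible_rep_iff by auto
  moreover have "rep_character G ?\<rho> = (\<lambda>g\<in>carrier G. 1)"
    by (simp add: rep_character_def mat_trace_def)
  ultimately show ?thesis unfolding Irr_def by force
qed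

end

section \<open>Conjugacy classes and column orthogonality\<close>

lemma card_eq_fibres_times:
  assumes "finite A" and "\<And>x. x \<in> A \<Longrightarrow> card {y \<in> A. f y = f x} = k"
  shows "card A = card (f ` A) * k"
proof -
  have "card A = (\<Sum>z\<in>f ` A. \<Sum>y\<in>{y \<in> A. f y = z}. 1)"
    using sum.image_gen[OF assms(1), of "\<lambda>_. 1::nat" f] by simp
  also have "\<dots> = (\<Sum>z\<in>f ` A. k)" using assms(2) by (intro sum.cong[OF refl]) auto
  finally show ?thesis by simp
qed

context fin_group
begin

definition conj_class :: "'a \<Rightarrow> 'a set" where
  "conj_class a = (\<lambda>g. g \<otimes> a \<otimes> inv g) ` carrier G"

definition centralizer :: "'a \<Rightarrow> 'a set" where
  "centralizer a = {g \<in> carrier G. g \<otimes> a = a \<otimes> g}"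

lemma class_subset: "a \<in> carrier G \<Longrightarrow> conj_class a \<subseteq> carrier G"
  by (auto simp: conj_class_def)

lemma finite_class [simp]: "finite (conj_class a)"
  using fin by (simp add: conj_class_def)

lemma self_in_class: "a \<in> carrier G \<Longrightarrow> a \<in> conj_class a"
  unfolding conj_class_def by (rule image_eqI[of _ _ \<one>]) auto

lemma class_pos: "a \<in> carrier G \<Longrightarrow> 0 < card (conj_class a)"
  using self_in_class by (auto simp: card_gt_0_iff)

lemma conj_conj:
  assumes "g \<in> carrier G" "h \<in> carrier G" "a \<in> carrier G"
  shows "g \<otimes> (h \<otimes> a \<otimes> inv h) \<otimes> inv g = (g \<otimes> h) \<otimes> a \<otimes> inv (g \<otimes> h)"
  using assms by (simp add: inv_mult_group m_assoc)

lemma conj_inj: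
  assumes "g \<in> carrier G" "x \<in> carrier G" "y \<in> carrier G"
  shows "g \<otimes> x \<otimes> inv g = g \<otimes> y \<otimes> inv g \<longleftrightarrow> x = y"
  using assms by simp

lemma conj_eq_iff:
  assumes "g \<in> carrier G" "x \<in> carrier G" "y \<in> carrier G"
  shows "g \<otimes> x \<otimes> inv g = y \<longleftrightarrow> x = inv g \<otimes> y \<otimes> g"
  using assms by (metis inv_closed inv_inv inv_solve_left inv_solve_right m_assoc m_closed)

lemma conj_mult:
  assumes "g \<in> carrier G" "x \<in> carrier G" "y \<in> carrier G"
  shows "g \<otimes> (x \<otimes> y) \<otimes> inv g = (g \<otimes> x \<otimes> inv g) \<otimes> (g \<otimes> y \<otimes> inv g)"
proof -
  have "inv g \<otimes> (g \<otimes> (y \<otimes> inv g)) = y \<otimes> inv g"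
    using assms by (simp add: m_assoc[symmetric])
  then show ?thesis using assms by (simp add: m_assoc)
qed

lemma conj_inv_elem:
  assumes "g \<in> carrier G" "x \<in> carrier G"
  shows "inv (g \<otimes> x \<otimes> inv g) = g \<otimes> inv x \<otimes> inv g"
  using assms by (simp add: inv_mult_group m_assoc)

lemma class_conj_closed:
  assumes "a \<in> carrier G" "x \<in> conj_class a" "g \<in> carrier G"
  shows "g \<otimes> x \<otimes> inv g \<in> conj_class a"
proof -
  obtain h where "h \<in> carrier G" "x = h \<otimes> a \<otimes> inv h" using assms(2) by (auto simp: conj_class_def)
  then show ?thesis using conj_conj[OF assms(3) _ assms(1)] assms(3) by (auto simp: conj_class_def)
qed

lemma class_eq:
  assumes a: "a \<in> carrier G" and x: "x \<in> conj_class a"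
  shows "conj_class x = conj_class a"
proof -
  obtain h where h: "h \<in> carrier G" "x = h \<otimes> a \<otimes> inv h" using x by (auto simp: conj_class_def)
  have xG: "x \<in> carrier G" using h a by simp
  have "conj_class x \<subseteq> conj_class a" using class_conj_closed[OF a x] by (auto simp: conj_class_def[of x])
  moreover have "a = inv h \<otimes> x \<otimes> inv (inv h)" using h a conj_eq_iff[of h a x] xG by simp
  then have "a \<in> conj_class x" unfolding conj_class_def by (rule image_eqI) (use h in simp)
  then have "conj_class a \<subseteq> conj_class x" using class_conj_closed[OF xG] by (auto simp: conj_class_def[of a])
  ultimately show ?thesis by blast
qed

lemma card_class_centralizer:
  assumes a: "a \<in> carrier G"
  shows "card (conj_class a) * card (centralizer a) = Coset.order G"
proof -
  have "card {y \<in> carrier G. y \<otimes> a \<otimes> inv y = g \<otimes> a \<otimes> inv g} = card (centralizer a)" if g: "g \<in> carrier G" for g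
  proof (rule bij_betw_same_card[of "\<lambda>y. inv g \<otimes> y"], rule bij_betw_byWitness[where f' = "\<lambda>c. g \<otimes> c"])
    show "(\<lambda>y. inv g \<otimes> y) ` {y \<in> carrier G. y \<otimes> a \<otimes> inv y = g \<otimes> a \<otimes> inv g} \<subseteq> centralizer a"
    proof (rule image_subsetI)
      fix y assume "y \<in> {y \<in> carrier G. y \<otimes> a \<otimes> inv y = g \<otimes> a \<otimes> inv g}"
      then have y: "y \<in> carrier G" "y \<otimes> a \<otimes> inv y = g \<otimes> a \<otimes> inv g" by auto
      have "y \<otimes> a = g \<otimes> a \<otimes> inv g \<otimes> y"
        using y a g by (metis inv_solve_right m_closed inv_closed)
      then have "inv g \<otimes> (y \<otimes> a) = inv g \<otimes> (g \<otimes> (a \<otimes> (inv g \<otimes> y)))"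
        using y a g by (simp add: m_assoc)
      then have "inv g \<otimes> y \<otimes> a = a \<otimes> (inv g \<otimes> y)"
        using y a g by (simp add: m_assoc[symmetric])
      then show "inv g \<otimes> y \<in> centralizer a" using y g by (simp add: centralizer_def)
    qed
    show "(\<lambda>c. g \<otimes> c) ` centralizer a \<subseteq> {y \<in> carrier G. y \<otimes> a \<otimes> inv y = g \<otimes> a \<otimes> inv g}"
    proof (rule image_subsetI)
      fix c assume "c \<in> centralizer a"
      then have c: "c \<in> carrier G" "c \<otimes> a = a \<otimes> c" by (auto simp: centralizer_def)
      have "c \<otimes> a \<otimes> inv c = a" using c a by (simp add: m_assoc)
      then show "g \<otimes> c \<in> {y \<in> carrier G. y \<otimes> a \<otimes> inv y = g \<otimes> a \<otimes> inv g}"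
        using c g a conj_conj[OF g c(1) a] by simp
    qed
  qed (use g in \<open>auto simp: m_assoc[symmetric] centralizer_def\<close>)
  then show ?thesis
    using card_eq_fibres_times[OF fin, of "\<lambda>g. g \<otimes> a \<otimes> inv g" "card (centralizer a)"]
    by (simp add: conj_class_def Coset.order_def)
qed

lemma subgroup_centralizer:
  assumes a: "a \<in> carrier G"
  shows "subgroup (centralizer a) G"
proof (rule subgroupI)
  show "centralizer a \<noteq> {}" using a by (auto simp: centralizer_def intro!: exI[of _ \<one>])
next
  fix x assume "x \<in> centralizer a"
  then have x: "x \<in> carrier G" "x \<otimes> a = a \<otimes> x" by (auto simp: centralizer_def)
  then have "inv x \<otimes> a = a \<otimes> inv x"
    using a by (metis inv_closed inv_solve_left inv_solve_right m_assoc m_closed)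
  then show "inv x \<in> centralizer a" using x by (simp add: centralizer_def)
next
  fix x y assume "x \<in> centralizer a" "y \<in> centralizer a"
  then have x: "x \<in> carrier G" "x \<otimes> a = a \<otimes> x" and y: "y \<in> carrier G" "y \<otimes> a = a \<otimes> y"
    by (auto simp: centralizer_def)
  have "x \<otimes> y \<otimes> a = x \<otimes> a \<otimes> y" using x(1) y a by (simp add: m_assoc)
  then show "x \<otimes> y \<in> centralizer a" using x y a by (simp add: centralizer_def m_assoc)
qed (auto simp: centralizer_def)

lemma card_subgroup_dvd:
  assumes A: "subgroup A G" and B: "subgroup B G" and AB: "A \<subseteq> B"
  shows "card A dvd card B"
proof -
  interpret H: group "G\<lparr>carrier := B\<rparr>" by (rule subgroup_imp_group[OF B])
  have "subgroup A (G\<lparr>carrier := B\<rparr>)" by (rule subgroup_incl[OF A B AB])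
  moreover have "finite (carrier (G\<lparr>carrier := B\<rparr>))"
    using subgroup.subset[OF B] fin finite_subset by auto
  ultimately have "card (rcosets\<^bsub>G\<lparr>carrier := B\<rparr>\<^esub> A) * card A = card B"
    using H.lagrange by (simp add: Coset.order_def)
  then show ?thesis by (metis dvd_triv_right)
qed

lemma coprime_subgroups_Int:
  assumes A: "subgroup A G" and B: "subgroup B G" and cop: "coprime (card A) (card B)"
  shows "A \<inter> B = {\<one>}"
proof -
  have S: "subgroup (A \<inter> B) G" by (rule subgroups_Inter_pair[OF A B])
  have "card (A \<inter> B) dvd card A" "card (A \<inter> B) dvd card B"
    using card_subgroup_dvd[OF S A] card_subgroup_dvd[OF S B] by auto
  then have "card (A \<inter> B) = 1" using cop coprime_common_divisor_nat by blast
  then obtain x where "A \<inter> B = {x}" using card_1_singletonE by blast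
  then show ?thesis using subgroup.one_closed[OF S] by auto
qed

definition conj_closed :: "'a set \<Rightarrow> bool" where
  "conj_closed S \<longleftrightarrow> S \<subseteq> carrier G \<and> (\<forall>g\<in>carrier G. \<forall>s\<in>S. g \<otimes> s \<otimes> inv g \<in> S)"

lemma conj_closed_class: "a \<in> carrier G \<Longrightarrow> conj_closed (conj_class a)"
  unfolding conj_closed_def using class_subset class_conj_closed by blast

lemma conj_closed_commute:
  assumes S: "conj_closed S" and "g \<in> carrier G" "h \<in> carrier G" "g \<otimes> h \<in> S"
  shows "h \<otimes> g \<in> S"
proof -
  have "inv g \<otimes> (g \<otimes> h) \<otimes> inv (inv g) \<in> S" using assms unfolding conj_closed_def by blast
  moreover have "inv g \<otimes> (g \<otimes> h) \<otimes> inv (inv g) = h \<otimes> g" using assms by (simp add: m_assoc[symmetric])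
  ultimately show ?thesis by simp
qed

lemma Irr_conj:
  assumes "\<chi> \<in> Irr G" "g \<in> carrier G" "a \<in> carrier G"
  shows "\<chi> (g \<otimes> a \<otimes> inv g) = \<chi> a"
  using Irr_commute[OF assms(1), of "g \<otimes> a" "inv g"] assms by (simp add: m_assoc[symmetric])

lemma Irr_class: "\<chi> \<in> Irr G \<Longrightarrow> a \<in> carrier G \<Longrightarrow> x \<in> conj_class a \<Longrightarrow> \<chi> x = \<chi> a"
  using Irr_conj by (auto simp: conj_class_def)

lemma Irr_class_sum:
  assumes chi: "\<chi> \<in> Irr G" and S: "conj_closed S" and h: "h \<in> carrier G"
  shows "\<chi> \<one> * (\<Sum>s\<in>S. \<chi> (s \<otimes> h)) = (\<Sum>s\<in>S. \<chi> s) * \<chi> h"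
proof -
  let ?f = "\<lambda>g. if g \<in> S then 1 else 0 :: complex"
  have SG: "S \<subseteq> carrier G" using S unfolding conj_closed_def by blast
  have "class_fun ?f" unfolding class_fun_def using conj_closed_commute[OF S] by auto
  from Irr_central[OF chi this h]
  have *: "\<chi> \<one> * (\<Sum>g\<in>carrier G. ?f g * \<chi> (g \<otimes> h)) = (\<Sum>g\<in>carrier G. ?f g * \<chi> g) * \<chi> h" .
  have "(\<Sum>g\<in>carrier G. ?f g * F g) = (\<Sum>s\<in>S. F s)" for F
    using SG fin by (intro sum.mono_neutral_cong_right) auto
  then show ?thesis using * by simp
qed

text \<open>Summing \<open>Irr_class_sum\<close> over all characters reduces this to the column of the identity. The
  inverse of \<open>g\<close> takes the place of complex conjugation in the usual form of the relation.\<close>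

lemma column_orthogonality:
  assumes a: "a \<in> carrier G" and g: "g \<in> carrier G"
  shows "of_nat (card (conj_class a)) * (\<Sum>\<chi>\<in>Irr G. \<chi> a * \<chi> g) = (if inv g \<in> conj_class a then cN else 0)"
proof -
  have "of_nat (card (conj_class a)) * (\<Sum>\<chi>\<in>Irr G. \<chi> a * \<chi> g)
      = (\<Sum>\<chi>\<in>Irr G. (\<Sum>s\<in>conj_class a. \<chi> s) * \<chi> g)"
    unfolding sum_distrib_left
  proof (rule sum.cong[OF refl])
    fix \<chi> assume chi: "\<chi> \<in> Irr G"
    have "(\<Sum>s\<in>conj_class a. \<chi> s) = of_nat (card (conj_class a)) * \<chi> a" using Irr_class[OF chi a] by simp
    then show "of_nat (card (conj_class a)) * (\<chi> a * \<chi> g) = (\<Sum>s\<in>conj_class a. \<chi> s) * \<chi> g" by simp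
  qed
  also have "\<dots> = (\<Sum>\<chi>\<in>Irr G. \<chi> \<one> * (\<Sum>s\<in>conj_class a. \<chi> (s \<otimes> g)))"
    using Irr_class_sum[OF _ conj_closed_class[OF a] g] by (intro sum.cong[OF refl]) simp
  also have "\<dots> = (\<Sum>s\<in>conj_class a. \<Sum>\<chi>\<in>Irr G. \<chi> \<one> * \<chi> (s \<otimes> g))"
    by (simp add: sum_distrib_left) (rule sum.swap)
  also have "\<dots> = (\<Sum>s\<in>conj_class a. if s = inv g then cN else 0)"
  proof (rule sum.cong[OF refl])
    fix s assume "s \<in> conj_class a"
    then have s: "s \<in> carrier G" using class_subset[OF a] by blast
    have "s \<otimes> g = \<one> \<longleftrightarrow> s = inv g" using s g by (metis inv_equality l_inv)
    then show "(\<Sum>\<chi>\<in>Irr G. \<chi> \<one> * \<chi> (s \<otimes> g)) = (if s = inv g then cN else 0)"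
      using column_orthogonality_one[of "s \<otimes> g"] s g by simp
  qed
  also have "\<dots> = (if inv g \<in> conj_class a then cN else 0)" by simp
  finally show ?thesis .
qed

lemma max_irr_degree_eq:
  assumes chi: "\<chi> \<in> Irr G" and max: "\<And>\<psi>. \<psi> \<in> Irr G \<Longrightarrow> deg \<psi> \<le> deg \<chi>"
  shows "max_irr_degree G = deg \<chi>"
proof -
  have "{n. \<exists>\<chi>\<in>Irr G. \<chi> \<one> = of_nat n} = deg ` Irr G"
    using Irr_one by (auto simp: image_iff) (metis of_nat_eq_iff)
  then show ?thesis unfolding max_irr_degree_def
    using finite_Irr chi max by (intro Max_eqI) auto
qed

lemma deg_squares_pair_le:
  assumes "\<chi> \<in> Irr G" "\<psi> \<in> Irr G" "\<chi> \<noteq> \<psi>"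
  shows "(deg \<chi>)\<^sup>2 + (deg \<psi>)\<^sup>2 \<le> Coset.order G"
  using sum_deg_squares_le[of "{\<chi>, \<psi>}"] assms by simp

text \<open>If both \<open>a\<close> and \<open>b\<close> differ from the identity, then \<open>column_orthogonality_one\<close> for the difference of
  their columns leaves the single term \<open>\<chi> 1 (\<chi> a - \<chi> b) = 0\<close>. So one of the two columns is that of
  the identity.\<close>

lemma CD1_group_iff:
  "CD1_group G \<longleftrightarrow> 2 < Coset.order G \<and>
     (\<exists>a\<in>carrier G - {\<one>}. \<exists>\<chi>\<in>Irr G. \<chi> a \<noteq> \<chi> \<one> \<and> (\<forall>\<psi>\<in>Irr G - {\<chi>}. \<psi> a = \<psi> \<one>))"
    (is "_ \<longleftrightarrow> _ \<and> ?R")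
proof -
  have "?R" if ab: "a \<in> carrier G" "b \<in> carrier G" and chi: "\<chi> \<in> Irr G" "\<chi> a \<noteq> \<chi> b"
    and others: "\<forall>\<psi>\<in>Irr G - {\<chi>}. \<psi> a = \<psi> b" for a b \<chi>
  proof -
    have "a = \<one> \<or> b = \<one>"
    proof (rule ccontr)
      assume "\<not> ?thesis"
      then have "(\<Sum>\<psi>\<in>Irr G. \<psi> \<one> * \<psi> a) - (\<Sum>\<psi>\<in>Irr G. \<psi> \<one> * \<psi> b) = 0"
        using column_orthogonality_one ab by simp
      then have "(\<Sum>\<psi>\<in>Irr G. \<psi> \<one> * (\<psi> a - \<psi> b)) = 0"
        by (simp add: sum_subtractf right_diff_distrib)
      also have "(\<Sum>\<psi>\<in>Irr G. \<psi> \<one> * (\<psi> a - \<psi> b)) = \<chi> \<one> * (\<chi> a - \<chi> b)"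
        using others by (subst sum.remove[OF finite_Irr chi(1)]) (simp add: sum.neutral)
      finally show False using chi Irr_one_nonzero by simp
    qed
    then show ?thesis
    proof
      assume "a = \<one>"
      moreover have "\<psi> b = \<psi> a" if "\<psi> \<in> Irr G" "\<psi> \<noteq> \<chi>" for \<psi> 
        by (rule others[rule_format, symmetric]) (use that in simp)
      ultimately show ?thesis using chi ab by (intro bexI[of _ b] bexI[of _ \<chi>]) auto
    next
      assume "b = \<one>"
      then show ?thesis using chi others ab by (intro bexI[of _ a] bexI[of _ \<chi>]) auto
    qed
  qed
  moreover have "\<not> conjugate_elems G a \<one>" if "a \<in> carrier G - {\<one>}" for a
  proof
    assume "conjugate_elems G a \<one>"
    then obtain g where g: "g \<in> carrier G" "g \<otimes> a \<otimes> inv g = \<one>" by (auto simp: conjugate_elems_def)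
    then have "a = inv g \<otimes> \<one> \<otimes> g" using conj_eq_iff[of g a \<one>] that by blast
    then show False using g that by simp
  qed
  ultimately show ?thesis unfolding CD1_group_def by (intro conj_cong refl iffI) blast+
qed

end

section \<open>Two columns that differ in exactly one entry\<close>

locale cd1_pair = fin_group +
  fixes a :: 'a and \<chi> :: "'a \<Rightarrow> complex"
  assumes aG: "a \<in> carrier G" and a1: "a \<noteq> \<one>"
    and chi: "\<chi> \<in> Irr G" and chi_a: "\<chi> a \<noteq> \<chi> \<one>"
    and others: "\<And>\<psi>. \<psi> \<in> Irr G \<Longrightarrow> \<psi> \<noteq> \<chi> \<Longrightarrow> \<psi> a = \<psi> \<one>"
begin

abbreviation m :: nat where "m \<equiv> card (conj_class a)"
abbreviation d :: nat where "d \<equiv> deg \<chi>"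
definition N :: "'a set" where "N = insert \<one> (conj_class a)"

lemma m_pos: "0 < m" using class_pos[OF aG] .
lemma d_pos: "0 < d" using deg_pos[OF chi] .

lemma m_nonzero: "(of_nat m :: complex) \<noteq> 0" using m_pos by (metis neq0_conv of_nat_eq_0_iff)
lemma d_nonzero: "(of_nat d :: complex) \<noteq> 0" using d_pos by simp

lemma one_notin_class: "\<one> \<notin> conj_class a"
proof
  assume "\<one> \<in> conj_class a"
  then obtain g where g: "g \<in> carrier G" "g \<otimes> a \<otimes> inv g = \<one>" by (auto simp: conj_class_def)
  then have "a = inv g \<otimes> \<one> \<otimes> g" using conj_eq_iff[OF g(1) aG one_closed] by blast
  then show False using g a1 by simp
qed

lemma card_N: "card N = Suc m"
  using one_notin_class by (simp add: N_def)

lemma N_subset: "N \<subseteq> carrier G"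
  using class_subset[OF aG] by (auto simp: N_def)

lemma N_conj_closed: "conj_closed N"
  using conj_closed_class[OF aG] unfolding conj_closed_def N_def by auto

text \<open>The difference of the columns of the identity and of \<open>a\<close> has a single nonzero entry, so its
  orthogonality relation with the column of \<open>g\<close> isolates \<open>\<chi> g\<close>.\<close>

lemma column_difference:
  assumes g: "g \<in> carrier G"
  shows "\<chi> g * (\<chi> \<one> - \<chi> a) = (if g = \<one> then cN else 0) - (if inv g \<in> conj_class a then cN / of_nat m else 0)"
proof -
  have "(\<Sum>\<psi>\<in>Irr G. \<psi> a * \<psi> g) = (if inv g \<in> conj_class a then cN else 0) / of_nat m"
    unfolding nonzero_eq_divide_eq[OF m_nonzero] column_orthogonality[OF aG g, symmetric]
    by (rule mult.commute)
  then have "(\<Sum>\<psi>\<in>Irr G. \<psi> a * \<psi> g) = (if inv g \<in> conj_class a then cN / of_nat m else 0)"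
    by (simp split: if_splits)
  then have "(\<Sum>\<psi>\<in>Irr G. \<psi> g * (\<psi> \<one> - \<psi> a))
      = (if g = \<one> then cN else 0) - (if inv g \<in> conj_class a then cN / of_nat m else 0)"
    using column_orthogonality_one[OF g] by (simp add: right_diff_distrib sum_subtractf mult.commute)
  moreover have "(\<Sum>\<psi>\<in>Irr G. \<psi> g * (\<psi> \<one> - \<psi> a)) = \<chi> g * (\<chi> \<one> - \<chi> a)"
  proof -
    have "(\<Sum>\<psi>\<in>Irr G - {\<chi>}. \<psi> g * (\<psi> \<one> - \<psi> a)) = 0"
      by (rule sum.neutral) (metis others DiffE insertI1 diff_self mult_zero_right)
    then show ?thesis by (subst sum.remove[OF finite_Irr chi]) simp
  qed
  ultimately show ?thesis by simp
qed

lemma d_times_difference: "of_nat d * (\<chi> \<one> - \<chi> a) = cN"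
  using column_difference[OF one_closed] one_notin_class Irr_one[OF chi] by simp

lemma chi_nontrivial: "\<chi> \<noteq> (\<lambda>g\<in>carrier G. 1)"
  using chi_a aG by auto

lemma d_square_less: "d\<^sup>2 < Coset.order G"
proof -
  have "d\<^sup>2 + (deg (\<lambda>g\<in>carrier G. 1))\<^sup>2 \<le> Coset.order G"
    by (rule deg_squares_pair_le[OF chi trivial_character chi_nontrivial])
  moreover have "0 < (deg (\<lambda>g\<in>carrier G. 1))\<^sup>2" using deg_pos[OF trivial_character] by simp
  ultimately show ?thesis by linarith
qed

text \<open>Otherwise \<open>\<chi> a = 0\<close> and \<open>d\<^sup>2 = \<bar>G\<bar>\<close>, which leaves no room for the trivial character.\<close>

lemma inv_a_in_class: "inv a \<in> conj_class a"
proof (rule ccontr)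
  assume "inv a \<notin> conj_class a"
  then have "\<chi> a = 0" using column_difference[OF aG] a1 chi_a by simp
  then have "of_nat (d\<^sup>2) = cN" using d_times_difference Irr_one[OF chi] by (simp add: power2_eq_square)
  then have "d\<^sup>2 = Coset.order G" using of_nat_eq_iff by blast
  then show False using d_square_less by simp
qed

lemma inv_in_class:
  assumes "g \<in> carrier G" and "inv g \<in> conj_class a"
  shows "g \<in> conj_class a"
proof -
  obtain x where x: "x \<in> carrier G" "inv g = x \<otimes> a \<otimes> inv x" using assms(2) by (auto simp: conj_class_def)
  then have "g = x \<otimes> inv a \<otimes> inv x" using conj_inv_elem[OF x(1) aG] assms(1) by (metis inv_inv)
  then show ?thesis using class_conj_closed[OF aG inv_a_in_class x(1)] by simp
qed

lemma chi_value: "\<chi> a = - of_nat d / of_nat m"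
proof -
  have "\<chi> a * (\<chi> \<one> - \<chi> a) = - (cN / of_nat m)"
    using column_difference[OF aG] a1 inv_a_in_class by simp
  moreover have "\<chi> \<one> - \<chi> a = cN / of_nat d" using d_times_difference d_pos by (simp add: field_simps)
  ultimately have "\<chi> a * (cN / of_nat d) = - (cN / of_nat m)" by simp
  moreover have "x = - D / M" if "x * (C / D) = - (C / M)" "C \<noteq> 0" "D \<noteq> 0" "M \<noteq> 0" for x C D M :: complex
  proof -
    have "C * (x * M) = C * (- D)" using that by (simp add: field_simps)
    then have "x * M = - D" using that(2) by (simp only: mult_left_cancel simp_thms)
    then show ?thesis using that(4) by (simp add: field_simps)
  qed
  ultimately show ?thesis using d_nonzero m_nonzero cN_nonzero by blast
qed

lemma chi_vanishes:
  assumes "g \<in> carrier G" "g \<notin> N"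
  shows "\<chi> g = 0"
proof -
  have "inv g \<notin> conj_class a" "g \<noteq> \<one>" using inv_in_class[OF assms(1)] assms(2) by (auto simp: N_def)
  then show ?thesis using column_difference[OF assms(1)] chi_a by simp
qed

lemma degree_equation: "d\<^sup>2 * Suc m = m * Coset.order G"
proof -
  have "of_nat d * (of_nat d + of_nat d / of_nat m) = cN"
    using d_times_difference Irr_one[OF chi] chi_value by simp
  then have "of_nat (d\<^sup>2 * Suc m) = (of_nat (m * Coset.order G) :: complex)"
  proof -
    have "D\<^sup>2 * (M + 1) = M * C" if "D * (D + D / M) = C" "M \<noteq> 0" for C D M :: complex
      using that by (auto simp: field_simps power2_eq_square)
    from this[OF \<open>of_nat d * (of_nat d + of_nat d / of_nat m) = cN\<close> m_nonzero]
    show ?thesis by (simp add: algebra_simps)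
  qed
  then show ?thesis using of_nat_eq_iff by blast
qed

text \<open>Up to the factor \<open>\<psi> 1\<close> this is the scalar by which the class sum of \<open>N\<close> acts: \<open>0\<close> for \<open>\<chi>\<close> and
  \<open>m + 1\<close> for all other characters.\<close>

lemma sum_N:
  assumes "\<psi> \<in> Irr G"
  shows "(\<Sum>s\<in>N. \<psi> s) = (if \<psi> = \<chi> then 0 else of_nat (Suc m) * \<psi> \<one>)"
proof -
  have "(\<Sum>s\<in>N. \<psi> s) = \<psi> \<one> + of_nat m * \<psi> a"
    using one_notin_class Irr_class[OF assms aG] by (simp add: N_def)
  then show ?thesis
    using others[OF assms] chi_value m_nonzero Irr_one[OF chi]
    by (auto simp: distrib_right simp del: of_nat_eq_0_iff)
qed

lemma sum_N_translate:
  assumes "\<psi> \<in> Irr G" "h \<in> carrier G"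
  shows "(\<Sum>s\<in>N. \<psi> (s \<otimes> h)) = (if \<psi> = \<chi> then 0 else of_nat (Suc m) * \<psi> h)"
  using Irr_class_sum[OF assms(1) N_conj_closed assms(2)] sum_N[OF assms(1)] Irr_one_nonzero[OF assms(1)]
  by (auto split: if_splits)

text \<open>The class sum \<open>z\<close> of \<open>N\<close> satisfies \<open>z\<^sup>2 = (m + 1) z\<close> in every irreducible representation, so every
  product of two elements of \<open>N\<close>, contributing a positive coefficient to \<open>z\<^sup>2\<close>, lies in \<open>N\<close>.\<close>

lemma N_mult_closed:
  assumes u: "u \<in> N" and v: "v \<in> N"
  shows "u \<otimes> v \<in> N"
proof (rule ccontr)
  let ?g = "u \<otimes> v"
  assume notN: "?g \<notin> N"
  have uG: "u \<in> carrier G" and vG: "v \<in> carrier G" using u v N_subset by auto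
  then have gG: "?g \<in> carrier G" and igG: "inv ?g \<in> carrier G" by auto
  have finN: "finite N" using N_subset fin finite_subset by blast
  have ig_notN: "inv ?g \<notin> N"
  proof
    assume "inv ?g \<in> N"
    then consider "inv ?g = \<one>" | "inv ?g \<in> conj_class a" by (auto simp: N_def)
    then show False
    proof cases
      case 1
      then have "?g = \<one>" using gG by (metis inv_inv inv_one)
      then show ?thesis using notN by (simp add: N_def)
    next
      case 2
      then show ?thesis using inv_in_class[OF gG] notN by (simp add: N_def)
    qed
  qed
  (* The double sum of c is the order of G times the number of pairs in N with product g. *)
  let ?c = "\<lambda>t s. if s \<otimes> (t \<otimes> inv ?g) = \<one> then Coset.order G else 0"
  have "of_nat (\<Sum>t\<in>N. \<Sum>s\<in>N. ?c t s) = (\<Sum>t\<in>N. \<Sum>s\<in>N. \<Sum>\<psi>\<in>Irr G. \<psi> \<one> * \<psi> (s \<otimes> (t \<otimes> inv ?g)))"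
    unfolding of_nat_sum
  proof (intro sum.cong[OF refl])
    fix t s assume "t \<in> N" "s \<in> N"
    then have "s \<otimes> (t \<otimes> inv ?g) \<in> carrier G" using N_subset igG by blast
    from column_orthogonality_one[OF this]
    show "of_nat (?c t s) = (\<Sum>\<psi>\<in>Irr G. \<psi> \<one> * \<psi> (s \<otimes> (t \<otimes> inv ?g)))" by simp
  qed
  also have "\<dots> = (\<Sum>t\<in>N. \<Sum>\<psi>\<in>Irr G. \<Sum>s\<in>N. \<psi> \<one> * \<psi> (s \<otimes> (t \<otimes> inv ?g)))"
    by (rule sum.cong[OF refl], rule sum.swap)
  also have "\<dots> = (\<Sum>\<psi>\<in>Irr G. \<Sum>t\<in>N. \<Sum>s\<in>N. \<psi> \<one> * \<psi> (s \<otimes> (t \<otimes> inv ?g)))" by (rule sum.swap)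
  also have "\<dots> = (\<Sum>\<psi>\<in>Irr G. if \<psi> = \<chi> then 0 else (of_nat (Suc m))\<^sup>2 * (\<psi> \<one> * \<psi> (inv ?g)))"
  proof (rule sum.cong[OF refl])
    fix \<psi> assume psi: "\<psi> \<in> Irr G"
    have "(\<Sum>t\<in>N. \<Sum>s\<in>N. \<psi> \<one> * \<psi> (s \<otimes> (t \<otimes> inv ?g)))
        = (\<Sum>t\<in>N. \<psi> \<one> * (if \<psi> = \<chi> then 0 else of_nat (Suc m) * \<psi> (t \<otimes> inv ?g)))"
    proof (rule sum.cong[OF refl])
      fix t assume "t \<in> N"
      then have "t \<otimes> inv ?g \<in> carrier G" using N_subset igG by blast
      from sum_N_translate[OF psi this]
      show "(\<Sum>s\<in>N. \<psi> \<one> * \<psi> (s \<otimes> (t \<otimes> inv ?g)))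
          = \<psi> \<one> * (if \<psi> = \<chi> then 0 else of_nat (Suc m) * \<psi> (t \<otimes> inv ?g))"
        by (simp only: sum_distrib_left[symmetric])
    qed
    also have "\<dots> = (if \<psi> = \<chi> then 0 else \<psi> \<one> * of_nat (Suc m) * (\<Sum>t\<in>N. \<psi> (t \<otimes> inv ?g)))"
      by (simp only: sum_distrib_left mult.assoc if_distrib) simp
    also have "\<dots> = (if \<psi> = \<chi> then 0 else (of_nat (Suc m))\<^sup>2 * (\<psi> \<one> * \<psi> (inv ?g)))"
      using sum_N_translate[OF psi igG] by (simp add: power2_eq_square)
    finally show "(\<Sum>t\<in>N. \<Sum>s\<in>N. \<psi> \<one> * \<psi> (s \<otimes> (t \<otimes> inv ?g)))
        = (if \<psi> = \<chi> then 0 else (of_nat (Suc m))\<^sup>2 * (\<psi> \<one> * \<psi> (inv ?g)))" .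
  qed
  also have "\<dots> = (\<Sum>\<psi>\<in>Irr G. (of_nat (Suc m))\<^sup>2 * (\<psi> \<one> * \<psi> (inv ?g)))"
    using chi_vanishes[OF igG ig_notN] by (intro sum.cong[OF refl]) auto
  also have "\<dots> = (of_nat (Suc m))\<^sup>2 * (\<Sum>\<psi>\<in>Irr G. \<psi> \<one> * \<psi> (inv ?g))" by (rule sum_distrib_left[symmetric])
  also have "\<dots> = 0" using column_orthogonality_one[OF igG] ig_notN by (auto simp: N_def)
  finally have "(\<Sum>t\<in>N. \<Sum>s\<in>N. ?c t s) = 0" by (simp only: of_nat_eq_0_iff)
  then have "?c v u = 0" using u v finN by simp
  moreover have "u \<otimes> (v \<otimes> inv ?g) = \<one>" using uG vG by (simp add: m_assoc[symmetric])
  ultimately show False using order_pos by simp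
qed

lemma N_subgroup: "subgroup N G"
proof (rule subgroupI)
  fix x assume x: "x \<in> N"
  then have xG: "x \<in> carrier G" using N_subset by blast
  show "inv x \<in> N"
  proof (cases "x = \<one>")
    case False
    then have "inv (inv x) \<in> conj_class a" using x xG by (simp add: N_def)
    then show ?thesis using inv_in_class[of "inv x"] xG by (simp add: N_def)
  qed (simp add: N_def)
qed (use N_subset N_mult_closed in \<open>auto simp: N_def\<close>)

text \<open>Let \<open>c\<close> be the order of the centralizer of \<open>a\<close>. Then \<open>degree_equation\<close> reads \<open>d\<^sup>2 (m + 1) = m\<^sup>2 c\<close>, and
  \<open>m\<^sup>2\<close> is coprime to \<open>m + 1\<close>.\<close>

lemma cd1_arith:
  obtains e where "0 < e" "d = m * e" "Coset.order G = e\<^sup>2 * m * Suc m"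
proof -
  let ?c = "card (centralizer a)"
  have ord: "m * ?c = Coset.order G" by (rule card_class_centralizer[OF aG])
  have eq: "d\<^sup>2 * Suc m = m\<^sup>2 * ?c" using degree_equation ord by (metis mult.assoc power2_eq_square)
  have "coprime (m\<^sup>2) (Suc m)" by simp
  then have "m\<^sup>2 dvd d\<^sup>2" using eq by (metis coprime_dvd_mult_left_iff dvd_triv_left)
  then have "m dvd d" by simp
  then obtain e where e: "d = m * e" by blast
  have "m\<^sup>2 * (e\<^sup>2 * Suc m) = m\<^sup>2 * ?c" using eq unfolding e by (simp only: power_mult_distrib mult.assoc)
  moreover have "m\<^sup>2 \<noteq> 0" using m_pos by (metis power_not_zero neq0_conv)
  ultimately have "?c = e\<^sup>2 * Suc m" by (metis mult_left_cancel)
  then have "Coset.order G = e\<^sup>2 * m * Suc m" using ord by (simp add: mult_ac)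
  then show ?thesis using that e d_pos by (metis mult_eq_0_iff neq0_conv)
qed

text \<open>The squares of the remaining degrees add up to \<open>\<bar>G\<bar> - d\<^sup>2 = e\<^sup>2 m \<le> d\<^sup>2\<close>.\<close>

lemma max_irr_degree_cd1: "max_irr_degree G = d"
proof (rule max_irr_degree_eq[OF chi])
  fix \<psi> assume psi: "\<psi> \<in> Irr G"
  obtain e where e: "0 < e" "d = m * e" "Coset.order G = e\<^sup>2 * m * Suc m" by (rule cd1_arith)
  show "deg \<psi> \<le> d"
  proof (cases "\<psi> = \<chi>")
    case False
    have "d\<^sup>2 + (deg \<psi>)\<^sup>2 \<le> Coset.order G" using deg_squares_pair_le[OF chi psi] False by blast
    moreover have "Coset.order G = d\<^sup>2 + e\<^sup>2 * m"
      unfolding e by (simp add: power_mult_distrib power2_eq_square algebra_simps)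
    moreover have "e\<^sup>2 * m \<le> d\<^sup>2"
      unfolding e using m_pos by (simp add: power_mult_distrib power2_eq_square)
    ultimately have "(deg \<psi>)\<^sup>2 \<le> d\<^sup>2" by linarith
    then show ?thesis by simp
  qed simp
qed

text \<open>On \<open>R\<close> the character \<open>\<chi>\<close> is supported at the identity, so it contains the trivial character
  \<open>d / \<bar>R\<bar>\<close> times.\<close>

lemma card_complement_dvd:
  assumes R: "subgroup R G" and RN: "R \<inter> N = {\<one>}"
  shows "card R dvd d"
proof -
  have RG: "R \<subseteq> carrier G" by (rule subgroup.subset[OF R])
  then have finR: "finite R" using fin finite_subset by blast
  obtain k where "(\<Sum>g\<in>R. \<chi> g) = of_nat (card R) * of_nat k" by (rule restriction_multiplicity[OF chi R])
  moreover have "(\<Sum>g\<in>R. \<chi> g) = (\<Sum>g\<in>R. if g = \<one> then \<chi> \<one> else 0)"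
    using chi_vanishes RG RN by (intro sum.cong[OF refl]) auto
  moreover have "\<dots> = of_nat d" using finR subgroup.one_closed[OF R] Irr_one[OF chi] by simp
  ultimately have "of_nat d = (of_nat (card R * k) :: complex)" by simp
  then have "d = card R * k" using of_nat_eq_iff by blast
  then show ?thesis by simp
qed

end

section \<open>Doubly transitive Frobenius groups\<close>

context fin_group
begin

lemma conjugate_coset: "g <#\<^bsub>G\<^esub> H #>\<^bsub>G\<^esub> inv g = (\<lambda>h. g \<otimes> h \<otimes> inv g) ` H"
  by (auto simp: l_coset_def r_coset_def)

text \<open>The last part is the form in which malnormality is used: \<open>H\<close> contains every element that conjugates
  some nontrivial element of \<open>H\<close> into \<open>H\<close>.\<close>

lemma frobenius_complementD:
  assumes "frobenius_complement G H"
  shows "subgroup H G" "H \<noteq> {\<one>}" "H \<noteq> carrier G"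
    "\<And>g h. g \<in> carrier G \<Longrightarrow> h \<in> H \<Longrightarrow> g \<otimes> h \<otimes> inv g \<in> H \<Longrightarrow> h \<noteq> \<one> \<Longrightarrow> g \<in> H"
proof -
  show H: "subgroup H G" "H \<noteq> {\<one>}" "H \<noteq> carrier G"
    using assms unfolding frobenius_complement_def by auto
  fix g h assume g: "g \<in> carrier G" and h: "h \<in> H" "g \<otimes> h \<otimes> inv g \<in> H" "h \<noteq> \<one>"
  show "g \<in> H"
  proof (rule ccontr)
    assume "g \<notin> H"
    then have "H \<inter> (\<lambda>h. g \<otimes> h \<otimes> inv g) ` H = {\<one>}"
      using assms g unfolding frobenius_complement_def conjugate_coset by blast
    then have "g \<otimes> h \<otimes> inv g = \<one>" using h by blast
    moreover have "h \<in> carrier G" using h subgroup.subset[OF H(1)] by blast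
    ultimately show False using conj_eq_iff[OF g, of h \<one>] g h(3) by simp
  qed
qed

text \<open>Count the pairs \<open>(g, y)\<close> with \<open>y \<in> H - {1}\<close> by the value of \<open>g y g\<inverse>\<close>. By malnormality the pairs with
  a given value form a single coset of \<open>H\<close>.\<close>

lemma card_frobenius_kernel:
  assumes F: "frobenius_complement G H"
  shows "card (frobenius_kernel G H) * card H = Coset.order G"
proof -
  note H = frobenius_complementD[OF F]
  have HG: "H \<subseteq> carrier G" by (rule subgroup.subset[OF H(1)])
  have finH: "finite H" using HG fin finite_subset by blast
  have oneH: "\<one> \<in> H" by (rule subgroup.one_closed[OF H(1)])
  let ?P = "carrier G \<times> (H - {\<one>})"
  let ?f = "\<lambda>(g,h). g \<otimes> h \<otimes> inv g"
  have fibre: "card {q \<in> ?P. ?f q = ?f p} = card H" if p: "p \<in> ?P" for p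
  proof -
    obtain g0 h0 where p0: "p = (g0,h0)" "g0 \<in> carrier G" "h0 \<in> H" "h0 \<noteq> \<one>" using p by auto
    have h0G: "h0 \<in> carrier G" using p0 HG by blast
    have "bij_betw (\<lambda>k. (g0 \<otimes> k, inv k \<otimes> h0 \<otimes> k)) H {q \<in> ?P. ?f q = ?f p}"
    proof (rule bij_betwI[where g = "\<lambda>q. inv g0 \<otimes> fst q"])
      show "(\<lambda>k. (g0 \<otimes> k, inv k \<otimes> h0 \<otimes> k)) \<in> H \<rightarrow> {q \<in> ?P. ?f q = ?f p}"
      proof
        fix k assume k: "k \<in> H"
        then have kG: "k \<in> carrier G" using HG by blast
        have "inv k \<otimes> h0 \<otimes> k \<in> H"
          using k p0 subgroup.m_closed[OF H(1)] subgroup.m_inv_closed[OF H(1)] by blast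
        moreover have "inv k \<otimes> h0 \<otimes> k \<noteq> \<one>"
          using conj_eq_iff[of "inv k" h0 \<one>] kG h0G p0(4) by auto
        moreover have "g0 \<otimes> k \<otimes> (inv k \<otimes> h0 \<otimes> k) \<otimes> inv (g0 \<otimes> k) = g0 \<otimes> h0 \<otimes> inv g0"
        proof -
          have "inv k \<otimes> h0 \<otimes> k = inv k \<otimes> h0 \<otimes> inv (inv k)" using kG by simp
          then have "k \<otimes> (inv k \<otimes> h0 \<otimes> k) \<otimes> inv k = h0"
            using conj_conj[of k "inv k" h0] kG h0G by simp
          then show ?thesis using conj_conj[OF p0(2) kG, of "inv k \<otimes> h0 \<otimes> k"] kG h0G by simp
        qed
        ultimately show "(g0 \<otimes> k, inv k \<otimes> h0 \<otimes> k) \<in> {q \<in> ?P. ?f q = ?f p}"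
          using p0 kG by simp
      qed
      show "(\<lambda>q. inv g0 \<otimes> fst q) \<in> {q \<in> ?P. ?f q = ?f p} \<rightarrow> H"
      proof
        fix q assume "q \<in> {q \<in> ?P. ?f q = ?f p}"
        then obtain g h where q: "q = (g,h)" "g \<in> carrier G" "h \<in> H" "h \<noteq> \<one>"
          "g \<otimes> h \<otimes> inv g = g0 \<otimes> h0 \<otimes> inv g0" using p0 by auto
        have hG: "h \<in> carrier G" using q HG by blast
        have "(inv g0 \<otimes> g) \<otimes> h \<otimes> inv (inv g0 \<otimes> g) = inv g0 \<otimes> (g0 \<otimes> h0 \<otimes> inv g0) \<otimes> inv (inv g0)"
          using conj_conj[of "inv g0" g h] q p0 hG by simp
        also have "\<dots> = h0" using conj_conj[of "inv g0" g0 h0] p0 h0G by simp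
        finally show "inv g0 \<otimes> fst q \<in> H"
          using H(4)[of "inv g0 \<otimes> g" h] q p0 by simp
      qed
      fix k assume "k \<in> H"
      then show "inv g0 \<otimes> fst (g0 \<otimes> k, inv k \<otimes> h0 \<otimes> k) = k"
        using HG p0 by (auto simp: m_assoc[symmetric])
    next
      fix q assume "q \<in> {q \<in> ?P. ?f q = ?f p}"
      then obtain g h where q: "q = (g,h)" "g \<in> carrier G" "h \<in> H" "h \<noteq> \<one>"
        "g \<otimes> h \<otimes> inv g = g0 \<otimes> h0 \<otimes> inv g0" using p0 by auto
      have hG: "h \<in> carrier G" using q HG by blast
      let ?k = "inv g0 \<otimes> g"
      have g: "g0 \<otimes> ?k = g" using q p0 by (simp add: m_assoc[symmetric])
      have "inv g \<otimes> (g0 \<otimes> h0 \<otimes> inv g0) \<otimes> g = h"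
        using conj_eq_iff[of g h "g0 \<otimes> h0 \<otimes> inv g0"] q p0 hG h0G by simp
      then have "inv ?k \<otimes> h0 \<otimes> ?k = h" using q p0 h0G by (simp add: inv_mult_group m_assoc)
      then show "(g0 \<otimes> (inv g0 \<otimes> fst q), inv (inv g0 \<otimes> fst q) \<otimes> h0 \<otimes> (inv g0 \<otimes> fst q)) = q"
        using q g by simp
    qed
    then show ?thesis by (rule bij_betw_same_card[symmetric])
  qed
  let ?U = "\<Union>g\<in>carrier G. g <#\<^bsub>G\<^esub> H #>\<^bsub>G\<^esub> inv g"
  have U: "?f ` ?P = ?U - {\<one>}"
  proof
    show "?f ` ?P \<subseteq> ?U - {\<one>}"
    proof (rule image_subsetI)
      fix p assume "p \<in> ?P"
      then obtain g h where p: "p = (g,h)" "g \<in> carrier G" "h \<in> H" "h \<noteq> \<one>" by auto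
      moreover have "h \<in> carrier G" using p HG by blast
      ultimately show "?f p \<in> ?U - {\<one>}"
        using conj_eq_iff[of g h \<one>] by (auto simp: conjugate_coset)
    qed
    show "?U - {\<one>} \<subseteq> ?f ` ?P"
    proof
      fix x assume "x \<in> ?U - {\<one>}"
      then obtain g h where x: "g \<in> carrier G" "h \<in> H" "x = g \<otimes> h \<otimes> inv g" "x \<noteq> \<one>"
        by (auto simp: conjugate_coset)
      then have "h \<noteq> \<one>" by auto
      then show "x \<in> ?f ` ?P" using x by force
    qed
  qed
  have "card ?P = card (?U - {\<one>}) * card H"
    using card_eq_fibres_times[of ?P ?f "card H"] fibre fin finH U by simp
  moreover have "card ?P = Coset.order G * (card H - 1)"
    using oneH finH by (simp add: card_cartesian_product Coset.order_def)
  moreover have UG: "?U \<subseteq> carrier G" using HG by (auto simp: conjugate_coset)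
  have "\<one> \<in> ?U" using oneH by (auto simp: conjugate_coset intro!: bexI[of _ \<one>] image_eqI[of _ _ \<one>])
  then have "frobenius_kernel G H = carrier G - (?U - {\<one>})"
    unfolding frobenius_kernel_def by auto
  moreover have "card (carrier G - (?U - {\<one>})) = Coset.order G - card (?U - {\<one>})"
    using UG fin by (subst card_Diff_subset) (auto simp: Coset.order_def intro: finite_subset)
  ultimately have "card (frobenius_kernel G H) * card H
      = Coset.order G * card H - Coset.order G * (card H - 1)"
    by (simp add: diff_mult_distrib)
  also have "\<dots> = Coset.order G"
  proof -
    have "0 < card H" using oneH finH by (auto simp: card_gt_0_iff)
    then obtain k where "card H = Suc k" using gr0_implies_Suc by blast
    then show ?thesis by simp
  qed
  finally show ?thesis .
qed

end

locale dt_frobenius = fin_group +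
  fixes H :: "'a set"
  assumes complement: "frobenius_complement G H"
    and transitive: "card H = card (frobenius_kernel G H) - 1"
begin

abbreviation K :: "'a set" where "K \<equiv> frobenius_kernel G H"
abbreviation h :: nat where "h \<equiv> card H"

lemmas HD = frobenius_complementD[OF complement]

lemma K_iff: "x \<in> K \<longleftrightarrow> x = \<one> \<or> x \<in> carrier G \<and> (\<forall>g\<in>carrier G. \<forall>y\<in>H. x \<noteq> g \<otimes> y \<otimes> inv g)"
  unfolding frobenius_kernel_def conjugate_coset by auto

lemma K_subset: "K \<subseteq> carrier G" by (auto simp: K_iff)

lemma finite_K: "finite K" using K_subset fin finite_subset by blast

lemma card_K: "card K = Suc h"
proof -
  have "\<one> \<in> K" by (simp add: K_iff)
  then have "0 < card K" using finite_K by (auto simp: card_gt_0_iff)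
  then show ?thesis using transitive by simp
qed

lemma order_eq: "Coset.order G = Suc h * h"
  using card_frobenius_kernel[OF complement] card_K by simp

lemma h_ge_2: "2 \<le> h"
proof -
  have "finite H" using subgroup.subset[OF HD(1)] fin finite_subset by blast
  moreover obtain y where "y \<in> H" "y \<noteq> \<one>" using HD(2) subgroup.one_closed[OF HD(1)] by blast
  moreover have "\<one> \<in> H" by (rule subgroup.one_closed[OF HD(1)])
  ultimately have "card {\<one>, y} \<le> h" by (intro card_mono) auto
  then show ?thesis using \<open>y \<noteq> \<one>\<close> by simp
qed

text \<open>If \<open>y \<noteq> 1\<close> lies in a conjugate of \<open>H\<close> and commutes with \<open>x\<close>, then \<open>x\<close> lies in the same conjugate by
  malnormality.\<close>

lemma centralizer_subset_K:
  assumes x: "x \<in> K" "x \<noteq> \<one>"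
  shows "centralizer x \<subseteq> K"
proof
  fix y assume "y \<in> centralizer x"
  then have y: "y \<in> carrier G" "y \<otimes> x = x \<otimes> y" by (auto simp: centralizer_def)
  have xG: "x \<in> carrier G" using x K_subset by blast
  show "y \<in> K"
  proof (rule ccontr)
    assume "y \<notin> K"
    then obtain g z where z: "g \<in> carrier G" "z \<in> H" "y = g \<otimes> z \<otimes> inv g" "y \<noteq> \<one>"
      using y by (auto simp: K_iff)
    have zG: "z \<in> carrier G" using z subgroup.subset[OF HD(1)] by blast
    have z1: "z \<noteq> \<one>" using z by auto
    let ?w = "inv g \<otimes> x \<otimes> g"
    have "?w \<otimes> z \<otimes> inv ?w = z"
    proof -
      have xyx: "x \<otimes> y \<otimes> inv x = y" using y xG by (metis inv_solve_right' m_closed y(2))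
      have "?w \<otimes> z \<otimes> inv ?w = inv g \<otimes> (x \<otimes> (g \<otimes> z \<otimes> inv g) \<otimes> inv x) \<otimes> g"
        using z(1) zG xG by (simp add: inv_mult_group m_assoc)
      also have "\<dots> = inv g \<otimes> y \<otimes> g" using xyx z(3) by simp
      also have "\<dots> = z" using conj_eq_iff[OF z(1) zG y(1)] z(3) by simp
      finally show ?thesis .
    qed
    then have "?w \<in> H" using HD(4)[of ?w z] z xG z1 by simp
    moreover have "x = g \<otimes> ?w \<otimes> inv g" using z(1) xG conj_eq_iff[of g ?w x] by simp
    ultimately show False using x z(1) by (auto simp: K_iff)
  qed
qed

lemma class_subset_K:
  assumes x: "x \<in> K" "x \<noteq> \<one>"
  shows "conj_class x \<subseteq> K - {\<one>}"
proof
  fix y assume "y \<in> conj_class x"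
  then obtain g where g: "g \<in> carrier G" "y = g \<otimes> x \<otimes> inv g" by (auto simp: conj_class_def)
  have xG: "x \<in> carrier G" using x K_subset by blast
  have "y \<noteq> \<one>" using conj_eq_iff[OF g(1) xG one_closed] g x(2) by simp
  moreover have "y \<in> K"
  proof (rule ccontr)
    assume "y \<notin> K"
    then obtain k z where z: "k \<in> carrier G" "z \<in> H" "y = k \<otimes> z \<otimes> inv k"
      using g xG by (auto simp: K_iff)
    have zG: "z \<in> carrier G" using z subgroup.subset[OF HD(1)] by blast
    have "x = inv g \<otimes> y \<otimes> inv (inv g)" using conj_eq_iff[OF g(1) xG, of y] g xG by simp
    also have "\<dots> = (inv g \<otimes> k) \<otimes> z \<otimes> inv (inv g \<otimes> k)"
      unfolding z(3) using conj_conj[of "inv g" k z] g z zG by simp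
    finally show False using x z g by (auto simp: K_iff)
  qed
  ultimately show "y \<in> K - {\<one>}" by simp
qed

text \<open>Both inclusions \<open>conj_class x \<subseteq> K - {1}\<close> and \<open>centralizer x \<subseteq> K\<close> must be equalities, since
  \<open>\<bar>conj_class x\<bar> \<bar>centralizer x\<bar> = \<bar>G\<bar> = h (h + 1)\<close>. In particular the kernel, as a centralizer, is a subgroup.\<close>

lemma class_centralizer_K:
  assumes x: "x \<in> K" "x \<noteq> \<one>"
  shows "conj_class x = K - {\<one>}" "centralizer x = K"
proof -
  have xG: "x \<in> carrier G" using x K_subset by blast
  have oneK: "\<one> \<in> K" by (simp add: K_iff)
  have cK: "card (K - {\<one>}) = h" using card_K finite_K oneK by simp
  have le: "card (conj_class x) \<le> h" "card (centralizer x) \<le> Suc h"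
    using card_mono[OF _ class_subset_K[OF x]] card_mono[OF finite_K centralizer_subset_K[OF x]] finite_K cK card_K by auto
  have prod: "card (conj_class x) * card (centralizer x) = h * Suc h" using card_class_centralizer[OF xG] order_eq by simp
  have h0: "0 < h" using h_ge_2 by simp
  have eq1: "card (conj_class x) = h"
  proof (rule ccontr)
    assume "card (conj_class x) \<noteq> h"
    then have "card (conj_class x) * card (centralizer x) < h * Suc h"
      using le h0 prod by (intro mult_less_le_imp_less) (auto intro!: gr0I)
    then show False using prod by simp
  qed
  then have eq2: "card (centralizer x) = Suc h" using prod h0 by (metis mult_cancel1 neq0_conv)
  show "conj_class x = K - {\<one>}" by (rule card_subset_eq) (use class_subset_K[OF x] finite_K eq1 cK in auto)
  show "centralizer x = K" by (rule card_subset_eq) (use centralizer_subset_K[OF x] finite_K eq2 card_K in auto)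
qed

lemma K_subgroup_conj: "subgroup K G" "conj_closed K"
proof -
  have "card K \<noteq> 1" using card_K h_ge_2 by simp
  then obtain x where x: "x \<in> K" "x \<noteq> \<one>"
    by (metis K_iff card_1_singleton_iff is_singletonI' is_singleton_altdef empty_iff)
  have xG: "x \<in> carrier G" using x K_subset by blast
  show "subgroup K G" using subgroup_centralizer[OF xG] class_centralizer_K(2)[OF x] by simp
  have "g \<otimes> s \<otimes> inv g \<in> K" if "g \<in> carrier G" "s \<in> K" for g s
  proof (cases "s = \<one>")
    case False
    then show ?thesis using class_subset_K[OF that(2) False] that by (auto simp: conj_class_def)
  qed (use that in \<open>simp add: K_iff\<close>)
  then show "conj_closed K" unfolding conj_closed_def using K_subset by blast
qed

text \<open>The class sum of \<open>K\<close> acts on each irreducible representation as \<open>h + 1\<close> or as \<open>0\<close>. In the second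
  case the character vanishes off \<open>K\<close> and has norm one only if its degree is \<open>h\<close>; the columns of the
  identity and of an element \<open>a \<noteq> 1\<close> of \<open>K\<close> then show that there is exactly one such character.\<close>

lemma CD1_and_degree: "CD1_group G" "max_irr_degree G = h"
proof -
  have "card K \<noteq> 1" using card_K h_ge_2 by simp
  then obtain a where a: "a \<in> K" "a \<noteq> \<one>"
    by (metis K_iff card_1_singleton_iff is_singletonI' is_singleton_altdef empty_iff)
  have aG: "a \<in> carrier G" using a K_subset by blast
  have oneK: "\<one> \<in> K" by (simp add: K_iff)
  have Kins: "K = insert \<one> (conj_class a)" and one_class: "\<one> \<notin> conj_class a" using class_centralizer_K(1)[OF a] oneK by auto
  have cc: "card (conj_class a) = h" using card_K Kins one_class by simp
  have h0: "0 < h" using h_ge_2 by simp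
  note Ks = K_subgroup_conj
  have sumK: "(\<Sum>s\<in>K. \<psi> s) = \<psi> \<one> + of_nat h * \<psi> a" if "\<psi> \<in> Irr G" for \<psi>
    unfolding Kins using one_class Irr_class[OF that aG] cc by simp
  (* K is a subgroup, so its class sum is an idempotent up to the factor h + 1. *)
  have dich: "\<psi> a = \<psi> \<one> \<or> \<psi> \<one> + of_nat h * \<psi> a = 0" if psi: "\<psi> \<in> Irr G" for \<psi>
  proof -
    let ?w = "\<Sum>s\<in>K. \<psi> s"
    have tr: "\<psi> \<one> * (\<Sum>s\<in>K. \<psi> (s \<otimes> t)) = ?w * \<psi> t" if "t \<in> carrier G" for t
      by (rule Irr_class_sum[OF psi Ks(2) that])
    have "(\<Sum>s\<in>K. \<psi> (s \<otimes> t)) = ?w" if t: "t \<in> K" for t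
      by (rule sum.reindex_bij_witness[where i = "\<lambda>s. s \<otimes> inv t" and j = "\<lambda>s. s \<otimes> t"])
        (use t subgroup.m_closed[OF Ks(1)] subgroup.m_inv_closed[OF Ks(1)] in
          \<open>auto simp: m_assoc K_subset[THEN subsetD]\<close>)
    then have "?w * \<psi> t = \<psi> \<one> * ?w" if t: "t \<in> K" for t
      using tr[of t] t K_subset by auto
    from this[OF a(1)] have "?w = 0 \<or> \<psi> a = \<psi> \<one>" by (simp add: mult.commute)
    then show ?thesis using sumK[OF psi] by auto
  qed
  have vanish: "\<psi> g = 0"
    if psi: "\<psi> \<in> Irr G" and minus: "\<psi> \<one> + of_nat h * \<psi> a = 0" and g: "g \<in> carrier G" "g \<notin> K" for \<psi> g
  proof -
    (* Conjugation by k moves g inside the coset K g, and no two k give the same conjugate; so the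
       class sum of K times g is a sum of conjugates of g. *)
    let ?f = "\<lambda>k. k \<otimes> (g \<otimes> inv k \<otimes> inv g)"
    have fK: "?f k \<in> K" if "k \<in> K" for k
      using that g Ks subgroup.m_closed[OF Ks(1)] subgroup.m_inv_closed[OF Ks(1)]
      unfolding conj_closed_def by blast
    have fg: "?f k \<otimes> g = k \<otimes> g \<otimes> inv k" if "k \<in> K" for k
      using that g K_subset by (auto simp: m_assoc)
    have inj: "inj_on ?f K"
    proof (rule inj_onI)
      fix k l assume kl: "k \<in> K" "l \<in> K" "?f k = ?f l"
      have kG: "k \<in> carrier G" and lG: "l \<in> carrier G" using kl K_subset by auto
      have eq: "k \<otimes> g \<otimes> inv k = l \<otimes> g \<otimes> inv l" using fg[OF kl(1)] fg[OF kl(2)] kl(3) by simp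
      let ?q = "inv l \<otimes> k"
      have "?q \<otimes> g \<otimes> inv ?q = inv l \<otimes> (k \<otimes> g \<otimes> inv k) \<otimes> inv (inv l)"
        using conj_conj[of "inv l" k g] kG lG g by simp
      also have "\<dots> = g" unfolding eq using conj_conj[of "inv l" l g] lG g by simp
      finally have comm: "g \<otimes> ?q = ?q \<otimes> g" using kG lG g by (metis inv_solve_right' m_closed inv_closed)
      have "?q = \<one>"
      proof (rule ccontr)
        assume ne: "?q \<noteq> \<one>"
        have "?q \<in> K" using kl subgroup.m_closed[OF Ks(1)] subgroup.m_inv_closed[OF Ks(1)] by blast
        then show False using class_centralizer_K(2)[OF _ ne] comm g by (auto simp: centralizer_def)
      qed
      then show "k = l" using kG lG by (metis inv_equality inv_inv l_inv inv_closed)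
    qed
    have "?f ` K = K" by (rule endo_inj_surj[OF finite_K _ inj]) (use fK in blast)
    then have "bij_betw ?f K K" using inj by (simp add: bij_betw_def)
    then have "(\<Sum>s\<in>K. \<psi> (s \<otimes> g)) = (\<Sum>k\<in>K. \<psi> (?f k \<otimes> g))"
      by (rule sum.reindex_bij_betw[symmetric])
    also have "\<dots> = (\<Sum>k\<in>K. \<psi> g)"
      using fg Irr_conj[OF psi _ g(1)] K_subset by (intro sum.cong[OF refl]) auto
    also have "\<dots> = of_nat (Suc h) * \<psi> g" using card_K by simp
    finally have "\<psi> \<one> * (of_nat (Suc h) * \<psi> g) = 0"
      using Irr_class_sum[OF psi Ks(2) g(1)] sumK[OF psi] minus by simp
    then show ?thesis using Irr_one_nonzero[OF psi] by (simp del: of_nat_Suc)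
  qed
  have degh: "deg \<psi> = h" if psi: "\<psi> \<in> Irr G" and minus: "\<psi> \<one> + of_nat h * \<psi> a = 0" for \<psi>
  proof -
    have pa: "\<psi> a = - \<psi> \<one> / of_nat h" using minus h0 by (simp add: field_simps add_eq_0_iff)
    have "cN = (\<Sum>g\<in>carrier G. \<psi> g * \<psi> (inv g))" by (rule Irr_norm[OF psi, symmetric])
    also have "\<dots> = (\<Sum>g\<in>K. \<psi> g * \<psi> (inv g))"
      using fin K_subset vanish[OF psi minus] by (intro sum.mono_neutral_right) auto
    also have "\<dots> = \<psi> \<one> * \<psi> \<one> + (\<Sum>g\<in>conj_class a. \<psi> g * \<psi> (inv g))"
      unfolding Kins using one_class by simp
    also have "(\<Sum>g\<in>conj_class a. \<psi> g * \<psi> (inv g)) = (\<Sum>g\<in>conj_class a. \<psi> a * \<psi> a)"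
    proof (rule sum.cong[OF refl])
      fix g assume g: "g \<in> conj_class a"
      have gK: "g \<in> K" using g Kins by blast
      then have gG: "g \<in> carrier G" using K_subset by blast
      have "inv g \<in> K" using gK subgroup.m_inv_closed[OF Ks(1)] by blast
      moreover have "inv g \<noteq> \<one>" using g gG one_class by (metis inv_inv inv_one)
      ultimately have "inv g \<in> conj_class a" using Kins by blast
      then show "\<psi> g * \<psi> (inv g) = \<psi> a * \<psi> a" using Irr_class[OF psi aG] g by simp
    qed
    also have "\<dots> = of_nat h * (\<psi> a * \<psi> a)" using cc by simp
    finally have "cN = \<psi> \<one> * \<psi> \<one> + of_nat h * (\<psi> a * \<psi> a)" .
    then have "cN * of_nat h = (of_nat (deg \<psi>))\<^sup>2 * of_nat (Suc h)"
      unfolding pa Irr_one[OF psi] using h0 by (simp add: field_simps power2_eq_square)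
    then have "of_nat (Coset.order G * h) = (of_nat ((deg \<psi>)\<^sup>2 * Suc h) :: complex)"
      by (simp add: algebra_simps)
    then have "Coset.order G * h = (deg \<psi>)\<^sup>2 * Suc h" using of_nat_eq_iff by blast
    then have "(deg \<psi>)\<^sup>2 * Suc h = h\<^sup>2 * Suc h" unfolding order_eq by (simp add: power2_eq_square algebra_simps)
    then have "(deg \<psi>)\<^sup>2 = h\<^sup>2" by (simp only: mult_cancel2 nat.distinct simp_thms)
    then show ?thesis by (rule power2_eq_imp_eq) simp_all
  qed
  (* The characters for which the class sum of K acts as 0; on M the value at a is -1. *)
  define M where "M = {\<psi> \<in> Irr G. \<psi> \<one> + of_nat h * \<psi> a = 0}"
  have finM: "finite M" and MI: "M \<subseteq> Irr G" using finite_Irr by (auto simp: M_def)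
  have plus: "\<psi> a = \<psi> \<one>" if "\<psi> \<in> Irr G - M" for \<psi> using dich that by (auto simp: M_def)
  have split: "(\<Sum>\<psi>\<in>Irr G. F \<psi>) = (\<Sum>\<psi>\<in>Irr G - M. F \<psi>) + (\<Sum>\<psi>\<in>M. F \<psi>)" for F :: "_ \<Rightarrow> complex"
    by (rule sum.subset_diff[OF MI finite_Irr])
  let ?s = "\<Sum>\<psi>\<in>Irr G - M. \<psi> \<one> * \<psi> \<one>"
  have Mone: "\<psi> \<one> = of_nat h" "\<psi> a = - 1" if "\<psi> \<in> M" for \<psi>
  proof -
    show "\<psi> \<one> = of_nat h" using degh[of \<psi>] Irr_one[of \<psi>] that by (simp add: M_def)
    then have "of_nat h * (1 + \<psi> a) = 0" using that by (simp add: M_def algebra_simps)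
    then show "\<psi> a = - 1" using h0 by (simp add: add_eq_0_iff)
  qed
  have "(\<Sum>\<psi>\<in>M. \<psi> \<one> * \<psi> \<one>) = (\<Sum>\<psi>\<in>M. of_nat h * of_nat h)"
    by (rule sum.cong[OF refl]) (metis Mone(1))
  then have e1: "?s + of_nat (card M) * (of_nat h * of_nat h) = cN"
    using column_orthogonality_one[OF one_closed] split[of "\<lambda>\<psi>. \<psi> \<one> * \<psi> \<one>"] by simp
  have "(\<Sum>\<psi>\<in>M. \<psi> \<one> * \<psi> a) = (\<Sum>\<psi>\<in>M. of_nat h * (- 1))"
    by (rule sum.cong[OF refl]) (metis Mone)
  moreover have "(\<Sum>\<psi>\<in>Irr G - M. \<psi> \<one> * \<psi> a) = ?s"
    by (rule sum.cong[OF refl]) (metis plus)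
  ultimately have e2: "?s - of_nat (card M) * of_nat h = 0"
    using column_orthogonality_one[OF aG] a(2) split[of "\<lambda>\<psi>. \<psi> \<one> * \<psi> a"] by simp
  have "of_nat (card M * (h * Suc h)) = cN"
    using e1 e2 by (simp add: algebra_simps)
  then have "card M * (h * Suc h) = Coset.order G" using of_nat_eq_iff by blast
  then have "card M = 1" using order_eq h0 by simp
  then obtain \<chi> where M: "M = {\<chi>}" using card_1_singletonE by blast
  then have chiM: "\<chi> \<in> M" by simp
  have chi: "\<chi> \<in> Irr G" "deg \<chi> = h" using degh[of \<chi>] chiM by (auto simp: M_def)
  have chi_a: "\<chi> a \<noteq> \<chi> \<one>"
  proof
    assume "\<chi> a = \<chi> \<one>"
    then have "of_nat h = (- 1 :: complex)" using Mone[OF chiM] by simp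
    then have "of_nat (Suc h) = (0 :: complex)" by simp
    then show False using of_nat_neq_0 by blast
  qed
  have ord2: "2 < Coset.order G"
    using h_ge_2 mult_le_mono[of 3 "Suc h" 2 h] by (simp add: order_eq)
  show "CD1_group G"
    unfolding CD1_group_iff using ord2 aG a(2) chi chi_a plus M
    by (intro conjI bexI[of _ a] bexI[of _ \<chi>]) auto
  have "deg \<psi> \<le> deg \<chi>" if psi: "\<psi> \<in> Irr G" for \<psi>
  proof (cases "\<psi> = \<chi>")
    case False
    have "(deg \<chi>)\<^sup>2 + (deg \<psi>)\<^sup>2 \<le> Coset.order G" using deg_squares_pair_le[OF chi(1) psi] False by blast
    moreover have "Coset.order G = h\<^sup>2 + h" by (simp add: order_eq power2_eq_square)
    moreover have "h \<le> h\<^sup>2" by (simp add: power2_eq_square)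
    ultimately have "(deg \<psi>)\<^sup>2 \<le> (deg \<chi>)\<^sup>2" unfolding chi(2) by linarith
    then show ?thesis by simp
  qed simp
  then show "max_irr_degree G = h" using max_irr_degree_eq[OF chi(1)] chi(2) by simp
qed

end

section \<open>Consecutive prime powers\<close>

lemma odd_geometric_sum:
  fixes x :: int
  assumes "odd x"
  shows "odd (\<Sum>i<n. x ^ i) \<longleftrightarrow> odd n"
  using assms by (induction n) auto

lemma odd_dvd_power_of_two:
  fixes S :: int
  assumes "odd S" "S dvd 2 ^ t"
  shows "\<bar>S\<bar> = 1"
proof -
  have "coprime S (2 ^ t)" using assms(1) by simp
  then have "is_unit S" using assms(2) coprime_absorb_left by blast
  then show ?thesis by (simp add: zdvd1_eq)
qed

text \<open>For \<open>r = 2\<close> the number \<open>p\<^sup>n - 1\<close> is a power of two, and for odd \<open>r\<close> the number \<open>r\<^sup>t + 1\<close> is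
  one. In \<open>p\<^sup>n - 1\<close> with \<open>n\<close> odd, and in \<open>r\<^sup>t + 1\<close> with \<open>t\<close> odd, the
  cofactor of \<open>p - 1\<close> or \<open>r + 1\<close> is a sum of an odd number of odd terms and must be \<open>1\<close>. For \<open>n\<close> even,
  \<open>p\<^sup>n - 1\<close> is a product of two powers of two with difference \<open>2\<close>; for \<open>t\<close> even, \<open>r\<^sup>t + 1\<close> is \<open>2\<close> modulo \<open>4\<close>.\<close>

lemma prime_power_eq_Suc_prime_power:
  fixes p r n t :: nat
  assumes p: "prime p" and r: "prime r" and eq: "p ^ n = Suc (r ^ t)" and t: "0 < t"
  shows "(p = 2 \<and> t = 1) \<or> (r = 2 \<and> n = 1) \<or> r ^ t = 8"
proof (cases "r = 2")
  case True
  have rt: "2 \<le> r ^ t" using self_le_power[of 2 t] True t by simp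
  have n0: "n \<noteq> 0"
  proof
    assume "n = 0"
    then have "Suc (r ^ t) = 1" using eq by simp
    then show False using rt by linarith
  qed
  have "odd (p ^ n)" using eq True t by simp
  then have odd_p: "odd p" using n0 by simp
  then have p3: "3 \<le> p" using prime_ge_2_nat[OF p] by (cases "p = 2") auto
  show ?thesis
  proof (cases "even n")
    case even: True
    then obtain k where k: "n = 2 * k" by blast
    have pk: "p ^ k * p ^ k = Suc (2 ^ t)" using eq k True by (simp add: mult_2 power_add)
    define q where "q = p ^ k - 1"
    have qk: "p ^ k = Suc q" using p3 by (simp add: q_def)
    have prod: "q * (q + 2) = 2 ^ t" using pk unfolding qk by (simp add: algebra_simps)
    obtain i where i: "q = 2 ^ i" using divides_primepow_nat[OF two_is_prime_nat, of q t] prod by (metis dvd_triv_left)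
    obtain j where j: "q + 2 = 2 ^ j" using divides_primepow_nat[OF two_is_prime_nat, of "q + 2" t] prod by (metis dvd_triv_right)
    have "i = 1"
    proof (rule ccontr)
      assume "i \<noteq> 1"
      then consider "i = 0" | i' where "i = Suc (Suc i')" by (metis One_nat_def not0_implies_Suc)
      then show False
      proof cases
        case 1
        then have "(3::nat) = 2 ^ j" using i j by simp
        then have "odd ((2::nat) ^ j)" by (metis odd_numeral)
        then have "j = 0" by simp
        then show False using \<open>(3::nat) = 2 ^ j\<close> by simp
      next
        case 2
        then have ij: "(4::nat) * 2 ^ i' + 2 = 2 ^ j" using i j by simp
        show False
        proof (cases "j \<le> 1")
          case True
          then have "(2::nat) ^ j \<le> 2" by (cases j) auto
          moreover have "(1::nat) \<le> 2 ^ i'" by simp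
          ultimately show ?thesis using ij by linarith
        next
          case False
          then obtain j' where "j = Suc (Suc j')" by (metis One_nat_def Suc_le_mono le0 not0_implies_Suc)
          then have "(4::nat) * 2 ^ i' + 2 = 4 * 2 ^ j'" using ij by simp
          then show ?thesis by presburger
        qed
      qed
    qed
    then have "r ^ t = 8" using i prod True by simp
    then show ?thesis by simp
  next
    case odd: False
    show ?thesis
    proof (cases "n = 1")
      case n1: False
      let ?S = "\<Sum>i<n. (int p) ^ i"
      have "1 - int p ^ n = (1 - int p) * ?S" by (rule one_diff_power_eq)
      moreover have "int p ^ n = 1 + 2 ^ t" using eq True by (metis of_nat_Suc of_nat_numeral of_nat_power)
      ultimately have "2 ^ t = (int p - 1) * ?S" by (simp add: algebra_simps)
      then have "?S dvd 2 ^ t" by simp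
      moreover have "odd ?S" using odd_geometric_sum[of "int p" n] odd odd_p by simp
      ultimately have "\<bar>?S\<bar> = 1" by (rule odd_dvd_power_of_two[rotated])
      obtain n' where n': "n = Suc (Suc n')" using n0 n1 by (metis One_nat_def not0_implies_Suc)
      have "?S = 1 + int p * (\<Sum>i<Suc n'. int p ^ i)"
        unfolding n' by (subst sum.lessThan_Suc_shift) (simp add: sum_distrib_left distrib_left)
      moreover have "0 < (\<Sum>i<Suc n'. int p ^ i)" using p3 by (intro sum_pos) auto
      moreover have "0 < int p * (\<Sum>i<Suc n'. int p ^ i)" using p3 calculation(2) by (intro mult_pos_pos) auto
      ultimately show ?thesis using \<open>\<bar>?S\<bar> = 1\<close> by linarith
    qed (use True in simp)
  qed
next
  case False
  have r3: "3 \<le> r" using prime_ge_2_nat[OF r] False by simp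
  have odd_r: "odd r" using r False primes_dvd_imp_eq two_is_prime_nat by blast
  have n0: "n \<noteq> 0" using eq r3 by (intro notI) simp
  have "even (p ^ n)" using eq odd_r by simp
  then have p2: "p = 2" using p primes_dvd_imp_eq[OF two_is_prime_nat p] by (auto dest: prime_dvd_power_nat)
  have rt: "3 \<le> r ^ t" using r3 self_le_power[of r t] t by linarith
  have "odd t"
  proof
    assume "even t"
    then obtain k where k: "t = 2 * k" by blast
    have "odd (r ^ k)" using odd_r by simp
    then obtain u where u: "r ^ k = 2 * u + 1" using oddE by blast
    have "r ^ t = r ^ k * r ^ k" using k by (simp add: mult_2 power_add)
    then have "2 ^ n = 4 * (u * u + u) + (2::nat)" using eq p2 unfolding u by (simp add: algebra_simps)
    then have "n = 1"
    proof (cases "n \<le> 1")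
      case False
      then obtain n' where "n = Suc (Suc n')" by (metis One_nat_def Suc_le_mono le0 not0_implies_Suc)
      then have "4 * 2 ^ n' = 4 * (u * u + u) + (2::nat)" using \<open>2 ^ n = 4 * (u * u + u) + (2::nat)\<close> by simp
      then show ?thesis by presburger
    qed (use n0 in simp)
    then show False using eq p2 rt by simp
  qed
  let ?S = "\<Sum>i<t. (- int r) ^ i"
  have "1 - (- int r) ^ t = (1 - - int r) * ?S" by (rule one_diff_power_eq)
  moreover have "(- int r) ^ t = - (int r ^ t)" using \<open>odd t\<close> by simp
  ultimately have S: "1 + int r ^ t = (1 + int r) * ?S" by simp
  moreover have "2 ^ n = 1 + int r ^ t" using eq p2 by (metis of_nat_Suc of_nat_numeral of_nat_power)
  ultimately have "?S dvd 2 ^ n" by simp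
  moreover have "odd ?S" using odd_geometric_sum[of "- int r" t] odd_r \<open>odd t\<close> by simp
  ultimately have "\<bar>?S\<bar> = 1" by (rule odd_dvd_power_of_two[rotated])
  then have "?S = 1 \<or> ?S = -1" by linarith
  moreover have "0 < 1 + int r ^ t" by (simp add: add_pos_nonneg)
  ultimately have "int r ^ t = int r ^ 1" using S by auto
  then have "r ^ t = r ^ 1" by (metis of_nat_eq_iff of_nat_power)
  moreover have "1 < r" using r3 by simp
  ultimately have "t = 1" by (simp only: power_inject_exp)
  then show ?thesis using p2 by simp
qed

section \<open>The classification\<close>

context fin_group
begin

lemma subgroup_conjugate:
  assumes P: "subgroup P G" and g: "g \<in> carrier G"
  shows "subgroup ((\<lambda>x. g \<otimes> x \<otimes> inv g) ` P) G" "card ((\<lambda>x. g \<otimes> x \<otimes> inv g) ` P) = card P"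
proof -
  have PG: "P \<subseteq> carrier G" by (rule subgroup.subset[OF P])
  show "subgroup ((\<lambda>x. g \<otimes> x \<otimes> inv g) ` P) G"
  proof (rule subgroupI)
    fix y assume "y \<in> (\<lambda>x. g \<otimes> x \<otimes> inv g) ` P"
    then obtain x where x: "x \<in> P" "y = g \<otimes> x \<otimes> inv g" by blast
    show "inv y \<in> (\<lambda>x. g \<otimes> x \<otimes> inv g) ` P"
      by (rule image_eqI[of _ _ "inv x"])
        (use x PG conj_inv_elem[OF g] subgroup.m_inv_closed[OF P] in auto)
  next
    fix y y' assume "y \<in> (\<lambda>x. g \<otimes> x \<otimes> inv g) ` P" "y' \<in> (\<lambda>x. g \<otimes> x \<otimes> inv g) ` P"
    then obtain x x' where x: "x \<in> P" "y = g \<otimes> x \<otimes> inv g" "x' \<in> P" "y' = g \<otimes> x' \<otimes> inv g" by blast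
    then have "y \<otimes> y' = g \<otimes> (x \<otimes> x') \<otimes> inv g" using conj_mult[OF g subsetD[OF PG x(1)] subsetD[OF PG x(3)]] x(2,4) by simp
    moreover have "x \<otimes> x' \<in> P" by (rule subgroup.m_closed[OF P x(1,3)])
    ultimately show "y \<otimes> y' \<in> (\<lambda>x. g \<otimes> x \<otimes> inv g) ` P" by (rule image_eqI)
  qed (use PG g subgroup.one_closed[OF P] in auto)
  show "card ((\<lambda>x. g \<otimes> x \<otimes> inv g) ` P) = card P"
    by (intro card_image inj_onI) (use PG conj_inj[OF g] in blast)
qed

lemma subgroup_center: "subgroup (group_center G) G"
proof -
  have "group_center G = carrier G \<inter> (\<Inter>a\<in>carrier G. centralizer a)"
    by (auto simp: group_center_def centralizer_def)
  moreover have "subgroup (\<Inter> (centralizer ` carrier G)) G"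
    by (rule subgroups_Inter) (use subgroup_centralizer in auto)
  ultimately show ?thesis using subgroups_Inter_pair[OF subgroup_self] by simp
qed

lemma center_conj:
  assumes "z \<in> group_center G" "g \<in> carrier G"
  shows "g \<otimes> z \<otimes> inv g = z"
  using assms by (auto simp: group_center_def m_assoc) (metis inv_closed inv_solve_right m_assoc m_closed r_inv r_one)

lemma Irr_center_mult:
  assumes psi: "\<psi> \<in> Irr G" and z: "z \<in> group_center G" and h: "h \<in> carrier G"
  shows "\<psi> \<one> * \<psi> (z \<otimes> h) = \<psi> z * \<psi> h"
proof -
  have "conj_closed {z}" using z center_conj[OF z] by (auto simp: conj_closed_def group_center_def)
  from Irr_class_sum[OF psi this h] show ?thesis by simp
qed

end

context cd1_pair
begin

text \<open>Suppose that two distinct primes divide the order of \<open>N\<close>. Elements of these orders in \<open>N\<close> are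
  conjugate, because \<open>N - {1}\<close> is a single class, which is absurd. The argument is phrased with subgroups
  of prime order, so that coprimality of their orders gives the contradiction.\<close>

lemma card_N_prime_power:
  obtains p n where "prime p" "Suc m = p ^ n"
proof -
  let ?GN = "G\<lparr>carrier := N\<rparr>"
  have "Suc m \<noteq> 1" using m_pos by linarith
  then obtain p where p: "prime p" "p dvd Suc m" using prime_factor_nat by blast
  have finN: "finite N" using N_subset fin finite_subset by blast
  have cauchy: "\<exists>P. subgroup P G \<and> P \<subseteq> N \<and> card P = p" if p: "prime p" "p dvd Suc m" for p
  proof -
    obtain k where "Suc m = p * k" using p(2) by blast
    then have "Coset.order ?GN = p ^ 1 * k" using card_N by (simp add: Coset.order_def)
    then obtain P where P: "subgroup P ?GN" "card P = p"
      using sylow_thm[OF p(1) subgroup_imp_group[OF N_subgroup], of 1 k] finN by auto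
    then show ?thesis using incl_subgroup[OF N_subgroup P(1)] subgroup.subset[OF P(1)] by auto
  qed
  obtain q where q: "Suc m = p ^ multiplicity p (Suc m) * q" "\<not> p dvd q"
    using multiplicity_decompose'[of "Suc m" p] p(1) not_prime_unit by blast
  have "q = 1"
  proof (rule ccontr)
    assume "q \<noteq> 1"
    then obtain p' where p': "prime p'" "p' dvd q" using prime_factor_nat by blast
    have "p' dvd Suc m" using p'(2) q(1) by (metis dvd_mult)
    have "p \<noteq> p'" using p'(2) q(2) by blast
    then have cop: "coprime p p'" using p(1) p'(1) primes_coprime by blast
    obtain P where P: "subgroup P G" "P \<subseteq> N" "card P = p" using cauchy[OF p] by blast
    obtain P' where P': "subgroup P' G" "P' \<subseteq> N" "card P' = p'" using cauchy[OF p'(1) \<open>p' dvd Suc m\<close>] by blast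
    have "P \<noteq> {\<one>}" using P(3) p(1) by auto
    then obtain x where x: "x \<in> P" "x \<noteq> \<one>" using subgroup.one_closed[OF P(1)] by blast
    have "P' \<noteq> {\<one>}" using P'(3) p'(1) by auto
    then obtain y where y: "y \<in> P'" "y \<noteq> \<one>" using subgroup.one_closed[OF P'(1)] by blast
    have "x \<in> conj_class a" "y \<in> conj_class a" using x y P(2) P'(2) by (auto simp: N_def)
    then have "y \<in> conj_class x" using class_eq[OF aG] by simp
    then obtain g where g: "g \<in> carrier G" "y = g \<otimes> x \<otimes> inv g" by (auto simp: conj_class_def)
    let ?Q = "(\<lambda>x. g \<otimes> x \<otimes> inv g) ` P"
    have "?Q \<inter> P' = {\<one>}"
      using coprime_subgroups_Int[OF subgroup_conjugate(1)[OF P(1) g(1)] P'(1)]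
        subgroup_conjugate(2)[OF P(1) g(1)] P(3) P'(3) cop by simp
    then show False using y g(2) x(1) by blast
  qed
  then have "Suc m = p ^ multiplicity p (Suc m)" using q(1) by simp
  then show ?thesis by (rule that[OF p(1)])
qed

text \<open>By its order, \<open>R\<close> is a complement of \<open>N\<close>, and since the centralizer of \<open>x \<in> N - {1}\<close> has order \<open>m + 1\<close>,
  which is coprime to \<open>\<bar>R\<bar> = m\<close>, no nontrivial element of \<open>R\<close> commutes with \<open>x\<close>.\<close>

lemma frobenius_of_complement:
  assumes R: "subgroup R G" and cR: "card R = m" and ord: "Coset.order G = m * Suc m"
    and RN: "R \<inter> N = {\<one>}" and m1: "1 < m"
  shows "doubly_transitive_frobenius G"
proof -
  have RG: "R \<subseteq> carrier G" by (rule subgroup.subset[OF R])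
  then have finR: "finite R" using fin finite_subset by blast
  have finN: "finite N" using N_subset fin finite_subset by blast
  have cent_R: "R \<inter> centralizer x = {\<one>}" if x: "x \<in> N" "x \<noteq> \<one>" for x
  proof -
    have xa: "x \<in> conj_class a" using x by (simp add: N_def)
    have xG: "x \<in> carrier G" using x N_subset by blast
    have "m * card (centralizer x) = m * Suc m" using card_class_centralizer[OF xG] class_eq[OF aG xa] ord by simp
    then have "card (centralizer x) = Suc m" using m1 by (metis mult_left_cancel not_one_less_zero)
    then show ?thesis using coprime_subgroups_Int[OF R subgroup_centralizer[OF xG]] cR by simp
  qed
  have surj: "\<exists>n\<in>N. \<exists>s\<in>R. g = n \<otimes> s" if g: "g \<in> carrier G" for g
  proof -
    have "inj_on (\<lambda>(n,s). n \<otimes> s) (N \<times> R)"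
    proof (rule inj_onI, clarify)
      fix n s n' s' assume *: "n \<in> N" "s \<in> R" "n' \<in> N" "s' \<in> R" "n \<otimes> s = n' \<otimes> s'"
      have G: "n \<in> carrier G" "s \<in> carrier G" "n' \<in> carrier G" "s' \<in> carrier G" using * RG N_subset by auto
      have "inv n' \<otimes> (n \<otimes> s) \<otimes> inv s = inv n' \<otimes> (n' \<otimes> s') \<otimes> inv s" using *(5) by simp
      moreover have "inv n' \<otimes> (n' \<otimes> s') = s'" using G by (simp add: m_assoc[symmetric])
      moreover have "inv n' \<otimes> (n \<otimes> s) \<otimes> inv s = inv n' \<otimes> n" using G by (simp add: m_assoc)
      ultimately have eq: "inv n' \<otimes> n = s' \<otimes> inv s" by simp
      have "inv n' \<otimes> n \<in> N"
        using * subgroup.m_closed[OF N_subgroup] subgroup.m_inv_closed[OF N_subgroup] by blast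
      moreover have "s' \<otimes> inv s \<in> R" using * subgroup.m_closed[OF R] subgroup.m_inv_closed[OF R] by blast
      ultimately have "inv n' \<otimes> n = \<one>" "s' \<otimes> inv s = \<one>" using RN eq by auto
      then show "n = n' \<and> s = s'" using G by (metis inv_closed inv_equality inv_inv inv_comm)
    qed
    then have "card ((\<lambda>(n,s). n \<otimes> s) ` (N \<times> R)) = Coset.order G"
      using card_image card_N cR ord by (fastforce simp: card_cartesian_product)
    moreover have "(\<lambda>(n,s). n \<otimes> s) ` (N \<times> R) \<subseteq> carrier G" using RG N_subset by auto
    ultimately have "(\<lambda>(n,s). n \<otimes> s) ` (N \<times> R) = carrier G"
      using card_subset_eq[OF fin] by (simp add: Coset.order_def)
    then have "g \<in> (\<lambda>(n,s). n \<otimes> s) ` (N \<times> R)" using g by simp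
    then show ?thesis by auto
  qed
  (* Write g = n s. If x in R equals y conjugated by g, then x and s y s^-1 agree modulo N, hence are
     equal, and x commutes with n. *)
  have disj: "R \<inter> (\<lambda>h. g \<otimes> h \<otimes> inv g) ` R = {\<one>}" if g: "g \<in> carrier G - R" for g
  proof -
    have gG: "g \<in> carrier G" using g by blast
    obtain n s where ns: "n \<in> N" "s \<in> R" "g = n \<otimes> s" using surj[OF gG] by blast
    have nG: "n \<in> carrier G" and sG: "s \<in> carrier G" using ns RG N_subset by auto
    have n1: "n \<noteq> \<one>" using ns g sG by auto
    have "x = \<one>" if x: "x \<in> R" "y \<in> R" "x = g \<otimes> y \<otimes> inv g" for x y
    proof -
      have xG: "x \<in> carrier G" and yG: "y \<in> carrier G" using x RG by auto
      let ?y = "s \<otimes> y \<otimes> inv s"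
      have yR: "?y \<in> R" using x(2) ns(2) subgroup.m_closed[OF R] subgroup.m_inv_closed[OF R] by blast
      have yyG: "?y \<in> carrier G" using yR RG by blast
      have xn: "x = n \<otimes> ?y \<otimes> inv n" using x(3) ns(3) conj_conj[OF nG sG yG] by simp
      have "?y \<otimes> inv n \<otimes> inv ?y \<in> N"
        using N_conj_closed yyG subgroup.m_inv_closed[OF N_subgroup ns(1)] unfolding conj_closed_def by blast
      then have "n \<otimes> (?y \<otimes> inv n \<otimes> inv ?y) \<in> N" using ns(1) subgroup.m_closed[OF N_subgroup] by blast
      moreover have "n \<otimes> (?y \<otimes> inv n \<otimes> inv ?y) = x \<otimes> inv ?y"
        unfolding xn using nG yyG by (simp add: m_assoc del: inv_mult_group)
      moreover have "x \<otimes> inv ?y \<in> R" using x(1) yR subgroup.m_closed[OF R] subgroup.m_inv_closed[OF R] by blast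
      ultimately have "x \<otimes> inv ?y = \<one>" using RN by auto
      then have "x = ?y" using xG yyG by (metis inv_closed inv_equality inv_inv)
      then have "x = n \<otimes> x \<otimes> inv n" using xn by simp
      then have "x \<otimes> n = n \<otimes> x" using xG nG by (metis inv_solve_right m_closed)
      then have "x \<in> R \<inter> centralizer n" using x(1) xG by (simp add: centralizer_def)
      then show ?thesis using cent_R[OF ns(1) n1] by simp
    qed
    moreover have "\<one> \<in> (\<lambda>h. g \<otimes> h \<otimes> inv g) ` R"
      by (rule image_eqI[of _ _ \<one>]) (use gG subgroup.one_closed[OF R] in auto)
    ultimately show ?thesis using subgroup.one_closed[OF R] by blast
  qed
  have "R \<noteq> {\<one>}" using cR m1 by auto
  moreover have "R \<noteq> carrier G" using cR ord m1 by (auto simp: Coset.order_def)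
  ultimately have comp: "frobenius_complement G R"
    unfolding frobenius_complement_def conjugate_coset using R disj by blast
  have "card (frobenius_kernel G R) * m = Suc m * m" using card_frobenius_kernel[OF comp] cR ord by simp
  then have "card (frobenius_kernel G R) = Suc m" using m1 by (metis mult_right_cancel not_one_less_zero)
  then show ?thesis unfolding doubly_transitive_frobenius_def using comp cR by auto
qed

text \<open>For \<open>m = 1\<close> the subgroup \<open>N\<close> is central of order two. It is the whole centre, because no irreducible
  character vanishes at a central element whereas \<open>\<chi>\<close> vanishes off \<open>N\<close>.\<close>

lemma two_group_case:
  assumes m1: "m = 1" and d: "d = 2 ^ s"
  shows "p_group 2 G \<and> central_type G \<and> card (group_center G) = 2 \<and> Coset.order G = 2 ^ (2 * s + 1)"
proof -
  have "d\<^sup>2 * Suc 1 = Coset.order G" using degree_equation m1 by simp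
  then have ord: "Coset.order G = 2 ^ (2 * s + 1)" unfolding d by (simp add: power_mult[symmetric] mult.commute)
  have "conj_class a = {a}" using m1 self_in_class[OF aG] by (metis card_1_singletonE One_nat_def singletonD)
  then have "g \<otimes> a \<otimes> inv g = a" if "g \<in> carrier G" for g using that by (auto simp: conj_class_def)
  then have "a \<otimes> g = g \<otimes> a" if "g \<in> carrier G" for g
    using that aG by (metis inv_solve_right m_closed)
  then have "N \<subseteq> group_center G" using \<open>conj_class a = {a}\<close> aG by (auto simp: N_def group_center_def)
  moreover have "z \<in> N" if z: "z \<in> group_center G" for z
  proof (rule ccontr)
    assume zN: "z \<notin> N"
    have zG: "z \<in> carrier G" using z by (simp add: group_center_def)
    have "\<chi> \<one> * \<chi> (z \<otimes> inv z) = \<chi> z * \<chi> (inv z)" using Irr_center_mult[OF chi z, of "inv z"] zG by simp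
    then show False using chi_vanishes[OF zG zN] zG Irr_one_nonzero[OF chi] by simp
  qed
  ultimately have Z: "group_center G = N" by blast
  have cZ: "card (group_center G) = 2" using Z card_N m1 by simp
  have "card (rcosets\<^bsub>G\<^esub> (group_center G)) * 2 = Coset.order G"
    using lagrange[OF subgroup_center] cZ by simp
  then have "card (rcosets\<^bsub>G\<^esub> (group_center G)) = d\<^sup>2" using \<open>d\<^sup>2 * Suc 1 = Coset.order G\<close> by simp
  then have "of_nat (card (rcosets\<^bsub>G\<^esub> (group_center G))) = (\<chi> \<one>)\<^sup>2" using Irr_one[OF chi] by simp
  then show ?thesis using ord cZ chi unfolding central_type_def p_group_def by blast
qed

lemma classification:
  assumes ord2: "2 < Coset.order G" and r: "prime r" and s: "0 < s" and d: "d = r ^ s"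
  shows "((p_group 2 G \<and> central_type G \<and> card (group_center G) = 2 \<and>
             (\<exists>s::nat. 0 < s \<and> Coset.order G = 2 ^ (2 * s + 1))) \<or>
          (\<exists>(n::nat) (r::nat). r = 2 ^ n - 1 \<and> prime r \<and>
             doubly_transitive_frobenius G \<and> Coset.order G = (2 ^ n - 1) * 2 ^ n) \<or>
          (doubly_transitive_frobenius G \<and> Coset.order G = (3 ^ 2 - 1) * 3 ^ 2) \<or>
          (\<exists>(n::nat) (p::nat). 1 \<le> n \<and> p = 2 ^ n + 1 \<and> prime p \<and>
             doubly_transitive_frobenius G \<and> Coset.order G = (p - 1) * p))"
proof (cases "m = 1 \<and> r = 2")
  case True
  then show ?thesis using two_group_case[of s] d s by blast
next
  case False
  obtain e where e: "0 < e" "d = m * e" "Coset.order G = e\<^sup>2 * m * Suc m" by (rule cd1_arith)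
  have "m dvd r ^ s" "e dvd r ^ s" using e(2) d by (metis dvd_triv_left, metis dvd_triv_right)
  then obtain i j where ij: "m = r ^ i" "e = r ^ j" using divides_primepow_nat[OF r] by blast
  (* If r divides m + 1, it does not divide m, which is a power of r; so m = 1 and r = 2. *)
  have "coprime r (Suc m)"
  proof (rule ccontr)
    assume "\<not> coprime r (Suc m)"
    then have dv: "r dvd Suc m" using r prime_imp_coprime by blast
    have "i = 0"
    proof (rule ccontr)
      assume "i \<noteq> 0"
      then have "r dvd m" using ij(1) by (metis dvd_power neq0_conv)
      then have "r dvd 1" using dv by (metis Suc_eq_plus1 dvd_add_right_iff)
      then show False using r by simp
    qed
    then have "m = 1" using ij(1) by simp
    moreover have "r dvd 2" using dv \<open>m = 1\<close> by (simp only: Suc_1)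
    then have "r = 2" by (rule primes_dvd_imp_eq[OF r two_is_prime_nat])
    ultimately show False using False by blast
  qed
  let ?q = "e\<^sup>2 * m"
  have q: "?q = r ^ (2 * j + i)" unfolding ij by (simp add: power_add power_mult[symmetric] mult.commute)
  obtain R where R: "subgroup R G" "card R = ?q"
    using sylow_thm[OF r is_group, of "2 * j + i" "Suc m"] e(3) q fin by auto
  have RN: "R \<inter> N = {\<one>}"
    by (rule coprime_subgroups_Int[OF R(1) N_subgroup])
      (use \<open>coprime r (Suc m)\<close> in \<open>simp only: R(2) q card_N coprime_power_left_iff simp_thms\<close>)
  (* The order of R divides the degree of \<chi>: e^2 m divides e m. *)
  have "?q dvd d" using card_complement_dvd[OF R(1) RN] R(2) by simp
  then have "?q \<le> d" using d_pos by (rule dvd_imp_le)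
  then have "e * (e * m) \<le> 1 * (e * m)" using e(2) by (simp add: power2_eq_square mult_ac)
  then have "e \<le> 1" using e(1) m_pos by (metis mult_le_cancel2 nat_0_less_mult_iff)
  then have e1: "e = 1" using e(1) by simp
  have ord: "Coset.order G = m * Suc m" and cR: "card R = m" using e(3) e1 R(2) by auto
  have m1: "1 < m"
  proof (rule ccontr)
    assume "\<not> 1 < m"
    then have "m = 1" using m_pos by linarith
    then have "Coset.order G = 2" using ord by simp
    then show False using ord2 by simp
  qed
  have i0: "0 < i" using m1 ij(1) by (cases i) auto
  have dt: "doubly_transitive_frobenius G" by (rule frobenius_of_complement[OF R(1) cR ord RN m1])
  obtain p n where p: "prime p" "Suc m = p ^ n" by (rule card_N_prime_power)
  then have "p ^ n = Suc (r ^ i)" using ij(1) by simp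
  from prime_power_eq_Suc_prime_power[OF p(1) r this i0]
  consider "p = 2" "i = 1" | "r = 2" "n = 1" | "r ^ i = 8" by blast
  then show ?thesis
  proof cases
    case 1
    then have "m = r" "Suc m = 2 ^ n" using ij p by auto
    then have "r = 2 ^ n - 1" "Coset.order G = (2 ^ n - 1) * 2 ^ n" using ord by (metis diff_Suc_1, metis diff_Suc_1)
    then show ?thesis using r dt by blast
  next
    case 2
    then have "Suc m = p" "m = 2 ^ i" using ij p by auto
    then have "p = 2 ^ i + 1" "Coset.order G = (p - 1) * p" using ord by auto
    then show ?thesis using p(1) dt i0 by (metis One_nat_def Suc_leI)
  next
    case 3
    then have "Coset.order G = (3 ^ 2 - 1) * 3 ^ 2" using ord ij(1) by simp
    then show ?thesis using dt by blast
  qed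
qed

end

text \<open>Let \<open>A\<close> and \<open>B\<close> consist of the irreducible characters whose value at the central involution \<open>z\<close> is the
  degree and minus the degree. The columns of the identity and of \<open>z\<close> show that the squared degrees
  sum to \<open>\<bar>G\<bar> / 2\<close> over each of \<open>A\<close> and \<open>B\<close>. The trivial character is in \<open>A\<close>, so the character \<open>\<chi>\<close> with
  \<open>(\<chi> 1)\<^sup>2 = \<bar>G\<bar> / 2\<close> is in \<open>B\<close>, and it is alone there.\<close>

lemma (in fin_group) central_type_CD1:
  assumes ct: "central_type G" and cZ: "card (group_center G) = 2"
    and s: "0 < s" and ord: "Coset.order G = 2 ^ (2 * s + 1)"
  shows "CD1_group G \<and> max_irr_degree G = 2 ^ s"
proof -
  note Z = subgroup_center
  obtain x y where "group_center G = {x, y}" "x \<noteq> y" using cZ by (auto simp: card_2_iff)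
  then obtain z where z: "group_center G = {\<one>, z}" "z \<noteq> \<one>"
    using subgroup.one_closed[OF Z] by (cases "x = \<one>") (auto simp: insert_commute)
  then have zZ: "z \<in> group_center G" by simp
  then have zG: "z \<in> carrier G" by (simp add: group_center_def)
  have "z \<otimes> z \<in> {\<one>, z}" using subgroup.m_closed[OF Z zZ zZ] z(1) by simp
  then have zz: "z \<otimes> z = \<one>" using zG z(2) by auto
  obtain \<chi> where chi: "\<chi> \<in> Irr G" "of_nat (card (rcosets\<^bsub>G\<^esub> (group_center G))) = (\<chi> \<one>)\<^sup>2"
    using ct unfolding central_type_def by blast
  have "of_nat (card (rcosets\<^bsub>G\<^esub> (group_center G))) = (of_nat ((deg \<chi>)\<^sup>2) :: complex)"
    using chi Irr_one by simp
  then have "card (rcosets\<^bsub>G\<^esub> (group_center G)) = (deg \<chi>)\<^sup>2" using of_nat_eq_iff by blast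
  then have degsq: "(deg \<chi>)\<^sup>2 * 2 = Coset.order G" using lagrange[OF Z] cZ by simp
  then have "(deg \<chi>)\<^sup>2 = (2 ^ s)\<^sup>2" using ord by (simp add: power_mult[symmetric] mult.commute)
  then have degchi: "deg \<chi> = 2 ^ s" by (rule power2_eq_imp_eq) simp_all
  define A where "A = {\<psi> \<in> Irr G. \<psi> z = \<psi> \<one>}"
  define B where "B = Irr G - A"
  have fin_AB: "finite A" "finite B" "A \<subseteq> Irr G" "B \<subseteq> Irr G" using finite_Irr by (auto simp: A_def B_def)
  have minus: "\<psi> z = - \<psi> \<one>" if "\<psi> \<in> B" for \<psi>
  proof -
    have psi: "\<psi> \<in> Irr G" "\<psi> z \<noteq> \<psi> \<one>" using that by (auto simp: A_def B_def)
    have "\<psi> \<one> * \<psi> \<one> = \<psi> z * \<psi> z" using Irr_center_mult[OF psi(1) zZ zG] zz by simp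
    then have "\<psi> z = \<psi> \<one> \<or> \<psi> z = - \<psi> \<one>" by (metis square_eq_iff)
    then show ?thesis using psi(2) by blast
  qed
  have split: "(\<Sum>\<psi>\<in>Irr G. F \<psi>) = (\<Sum>\<psi>\<in>A. F \<psi>) + (\<Sum>\<psi>\<in>B. F \<psi>)" for F :: "_ \<Rightarrow> 'x::comm_monoid_add"
    unfolding B_def using sum.subset_diff[OF fin_AB(3) finite_Irr, of F] by (simp add: add.commute)
  let ?P = "\<Sum>\<psi>\<in>A. (deg \<psi>)\<^sup>2" and ?Q = "\<Sum>\<psi>\<in>B. (deg \<psi>)\<^sup>2"
  have PQ: "?P + ?Q = Coset.order G" using sum_deg_squares split[of "\<lambda>\<psi>. (deg \<psi>)\<^sup>2"] by simp
  have "(\<Sum>\<psi>\<in>A. \<psi> \<one> * \<psi> z) = of_nat ?P"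
    unfolding of_nat_sum
  proof (rule sum.cong[OF refl])
    fix \<psi> assume "\<psi> \<in> A"
    then have "\<psi> \<in> Irr G" "\<psi> z = \<psi> \<one>" by (auto simp: A_def)
    then show "\<psi> \<one> * \<psi> z = of_nat ((deg \<psi>)\<^sup>2)" using Irr_one[of \<psi>] by (simp add: power2_eq_square)
  qed
  moreover have "(\<Sum>\<psi>\<in>B. \<psi> \<one> * \<psi> z) = - of_nat ?Q"
    unfolding of_nat_sum sum_negf[symmetric]
  proof (rule sum.cong[OF refl])
    fix \<psi> assume "\<psi> \<in> B"
    then have "\<psi> \<in> Irr G" "\<psi> z = - \<psi> \<one>" using minus by (auto simp: B_def)
    then show "\<psi> \<one> * \<psi> z = - of_nat ((deg \<psi>)\<^sup>2)" using Irr_one[of \<psi>] by (simp add: power2_eq_square)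
  qed
  moreover have "(\<Sum>\<psi>\<in>A. \<psi> \<one> * \<psi> z) + (\<Sum>\<psi>\<in>B. \<psi> \<one> * \<psi> z) = 0"
    using column_orthogonality_one[OF zG] z(2) split[of "\<lambda>\<psi>. \<psi> \<one> * \<psi> z"] by simp
  ultimately have "of_nat ?P = (of_nat ?Q :: complex)" by simp
  then have "?P = ?Q" using of_nat_eq_iff by blast
  then have P: "?P = (deg \<chi>)\<^sup>2" and Q: "?Q = (deg \<chi>)\<^sup>2" using PQ degsq by auto
  let ?one = "\<lambda>g\<in>carrier G. 1 :: complex"
  have oneA: "?one \<in> A" using trivial_character zG by (simp add: A_def)
  have "deg ?one = 1" by (simp add: deg_def)
  have chiB: "\<chi> \<in> B"
  proof (rule ccontr)
    assume "\<chi> \<notin> B"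
    then have "\<chi> \<in> A" using chi by (simp add: B_def)
    moreover have "1 < (2::nat) ^ s" using s by (intro one_less_power) auto
    then have "\<chi> \<noteq> ?one" using degchi \<open>deg ?one = 1\<close> by (intro notI) simp
    ultimately have "(\<Sum>\<psi>\<in>{\<chi>, ?one}. (deg \<psi>)\<^sup>2) \<le> ?P" using oneA fin_AB by (intro sum_mono2) auto
    then show False using P \<open>\<chi> \<noteq> ?one\<close> \<open>deg ?one = 1\<close> by simp
  qed
  have B1: "\<psi> = \<chi>" if "\<psi> \<in> B" for \<psi>
  proof (rule ccontr)
    assume "\<psi> \<noteq> \<chi>"
    then have "(\<Sum>\<psi>\<in>{\<psi>, \<chi>}. (deg \<psi>)\<^sup>2) \<le> ?Q" using that chiB fin_AB by (intro sum_mono2) auto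
    then show False using Q \<open>\<psi> \<noteq> \<chi>\<close> deg_pos[of \<psi>] that fin_AB by auto
  qed
  have "2 ^ 2 \<le> (2::nat) ^ (2 * s + 1)" using s by (intro power_increasing) auto
  then have ord2: "2 < Coset.order G" using ord by simp
  have chi_z: "\<chi> z \<noteq> \<chi> \<one>" using chiB by (simp add: A_def B_def)
  have others: "\<psi> z = \<psi> \<one>" if "\<psi> \<in> Irr G - {\<chi>}" for \<psi>
    using B1[of \<psi>] that by (auto simp: A_def B_def)
  have "CD1_group G"
    unfolding CD1_group_iff using ord2 zG z(2) chi(1) chi_z others
    by (intro conjI bexI[of _ z] bexI[of _ \<chi>]) auto
  moreover have "deg \<psi> \<le> deg \<chi>" if psi: "\<psi> \<in> Irr G" for \<psi>
  proof (cases "\<psi> = \<chi>")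
    case False
    have "\<psi> \<in> A" using B1 False psi by (auto simp: B_def)
    then have "(deg \<psi>)\<^sup>2 \<le> ?P" using fin_AB by (intro member_le_sum) auto
    then have "(deg \<psi>)\<^sup>2 \<le> (deg \<chi>)\<^sup>2" using P by simp
    then show ?thesis by simp
  qed simp
  ultimately show ?thesis using max_irr_degree_eq[OF chi(1)] degchi by simp
qed

lemma (in fin_group) doubly_transitive_frobenius_CD1:
  assumes "doubly_transitive_frobenius G" and ord: "Coset.order G = k * Suc k"
  shows "CD1_group G \<and> max_irr_degree G = k"
proof -
  obtain H where H: "frobenius_complement G H" "card H = card (frobenius_kernel G H) - 1"
    using assms(1) unfolding doubly_transitive_frobenius_def by blast
  interpret dt_frobenius G H by unfold_locales (use H in auto)
  have "h * Suc h = k * Suc k" using ord order_eq by simp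
  then have "h = k"
  proof (cases h k rule: linorder_cases)
    case less
    then have "h * Suc h < k * Suc k" by (intro mult_strict_mono) auto
    then show ?thesis using \<open>h * Suc h = k * Suc k\<close> by simp
  next
    case greater
    then have "k * Suc k < h * Suc h" by (intro mult_strict_mono) auto
    then show ?thesis using \<open>h * Suc h = k * Suc k\<close> by simp
  qed
  then show ?thesis using CD1_and_degree by simp
qed

theorem theorem5:
  fixes G :: "('a, 'b) monoid_scheme"
  assumes "group G" and "finite (carrier G)"
  shows "(CD1_group G \<and>
            (\<exists>(r::nat) (s::nat). prime r \<and> 0 < s \<and> max_irr_degree G = r ^ s)) \<longleftrightarrow>
         ((p_group 2 G \<and> central_type G \<and> card (group_center G) = 2 \<and>
             (\<exists>s::nat. 0 < s \<and> Coset.order G = 2 ^ (2 * s + 1))) \<or>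
          (\<exists>(n::nat) (r::nat). r = 2 ^ n - 1 \<and> prime r \<and>
             doubly_transitive_frobenius G \<and> Coset.order G = (2 ^ n - 1) * 2 ^ n) \<or>
          (doubly_transitive_frobenius G \<and> Coset.order G = (3 ^ 2 - 1) * 3 ^ 2) \<or>
          (\<exists>(n::nat) (p::nat). 1 \<le> n \<and> p = 2 ^ n + 1 \<and> prime p \<and>
             doubly_transitive_frobenius G \<and> Coset.order G = (p - 1) * p))"
    (is "?L \<longleftrightarrow> ?C1 \<or> ?C2 \<or> ?C3 \<or> ?C4")
proof
  interpret fin_group G using assms by (simp add: fin_group_def fin_group_axioms_def)
  assume L: ?L
  then obtain a \<chi> where "2 < Coset.order G" and *: "a \<in> carrier G" "a \<noteq> \<one>\<^bsub>G\<^esub>" "\<chi> \<in> Irr G"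
    "\<chi> a \<noteq> \<chi> \<one>\<^bsub>G\<^esub>" "\<forall>\<psi>\<in>Irr G - {\<chi>}. \<psi> a = \<psi> \<one>\<^bsub>G\<^esub>"
    unfolding CD1_group_iff by blast
  interpret cd1_pair G a \<chi> by unfold_locales (use * in blast)+
  obtain r s where "prime r" "0 < s" "max_irr_degree G = r ^ s" using L by blast
  then show "?C1 \<or> ?C2 \<or> ?C3 \<or> ?C4"
    using classification[OF \<open>2 < Coset.order G\<close>, of r s] max_irr_degree_cd1 by simp
next
  interpret fin_group G using assms by (simp add: fin_group_def fin_group_axioms_def)
  have L: ?L if "CD1_group G \<and> max_irr_degree G = r ^ s" "prime r" "0 < s" for r s
    using that by blast
  assume "?C1 \<or> ?C2 \<or> ?C3 \<or> ?C4"
  then consider ?C1 | ?C2 | ?C3 | ?C4 by blast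
  then show ?L
  proof cases
    case 1
    then obtain s where s: "central_type G" "card (group_center G) = 2" "0 < s"
      "Coset.order G = 2 ^ (2 * s + 1)" by auto
    show ?thesis by (rule L[OF central_type_CD1[OF s] two_is_prime_nat s(3)])
  next
    case 2
    then obtain n r :: nat where r: "r = 2 ^ n - 1" "prime r" "doubly_transitive_frobenius G"
      "Coset.order G = (2 ^ n - 1) * 2 ^ n" by blast
    have "Suc r = 2 ^ n" using r(1) by simp
    then have "Coset.order G = r * Suc r" using r(1,4) by simp
    then have "CD1_group G \<and> max_irr_degree G = r ^ 1"
      using doubly_transitive_frobenius_CD1[OF r(3)] by simp
    then show ?thesis by (rule L) (use r(2) in simp_all)
  next
    case 3
    then have "CD1_group G \<and> max_irr_degree G = 8"
      using doubly_transitive_frobenius_CD1[of 8] by simp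
    then have "CD1_group G \<and> max_irr_degree G = 2 ^ 3" by simp
    then show ?thesis by (rule L) simp_all
  next
    case 4
    then obtain n p :: nat where p: "1 \<le> n" "p = 2 ^ n + 1" "prime p" "doubly_transitive_frobenius G"
      "Coset.order G = (p - 1) * p" by blast
    then have "CD1_group G \<and> max_irr_degree G = 2 ^ n"
      using doubly_transitive_frobenius_CD1[OF p(4), of "2 ^ n"] by simp
    then show ?thesis by (rule L) (use p(1) in simp_all)
  qed
qed

end
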